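(* Let $\alpha,\beta>-1$, let $x\in(0,1)$, let $(q_n)$ be a sequence in $(0,1)$, and let $f$ be a real function which admits a second derivative at the point $x$. Suppose that one of the following holds: 1. $f$ is bounded on $[0,1]$ and $\lim_{n\to\infty}q_n=1$; 2. there exist real numbers $\alpha',\beta'\ge0$ and $\kappa'>0$ such that $|t^{\alpha'}(1-t)^{\beta'}f(t)|\le\kappa'$ for all $t\in(0,1)$, $\alpha'<\alpha+1$, $\beta'<\beta+1$, and the sequence $(q_n)$ has property $S$. Then $$\lim_{n\to\infty}[n]_{q_n}\left(M_{n,q_n}^{\alpha,\beta}f(x)-f(x)\right)=\frac{\dfrac{d}{dx}\left(x^{\alpha+1}(1-x)^{\beta+1}f'(x)\right)}{x^\alpha(1-x)^\beta}.$$
   Context: Property $S$ of a sequence $(q_n)$ in $(0,1)$: there exist $N\in\mathbb N$ and $c>0$ such that $1-q_n<c/n$ for all $n>N$. For $q\in(0,1)$ and real $a$, $[a]_q=\frac{1-q^a}{1-q}$; $[n]_q!=\prod_{j=1}^n[j]_q$; $\begin{bmatrix}n\\k\end{bmatrix}_q=\frac{[n]_q!}{[k]_q!\,[n-k]_q!}$. For real $a$, $(1-x)_q^a=\prod_{j=0}^\infty\frac{1-q^jx}{1-q^{j+a}x}$. The Jackson integral is $\int_0^ah(t)\,d_qt=a(1-q)\sum_{i\ge0}q^ih(q^ia)$. Put $b_{n,k,q}(x)=\begin{bmatrix}n\\k\end{bmatrix}_qx^k(1-x)_q^{n-k}$, $0\le k\le n$, and $$M_{n,q}^{\alpha,\beta}f(x)=\sum_{k=0}^n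 f_{n,k,q}^{\alpha,\beta}\,b_{n,k,q}(x),\qquad f_{n,k,q}^{\alpha,\beta}=\frac{\int_0^1t^{k+\alpha}(1-qt)_q^{n-k+\beta}f(q^{\beta+1}t)\,d_qt}{\int_0^1t^{k+\alpha}(1-qt)_q^{n-k+\beta}\,d_qt}.$$ Only the values of $f$ in $(0,1)$ are used in defining $M_{n,q}^{\alpha,\beta}f$. *)

theory Defs
  imports "HOL-Analysis.Analysis"
begin

text \<open>Real powers are written with \<open>powr\<close>; below \<open>0 < q < 1\<close> throughout.\<close>

definition q_number :: "real \<Rightarrow> real \<Rightarrow> real" where
  "q_number q a = (1 - q powr a) / (1 - q)"

definition q_fact :: "real \<Rightarrow> nat \<Rightarrow> real" where
  "q_fact q n = (\<Prod>j=1..n. q_number q (real j))"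

definition q_binomial :: "real \<Rightarrow> nat \<Rightarrow> nat \<Rightarrow> real" where
  "q_binomial q n k = q_fact q n / (q_fact q k * q_fact q (n - k))"

text \<open>
  \<open>q_shifted_power q x a\<close> is \<open>(1 - x)\<close> raised to the power \<open>a\<close> in the \<open>q\<close>-sense. The
  infinite product converges, with nonzero denominators, when \<open>0 \<le> x\<close>, \<open>x \<le> 1\<close> and
  \<open>q powr a * x < 1\<close>, which covers every use below.
\<close>
definition q_shifted_power :: "real \<Rightarrow> real \<Rightarrow> real \<Rightarrow> real" where
  "q_shifted_power q x a = (\<Prod>j. (1 - q ^ j * x) / (1 - q powr (real j + a) * x))"

text \<open>The Jackson integral of \<open>h\<close> from \<open>0\<close> to \<open>a\<close>.\<close>
definition jackson_integral :: "real \<Rightarrow> real \<Rightarrow> (real \<Rightarrow> real) \<Rightarrow> real" where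
  "jackson_integral q a h = a * (1 - q) * (\<Sum>i. q ^ i * h (q ^ i * a))"

definition q_bernstein_basis :: "nat \<Rightarrow> nat \<Rightarrow> real \<Rightarrow> real \<Rightarrow> real" where
  "q_bernstein_basis n k q x = q_binomial q n k * x ^ k * q_shifted_power q x (real (n - k))"

definition q_jacobi_coeff ::
  "real \<Rightarrow> real \<Rightarrow> nat \<Rightarrow> nat \<Rightarrow> real \<Rightarrow> (real \<Rightarrow> real) \<Rightarrow> real" where
  "q_jacobi_coeff \<alpha> \<beta> n k q f =
     jackson_integral q 1 (\<lambda>t. t powr (real k + \<alpha>)
        * q_shifted_power q (q * t) (real (n - k) + \<beta>) * f (q powr (\<beta> + 1) * t))
     / jackson_integral q 1 (\<lambda>t. t powr (real k + \<alpha>)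
        * q_shifted_power q (q * t) (real (n - k) + \<beta>))"

definition q_durrmeyer ::
  "real \<Rightarrow> real \<Rightarrow> nat \<Rightarrow> real \<Rightarrow> (real \<Rightarrow> real) \<Rightarrow> real \<Rightarrow> real" where
  "q_durrmeyer \<alpha> \<beta> n q f x =
     (\<Sum>k=0..n. q_jacobi_coeff \<alpha> \<beta> n k q f * q_bernstein_basis n k q x)"

definition property_S :: "(nat \<Rightarrow> real) \<Rightarrow> bool" where
  "property_S q \<longleftrightarrow> (\<exists>(N::nat) (c::real). c > 0 \<and> (\<forall>n>N. 1 - q n < c / real n))"

text \<open>
  A second derivative at a point requires the first derivative in a neighbourhood of it;
  \<open>deriv\<close> is total, so this has to be said explicitly.
\<close>
definition has_second_derivative_at :: "(real \<Rightarrow> real) \<Rightarrow> real \<Rightarrow> bool" where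
  "has_second_derivative_at f x \<longleftrightarrow>
     (\<forall>\<^sub>F t in nhds x. f differentiable at t) \<and> deriv f differentiable at x"

end

theory Submission
  imports Defs "HOL-Real_Asymp.Real_Asymp"
begin

text \<open>
  Put \<open>[a]\<close> for the \<open>q\<close>-number of \<open>a\<close> and \<open>t\<^sub>i = q\<^bsup>\<beta>+1\<^esup> q\<^bsup>i\<^esup>\<close>. For fixed \<open>k\<close> the coefficient of the operator is the
  mean of \<open>f(t\<^sub>i)\<close> for a probability distribution on the indices \<open>i\<close> (a \<open>q\<close>-beta distribution, carried by
  \<open>jackson_weight\<close>), and the values at \<open>x\<close> of the \<open>q\<close>-Bernstein basis are a probability distribution
  on \<open>k\<close>. So the operator, which is \<open>durrmeyer_mean\<close> below, is a mean of means, and the limit is a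
  statement of Voronovskaya type: expand
  \<open>f(t) = f(x) + f'(x)(t - x) + f''(x)/2 (t - x)\<^sup>2 + g(t)\<close> with \<open>g(t) = o((t - x)\<^sup>2)\<close>.
  
  The first two moments have closed forms, because the total mass of the beta weights satisfies a
  first order recurrence in each parameter and multiplying the Bernstein basis by \<open>[k]\<close> shifts it. They give the limits \<open>(\<alpha>+1) - (\<alpha>+\<beta>+2)x\<close> of
  \<open>[n] M(t - x)\<close> and \<open>2x(1-x)\<close> of \<open>[n] M((t - x)\<^sup>2)\<close> (\<open>first_moment_tendsto\<close>,
  \<open>central_second_moment_tendsto\<close>); together with the coefficients \<open>f'(x)\<close> and \<open>f''(x)/2\<close> these are
  the right-hand side (\<open>jacobi_operator_eq\<close>).
  
  It remains to see that \<open>[n] M(g)\<close> tends to \<open>0\<close>. Near \<open>x\<close> the remainder is at most \<open>\<eta>(t - x)\<^sup>2\<close>. Away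
  from \<open>x\<close> it is only known to be at most a multiple of \<open>t\<^bsup>-a\<^esup>\<close> on the left and of \<open>(1-t)\<^bsup>-b\<^esup>\<close> on the
  right, with \<open>a < \<alpha>+1\<close> and \<open>b < \<beta>+1\<close>; both alternatives of the hypothesis on \<open>f\<close> and \<open>q\<close> lead to
  such a bound (with \<open>a = b = 0\<close> for bounded \<open>f\<close>) and to \<open>q\<^sub>n \<longlonglongrightarrow> 1\<close>. The contribution of these tails is
  exponentially small in \<open>[n]\<close>. The reason is Markov's inequality with moments whose order \<open>s\<close> grows
  with \<open>n\<close>: for both distributions suitable moments of order \<open>s\<close>, positive or negative, are products
  of \<open>s\<close> explicit quotients of \<open>q\<close>-numbers, and if \<open>s\<close> is a small multiple of \<open>[n]\<close>, then each factor,
  divided by the threshold, stays below a constant smaller than \<open>1\<close>. The singular factors \<open>t\<^bsup>-a\<^esup>\<close> and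
  \<open>(1-t)\<^bsup>-b\<^esup>\<close> are absorbed into the weights by shifting \<open>\<alpha>\<close> and \<open>\<beta>\<close>, which costs a factor polynomial in
  \<open>[n]\<close> (\<open>durrmeyer_mean_lower_tail_le\<close>, \<open>durrmeyer_mean_upper_tail_le\<close>).
\<close>


section \<open>Elementary real algebra\<close>

text \<open>
  Induction step for identities in which both sides are products of quotients.
\<close>

lemma mult_eq_mult_swap:
  fixes a b c d e f g :: real
  assumes "a * b = c * d" "c * e = f * g"
  shows "a * (e * b) = f * (g * d)"
proof -
  have "a * (e * b) = a * b * e" by simp
  also have "\<dots> = c * e * d" unfolding assms(1) by simp
  finally show ?thesis unfolding assms(2) by simp
qed

text \<open>
  Turns an exact product formula for \<open>S / T\<close> into a geometric bound.
\<close>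

lemma quotient_le_power:
  fixes a b :: "nat \<Rightarrow> real"
  assumes eq: "S * (\<Prod>j<r. a j) = T * (\<Prod>j<r. b j)"
    and a: "\<And>j. j < r \<Longrightarrow> c \<le> a j" "0 < c"
    and b: "\<And>j. j < r \<Longrightarrow> 0 \<le> b j" "\<And>j. j < r \<Longrightarrow> b j \<le> d"
    and "0 \<le> S" "0 \<le> T" 
  shows "S \<le> (d / c) ^ r * T"
proof -
  have "S * c ^ r \<le> S * (\<Prod>j<r. a j)"
    using prod_mono[of "{..<r}" "\<lambda>j. c" a] assms by (intro mult_left_mono) auto
  also have "\<dots> \<le> T * d ^ r"
    unfolding eq using prod_mono[of "{..<r}" b "\<lambda>j. d"] assms by (intro mult_left_mono) auto
  finally show ?thesis using a(2) by (simp add: power_divide field_simps)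
qed

text \<open>
  The last step of Markov's inequality for a moment of order \<open>s\<close>.
\<close>

lemma le_power_quotient:
  fixes A V S T :: real
  assumes "A ^ s * S \<le> V ^ s * T" "T \<le> 1" "0 < A" "0 \<le> V"
  shows "S \<le> (V / A) ^ s"
proof -
  have "S * A ^ s \<le> V ^ s"
    using assms mult_left_mono[of T 1 "V ^ s"] by (simp add: mult.commute)
  then show ?thesis using assms by (simp add: power_divide le_divide_eq)
qed

text \<open>
  The \<open>q\<close>-Pascal rule after all \<open>q\<close>-factorials have been reduced to common ones.
\<close>

lemma binomial_split_identity:
  fixes a b :: real
  assumes "0 < a" "0 < b" "0 < K" "0 < E"
  shows "(a + qe * b) * F / (b * K * (a * E)) * y ^ Suc k * (r * P)
    = r * (F / (b * K * E) * y ^ Suc k * P) + qe * y * (F / (K * (a * E)) * y ^ k * (r * P))"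
proof -
  have "(a + qe * b) * F / (b * K * (a * E)) = F / (b * K * E) + qe * (F / (K * (a * E)))"
    using assms by (simp add: add_divide_distrib distrib_right)
  then show ?thesis by (simp add: algebra_simps)
qed

section \<open>q-numbers\<close>

text \<open>
  The weighted inequality between the geometric and the arithmetic mean of \<open>q\<close> and \<open>1\<close>.
\<close>

lemma powr_le_linear_interpolation:
  fixes q c :: real
  assumes "0 < q" "0 \<le> c" "c \<le> 1"
  shows "q powr c \<le> 1 - c * (1 - q)"
  using Youngs_inequality_0[of c "1 - c" q 1] assms by (simp add: algebra_simps)

context
  fixes q :: real
  assumes q: "0 < q" "q < 1"
begin

lemma q_number_add: "q_number q (a + b) = q_number q a + q powr a * q_number q b"
  using q by (simp add: q_number_def powr_add field_simps)

lemma q_number_0 [simp]: "q_number q 0 = 0"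
  using q by (simp add: q_number_def)

lemma q_number_1 [simp]: "q_number q 1 = 1"
  using q by (simp add: q_number_def)

lemma q_powr_less_1: "0 < a \<Longrightarrow> q powr a < 1"
  using q powr_less_mono'[of q 0 a] by simp

lemma q_powr_le_1: "0 \<le> a \<Longrightarrow> q powr a \<le> 1"
  using q powr_mono'[of 0 a q] by simp

lemma q_number_mono: "a \<le> b \<Longrightarrow> q_number q a \<le> q_number q b"
  using q powr_mono'[of a b q] by (simp add: q_number_def divide_right_mono)

lemma q_number_pos: "0 < a \<Longrightarrow> 0 < q_number q a"
  using q q_powr_less_1[of a] by (simp add: q_number_def)

lemma q_number_nonneg: "0 \<le> a \<Longrightarrow> 0 \<le> q_number q a"
  using q_number_mono[of 0 a] by simp

text \<open>
  This bound and the next one do not depend on \<open>q\<close>, so the constants in the tail estimates stay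
  controlled while \<open>q\<close> varies with \<open>n\<close>.
\<close>

lemma q_number_ge_min:
  assumes "0 < c"
  shows "min 1 c \<le> q_number q c"
proof (cases "c \<le> 1")
  case True
  then show ?thesis
    using powr_le_linear_interpolation[of q c] q assms
    by (simp add: q_number_def field_simps)
next
  case False
  then show ?thesis using q_number_mono[of 1 c] by simp
qed

lemma q_number_le_max:
  assumes "0 < c"
  shows "q_number q c \<le> max 1 c"
proof (cases "c \<le> 1")
  case True
  then show ?thesis using q_number_mono[of c 1] by simp
next
  case False
  have "(q powr c) powr (1 / c) \<le> 1 - (1 / c) * (1 - q powr c)"
    using q False by (intro powr_le_linear_interpolation) auto
  then have "q \<le> 1 - (1 / c) * (1 - q powr c)"
    using q False by (simp add: powr_powr)
  then have "1 - q powr c \<le> c * (1 - q)"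
    using False by (simp add: field_simps)
  then show ?thesis using q False by (simp add: q_number_def field_simps)
qed

lemma q_number_le_nat: "q_number q (real j) \<le> real j"
  using q_number_le_max[of "real j"] by (cases "j = 0") auto

lemma q_number_add_le:
  assumes "0 \<le> a" "0 < c"
  shows "q_number q (a + c) \<le> q_number q a + max 1 c"
proof -
  have "q powr a * q_number q c \<le> 1 * q_number q c"
    using q_powr_le_1[of a] q_number_nonneg[of c] assms by (intro mult_right_mono) auto
  then show ?thesis using q_number_le_max[of c] assms by (simp add: q_number_add)
qed

lemma q_number_diff_ge:
  assumes "0 \<le> a" 
  shows "q_number q (a + real j) - real j \<le> q_number q a"
proof -
  have "q powr a * q_number q (real j) \<le> 1 * q_number q (real j)"
    using q_powr_le_1[of a] assms q_number_nonneg[of "real j"] by (intro mult_right_mono) auto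
  then show ?thesis using q_number_le_nat[of j] by (simp add: q_number_add)
qed

section \<open>The q-shifted power\<close>

definition shifted_factor :: "real \<Rightarrow> real \<Rightarrow> nat \<Rightarrow> real" where
  "shifted_factor x a j = (1 - q ^ j * x) / (1 - q powr (real j + a) * x)"

lemma q_shifted_power_eq_prodinf: "q_shifted_power q x a = prodinf (shifted_factor x a)"
  by (simp add: q_shifted_power_def shifted_factor_def[abs_def])

lemma shifted_denominator_pos:
  assumes "0 \<le> x" "q powr a * x < 1"
  shows "0 < 1 - q powr (real j + a) * x"
proof -
  have "q powr (real j + a) * x \<le> q powr a * x"
    using assms q by (intro mult_right_mono powr_mono') auto
  then show ?thesis using assms by simp
qed

lemma shifted_numerator_pos:
  assumes "0 \<le> x" "x < 1"
  shows "0 < 1 - q ^ j * x"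
  using shifted_denominator_pos[of x 0 j] assms q by (simp add: powr_realpow)

lemma shifted_factor_pos:
  assumes "0 \<le> x" "x < 1" "q powr a * x < 1"
  shows "0 < shifted_factor x a j"
  unfolding shifted_factor_def
  using shifted_denominator_pos[of x a j] shifted_numerator_pos[of x j] assms by simp

text \<open>
  The factor with index \<open>j\<close> differs from \<open>1\<close> by a multiple of \<open>q\<^bsup>j\<^esup>\<close>.
\<close>

lemma convergent_prod_shifted_factor:
  assumes "0 \<le> x" "x < 1" "q powr a * x < 1"
  shows "convergent_prod (shifted_factor x a)"
proof -
  define z where "z j = q ^ j * (x * (q powr a - 1) / (1 - q powr (real j + a) * x))" for j
  have eq: "shifted_factor x a = (\<lambda>j. 1 + z j)"
  proof
    fix j
    show "shifted_factor x a j = 1 + z j"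
      using shifted_denominator_pos[of x a j] assms q
      by (simp add: shifted_factor_def z_def field_simps powr_add powr_realpow)
  qed
  have "summable (\<lambda>j. \<bar>z j\<bar>)"
  proof (rule summable_comparison_test')
    show "summable (\<lambda>j. q ^ j * (\<bar>x * (q powr a - 1)\<bar> / (1 - q powr a * x)))"
      using q by (intro summable_mult2) (simp add: summable_geometric)
    fix j :: nat
    have "q powr (real j + a) * x \<le> q powr a * x"
      using assms q by (intro mult_right_mono powr_mono') auto
    then show "norm \<bar>z j\<bar> \<le> q ^ j * (\<bar>x * (q powr a - 1)\<bar> / (1 - q powr a * x))"
      using assms q by (simp add: z_def abs_mult abs_divide frac_le mult_left_mono)
  qed
  moreover have "z j \<noteq> -1" for j
    using shifted_factor_pos[OF assms, of j] fun_cong[OF eq, of j] by auto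
  ultimately show ?thesis unfolding eq by (rule summable_imp_convergent_prod_real)
qed

lemma q_shifted_power_pos:
  assumes "0 \<le> x" "x < 1" "q powr a * x < 1"
  shows "0 < q_shifted_power q x a"
  unfolding q_shifted_power_eq_prodinf
  using convergent_prod_shifted_factor[OF assms] shifted_factor_pos[OF assms]
  by (rule less_0_prodinf)

lemma q_shifted_power_LIMSEQ:
  assumes "0 \<le> x" "x < 1" "q powr a * x < 1"
  shows "(\<lambda>n. \<Prod>j<n. shifted_factor x a j) \<longlonglongrightarrow> q_shifted_power q x a"
  unfolding q_shifted_power_eq_prodinf
  using convergent_prod_LIMSEQ[OF convergent_prod_shifted_factor[OF assms]]
  by (simp add: LIMSEQ_lessThan_iff_atMost)

lemma q_shifted_power_scale:
  assumes "0 \<le> x" "x < 1" "q powr a * x < 1"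
  shows "q_shifted_power q x a * (1 - q powr a * x) = (1 - x) * q_shifted_power q (q * x) a"
proof -
  have "shifted_factor x a 0 \<noteq> 0"
    using shifted_factor_pos[OF assms, of 0] by simp
  then have "(\<Prod>j. shifted_factor x a (Suc j)) = q_shifted_power q x a / shifted_factor x a 0"
    unfolding q_shifted_power_eq_prodinf
    by (rule prodinf_split_head[OF convergent_prod_shifted_factor[OF assms]])
  moreover have "(\<lambda>j. shifted_factor x a (Suc j)) = shifted_factor (q * x) a"
    using q by (simp add: fun_eq_iff shifted_factor_def powr_add powr_realpow mult_ac)
  ultimately have "q_shifted_power q (q * x) a = q_shifted_power q x a / shifted_factor x a 0"
    by (simp add: q_shifted_power_eq_prodinf)
  then show ?thesis
    using assms by (simp add: shifted_factor_def)
qed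

text \<open>
  The quotient of the partial products for \<open>a + 1\<close> and for \<open>a\<close> telescopes.
\<close>

lemma q_shifted_power_exponent_Suc:
  assumes "0 \<le> x" "x < 1" "q powr a * x < 1"
  shows "q_shifted_power q x (a + 1) = (1 - q powr a * x) * q_shifted_power q x a"
proof -
  have le: "q powr (a + 1) * x \<le> q powr a * x"
    using assms q by (intro mult_right_mono powr_mono') auto
  have D: "1 - q powr (real j + a) * x \<noteq> 0" for j
    using shifted_denominator_pos[of x a j] assms by simp
  have telescope: "(\<Prod>j<n. shifted_factor x (a + 1) j) =
      (\<Prod>j<n. shifted_factor x a j) * ((1 - q powr a * x) / (1 - q powr (real n + a) * x))" for n
  proof (induction n)
    case 0
    then show ?case using assms by simp
  next
    case (Suc n)
    have "real n + (a + 1) = real (Suc n) + a" by simp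
    then have "shifted_factor x (a + 1) n = (1 - q ^ n * x) / (1 - q powr (real (Suc n) + a) * x)"
      by (simp only: shifted_factor_def)
    moreover have "shifted_factor x a n = (1 - q ^ n * x) / (1 - q powr (real n + a) * x)"
      by (simp only: shifted_factor_def)
    ultimately show ?case using D[of n] D[of "Suc n"]
      unfolding prod.lessThan_Suc Suc by simp
  qed
  have "(\<lambda>n. q powr a * q ^ n * x) \<longlonglongrightarrow> q powr a * 0 * x"
    using q by (intro tendsto_intros LIMSEQ_realpow_zero) auto
  then have "(\<lambda>n. q powr (real n + a) * x) \<longlonglongrightarrow> 0"
    using q by (simp add: powr_add powr_realpow mult_ac)
  then have "(\<lambda>n. (\<Prod>j<n. shifted_factor x a j) * ((1 - q powr a * x) / (1 - q powr (real n + a) * x)))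
      \<longlonglongrightarrow> q_shifted_power q x a * ((1 - q powr a * x) / (1 - 0))"
    using assms by (intro tendsto_intros q_shifted_power_LIMSEQ) auto
  moreover have "(\<lambda>n. \<Prod>j<n. shifted_factor x (a + 1) j) \<longlonglongrightarrow> q_shifted_power q x (a + 1)"
    using assms le by (intro q_shifted_power_LIMSEQ) auto
  ultimately show ?thesis
    unfolding telescope by (auto dest: LIMSEQ_unique simp: mult.commute)
qed

lemma q_shifted_power_0 [simp]:
  assumes "0 \<le> x" "x < 1"
  shows "q_shifted_power q x 0 = 1"
proof -
  have "shifted_factor x 0 = (\<lambda>j. 1)"
    using shifted_numerator_pos[OF assms] q by (auto simp: shifted_factor_def powr_realpow fun_eq_iff less_imp_neq)
  then show ?thesis by (simp add: q_shifted_power_eq_prodinf)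
qed

lemma q_shifted_power_Suc_nat:
  assumes "0 \<le> x" "x < 1"
  shows "q_shifted_power q x (real (Suc d)) = (1 - q ^ d * x) * q_shifted_power q x (real d)"
proof -
  have "q powr real d * x < 1"
    using shifted_numerator_pos[OF assms, of d] q by (simp add: powr_realpow)
  then show ?thesis
    using q_shifted_power_exponent_Suc[of x "real d"] assms q by (simp add: powr_realpow add.commute)
qed

section \<open>The q-beta weights of the Jackson integral\<close>

text \<open>
  The part of the weight at the node \<open>q\<^bsup>i\<^esup>\<close> of the Jackson integral that stands for \<open>(1-t)\<^bsup>m\<^esup>\<close>.
\<close>

definition jackson_factor :: "real \<Rightarrow> nat \<Rightarrow> real" where
  "jackson_factor m i = q_shifted_power q (q * q ^ i) m"

lemma jackson_factor_args:
  assumes "-1 < m"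
  shows "0 \<le> q * q ^ i" "q * q ^ i < 1" "q powr m * (q * q ^ i) < 1"
proof -
  show "0 \<le> q * q ^ i" using q by simp
  show "q * q ^ i < 1" using q power_Suc_less_one[of q i] by simp
  have "q powr m * (q * q ^ i) = q powr (m + 1 + real i)"
    using q by (simp add: powr_add powr_realpow mult_ac)
  then show "q powr m * (q * q ^ i) < 1" using q_powr_less_1[of "m + 1 + real i"] assms by simp
qed

lemma jackson_factor_pos: "-1 < m \<Longrightarrow> 0 < jackson_factor m i"
  unfolding jackson_factor_def by (intro q_shifted_power_pos jackson_factor_args)

lemma jackson_factor_rec:
  assumes "-1 < m"
  shows "jackson_factor m (Suc i) * (1 - q ^ Suc i)
      = jackson_factor m i * (1 - q powr (real i + 1 + m))"
proof -
  have "q powr m * (q * q ^ i) = q powr (real i + 1 + m)"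
    using q by (simp add: powr_add powr_realpow mult_ac)
  then show ?thesis
    using q_shifted_power_scale[OF jackson_factor_args[OF assms, of i]]
    by (simp add: jackson_factor_def mult_ac)
qed

lemma jackson_factor_exponent_Suc:
  assumes "-1 < m"
  shows "jackson_factor (m + 1) i = (1 - q powr (real i + 1 + m)) * jackson_factor m i"
proof -
  have "q powr m * (q * q ^ i) = q powr (real i + 1 + m)"
    using q by (simp add: powr_add powr_realpow mult_ac)
  then show ?thesis
    using q_shifted_power_exponent_Suc[OF jackson_factor_args[OF assms, of i]]
    by (simp add: jackson_factor_def)
qed

text \<open>
  By \<open>jackson_factor_rec\<close> the value at \<open>i\<close> is the infinite product at \<open>0\<close> divided by its first \<open>i\<close>
  factors, and these partial products converge to that infinite product.
\<close>

lemma jackson_factor_LIMSEQ: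
  assumes "-1 < m"
  shows "jackson_factor m \<longlonglongrightarrow> 1"
proof -
  note args = jackson_factor_args[OF assms, of 0, simplified]
  have pos: "0 < q_shifted_power q q m"
    using args by (intro q_shifted_power_pos) auto
  have fpos: "0 < shifted_factor q m j" for j
    using args by (intro shifted_factor_pos) auto
  have prod: "jackson_factor m i * (\<Prod>j<i. shifted_factor q m j) = q_shifted_power q q m" for i
  proof (induction i)
    case (Suc i)
    define d where "d = 1 - q powr (real i + 1 + m)"
    have "0 < d" using q_powr_less_1[of "real i + 1 + m"] assms by (simp add: d_def)
    moreover have "shifted_factor q m i = (1 - q ^ Suc i) / d"
      using q by (simp add: shifted_factor_def d_def powr_add mult_ac)
    moreover have "jackson_factor m (Suc i) * (1 - q ^ Suc i) = jackson_factor m i * d"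
      using jackson_factor_rec[OF assms, of i] by (simp add: d_def)
    ultimately have "jackson_factor m (Suc i) * shifted_factor q m i = jackson_factor m i"
      by simp
    then show ?case using Suc unfolding prod.lessThan_Suc by (metis mult.assoc mult.commute)
  qed (simp add: jackson_factor_def)
  have "(\<lambda>i. q_shifted_power q q m / (\<Prod>j<i. shifted_factor q m j))
      \<longlonglongrightarrow> q_shifted_power q q m / q_shifted_power q q m"
    using pos args by (intro tendsto_intros q_shifted_power_LIMSEQ) auto
  moreover have "q_shifted_power q q m / (\<Prod>j<i. shifted_factor q m j) = jackson_factor m i" for i
    using prod[of i] prod_pos[of "{..<i}" "shifted_factor q m"] fpos
    by (metis less_irrefl nonzero_mult_div_cancel_right)
  ultimately show ?thesis using pos by simp
qed

text \<open>
  For the exponent \<open>b\<close> this compares one factor of the product that defines the \<open>q\<close>-power with one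
  factor of the corresponding product for the ordinary power. With \<open>u = q\<^bsup>b\<^esup> y\<close>, the number
  \<open>exp ((y - u) / (1 - u))\<close> lies between the two sides; on the left this uses
  \<open>b (1 - q) q\<^bsup>b\<^esup> \<le> 1 - q\<^bsup>b\<^esup>\<close>.
\<close>

lemma jackson_factor_ratio_step:
  fixes b y :: real
  assumes "0 \<le> b" "0 < y" "y < 1"
  shows "((1 - q * (q powr b * y)) / (1 - q powr b * y)) powr b \<le> (1 - q powr b * y) / (1 - y)"
proof -
  define u where "u = q powr b * y"
  have "u \<le> y" using assms q q_powr_le_1[of b] by (simp add: u_def mult_left_le_one_le)
  moreover have "0 < u" using assms q by (simp add: u_def)
  ultimately have u: "0 < u" "u \<le> y" "u < 1" using assms by auto
  have qu: "q * u < u" using u q by simp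
  have "(1 - q * u) / (1 - u) = 1 + (1 - q) * u / (1 - u)" using u by (simp add: field_simps)
  also have "\<dots> \<le> exp ((1 - q) * u / (1 - u))" by (rule exp_ge_add_one_self)
  finally have "(1 - q * u) / (1 - u) \<le> exp ((1 - q) * u / (1 - u))" .
  moreover have "0 \<le> (1 - q * u) / (1 - u)" using u qu by (intro divide_nonneg_nonneg) linarith+
  ultimately have "((1 - q * u) / (1 - u)) powr b \<le> exp ((1 - q) * u / (1 - u)) powr b"
    using assms by (intro powr_mono2) auto
  also have "\<dots> = exp (b * ((1 - q) * u / (1 - u)))" by (simp add: powr_def)
  also have "\<dots> \<le> exp ((y - u) / (1 - u))"
  proof -
    have "b * (1 - q) \<le> - b * ln q"
      using ln_le_minus_one[of q] q assms mult_left_mono[of "1 - q" "- ln q" b] by simp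
    also have "\<dots> \<le> exp (- b * ln q) - 1"
      using exp_ge_add_one_self[of "- b * ln q"] by linarith
    also have "exp (- b * ln q) = inverse (q powr b)"
      using q by (simp add: powr_def exp_minus)
    finally have "b * (1 - q) * q powr b \<le> 1 - q powr b"
      using q by (simp add: field_simps)
    then have "b * (1 - q) * u \<le> y - u"
      using assms mult_right_mono[of "b * (1 - q) * q powr b" "1 - q powr b" y]
      by (simp add: u_def algebra_simps)
    then show ?thesis using u by (simp add: divide_right_mono mult.assoc)
  qed
  also have "\<dots> \<le> (1 - u) / (1 - y)"
  proof -
    have "1 - (y - u) / (1 - u) \<le> exp (- ((y - u) / (1 - u)))"
      using exp_ge_add_one_self[of "- ((y - u) / (1 - u))"] by simp
    moreover have "1 - (y - u) / (1 - u) = (1 - y) / (1 - u)" using u by (simp add: field_simps)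
    ultimately have "(1 - y) / (1 - u) \<le> inverse (exp ((y - u) / (1 - u)))"
      by (simp add: exp_minus)
    then show ?thesis using u assms by (simp add: field_simps)
  qed
  finally show ?thesis unfolding u_def .
qed

text \<open>
  Increasing the exponent by \<open>b\<close> contributes at most an ordinary power of order \<open>b\<close>: the quotient
  of the two sides increases with \<open>i\<close>, by the previous lemma, and tends to \<open>1\<close>. Read backwards, a
  singularity \<open>(1-t)\<^bsup>-b\<^esup>\<close> with real \<open>b\<close> can be traded for a smaller exponent of the weight.
\<close>

lemma jackson_factor_exponent_add_le:
  assumes "0 \<le> b" "-1 < m"
  shows "jackson_factor (m + b) i \<le> (1 - q powr (real i + 1 + m + b)) powr b * jackson_factor m i"
proof -
  define P where "P i = 1 - q powr (real i + 1 + m + b)" for i :: nat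
  have P: "0 < P i" "P i < 1" for i
    using q_powr_less_1[of "real i + 1 + m + b"] assms q by (auto simp: P_def)
  define G where "G i = jackson_factor (m + b) i / (P i powr b * jackson_factor m i)" for i
  have "G i \<le> G (Suc i)" for i
  proof -
    define y where "y = q powr (real i + 1 + m)"
    have y: "0 < y" "y < 1" using q_powr_less_1[of "real i + 1 + m"] assms q by (auto simp: y_def)
    have Py: "P i = 1 - q powr b * y" "P (Suc i) = 1 - q * (q powr b * y)"
      using q by (simp_all add: P_def y_def powr_add power2_eq_square mult_ac)
    define d where "d = 1 - q ^ Suc i"
    have d: "0 < d" using power_Suc_less_one[of q i] q by (simp add: d_def)
    have r1: "jackson_factor (m + b) (Suc i) * d = jackson_factor (m + b) i * P i"
      using jackson_factor_rec[of "m + b" i] assms by (simp add: P_def d_def add.assoc)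
    have r2: "jackson_factor m (Suc i) * d = jackson_factor m i * (1 - y)"
      using jackson_factor_rec[of m i] assms by (simp add: y_def d_def)
    have "(P (Suc i) / P i) powr b \<le> P i / (1 - y)"
      using jackson_factor_ratio_step[OF assms(1) y] by (simp add: Py)
    then have step: "P (Suc i) powr b * (1 - y) \<le> P i * P i powr b"
      using P[of i] P[of "Suc i"] y by (simp add: powr_divide field_simps)
    have pos: "0 < jackson_factor m i" "0 < jackson_factor (m + b) i" "0 < jackson_factor m (Suc i)"
      using jackson_factor_pos assms by auto
    have Gi: "G (Suc i) = (jackson_factor (m + b) i * P i) / (P (Suc i) powr b * (jackson_factor m i * (1 - y)))"
      unfolding G_def r1[symmetric] r2[symmetric] using d by simp
    have "G i = (jackson_factor (m + b) i * P i) / ((P i * P i powr b) * jackson_factor m i)"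
      using P[of i] by (simp add: G_def)
    also have "\<dots> \<le> G (Suc i)"
      unfolding Gi using step pos P[of i] P[of "Suc i"] y
      by (intro divide_left_mono mult_nonneg_nonneg mult_pos_pos) (auto simp: mult_ac less_imp_le mult_left_mono)
    finally show ?thesis .
  qed
  then have "incseq G" by (rule incseq_SucI)
  moreover have "G \<longlonglongrightarrow> 1 / ((1 - q powr (1 + m + b) * 0) powr b * 1)"
  proof -
    have "P = (\<lambda>i. 1 - q powr (1 + m + b) * q ^ i)"
      using q by (simp add: P_def fun_eq_iff powr_add powr_realpow mult_ac)
    moreover have "(\<lambda>i. 1 - q powr (1 + m + b) * q ^ i) \<longlonglongrightarrow> 1 - q powr (1 + m + b) * 0"
      using q by (intro tendsto_intros LIMSEQ_realpow_zero) auto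
    ultimately have "P \<longlonglongrightarrow> 1 - q powr (1 + m + b) * 0" by simp
    then show ?thesis unfolding G_def using assms
      by (intro tendsto_intros jackson_factor_LIMSEQ) auto
  qed
  ultimately have "G i \<le> 1" by (metis incseq_le mult.right_neutral mult_zero_right diff_zero powr_one_eq_one div_by_1)
  then show ?thesis
    using P[of i] jackson_factor_pos[OF assms(2), of i] by (simp add: G_def P_def[symmetric] divide_le_eq)
qed

end

context
  fixes q :: real
  assumes q: "0 < q" "q < 1"
begin

text \<open>
  The weights of the Jackson integral of \<open>t\<^bsup>p\<^esup> (1-qt)\<^bsup>m\<^esup>\<close>, without the factor \<open>1 - q\<close>, which cancels in means.
  Functions are given by their values at the indices \<open>i\<close> of the nodes.
\<close>

definition jackson_weight :: "real \<Rightarrow> real \<Rightarrow> nat \<Rightarrow> real" where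
  "jackson_weight p m i = q powr (real i * (p + 1)) * jackson_factor q m i"

definition jackson_total :: "real \<Rightarrow> real \<Rightarrow> real" where
  "jackson_total p m = (\<Sum>i. jackson_weight p m i)"

definition jackson_mean :: "real \<Rightarrow> real \<Rightarrow> (nat \<Rightarrow> real) \<Rightarrow> real" where
  "jackson_mean p m h = (\<Sum>i. jackson_weight p m i * h i) / jackson_total p m"

lemma jackson_weight_pos: "-1 < m \<Longrightarrow> 0 < jackson_weight p m i"
  using jackson_factor_pos[OF q] q by (simp add: jackson_weight_def)

lemma jackson_weight_shift:
  "jackson_weight (p + a) m i = q powr (real i * a) * jackson_weight p m i"
  using q by (simp add: jackson_weight_def powr_add[symmetric] algebra_simps)

lemma jackson_weight_add_nat:
  "jackson_weight (p + real s) m i = (q ^ i) ^ s * jackson_weight p m i"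
proof -
  have "q powr (real i * real s) = (q ^ i) ^ s"
    using q by (simp add: powr_realpow[symmetric] powr_powr)
  then show ?thesis by (simp add: jackson_weight_shift)
qed

lemma jackson_weight_Suc:
  assumes "-1 < m"
  shows "jackson_weight p m (Suc i) * (1 - q ^ Suc i)
    = q powr (p + 1) * (jackson_weight p m i - q powr (m + 1) * jackson_weight (p + 1) m i)"
proof -
  have "q powr (real (Suc i) * (p + 1)) = q powr (p + 1) * q powr (real i * (p + 1))"
    using q by (simp add: powr_add[symmetric] algebra_simps)
  moreover have "q powr (real i + 1 + m) = q powr (m + 1) * q ^ i"
    using q by (simp add: powr_add powr_realpow)
  ultimately have "jackson_weight p m (Suc i) * (1 - q ^ Suc i)
      = q powr (p + 1) * q powr (real i * (p + 1)) * (jackson_factor q m i * (1 - q powr (m + 1) * q ^ i))"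
    using jackson_factor_rec[OF q assms, of i] unfolding jackson_weight_def by (simp only: mult.assoc)
  moreover have "jackson_weight (p + 1) m i = q ^ i * (q powr (real i * (p + 1)) * jackson_factor q m i)"
    using jackson_weight_add_nat[of p 1 m i] by (simp add: jackson_weight_def[of p])
  ultimately show ?thesis
    unfolding jackson_weight_def[of p] by (simp only: right_diff_distrib mult_ac mult_1_right)
qed

lemma summable_jackson_weight:
  assumes "-1 < p" "-1 < m"
  shows "summable (jackson_weight p m)"
proof -
  obtain K where K: "\<And>i. norm (jackson_factor q m i) \<le> K"
    using jackson_factor_LIMSEQ[OF q assms(2)] convergentI convergent_imp_Bseq BseqE by metis
  show ?thesis
  proof (rule summable_comparison_test')
    show "summable (\<lambda>i. (q powr (p + 1)) ^ i * K)"
      using q_powr_less_1[OF q, of "p + 1"] assms by (intro summable_mult2 summable_geometric) auto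
    fix i :: nat
    have "q powr (real i * (p + 1)) = (q powr (p + 1)) ^ i"
      using q by (simp add: powr_realpow[symmetric] powr_powr mult.commute)
    then show "norm (jackson_weight p m i) \<le> (q powr (p + 1)) ^ i * K"
      using K[of i] by (simp add: jackson_weight_def abs_mult mult_left_mono)
  qed
qed

lemma jackson_total_pos:
  assumes "-1 < p" "-1 < m"
  shows "0 < jackson_total p m"
  unfolding jackson_total_def
  using summable_jackson_weight[OF assms] jackson_weight_pos[OF assms(2)] by (rule suminf_pos)

lemma jackson_total_antimono:
  assumes "-1 < p" "p \<le> p'" "-1 < m"
  shows "jackson_total p' m \<le> jackson_total p m"
  unfolding jackson_total_def
proof (intro suminf_le summable_jackson_weight)
  fix i
  have "q powr (real i * (p' - p)) \<le> 1" using q_powr_le_1[OF q] assms by simp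
  then show "jackson_weight p' m i \<le> jackson_weight p m i"
    using jackson_weight_shift[of p "p' - p" m i] jackson_weight_pos[OF assms(3), of p i]
    by (simp add: mult_left_le_one_le)
qed (use assms in auto)

text \<open>
  Summation by parts. This is the \<open>q\<close>-analogue of the recurrence
  \<open>B(u+1, v) (u+v) = B(u, v) u\<close> of the beta function, with \<open>u = p + 1\<close> and \<open>v = m + 1\<close>; the next lemma
  is the recurrence in \<open>v\<close>. All moments below come from these two.
\<close>

lemma jackson_total_shift_left:
  assumes "-1 < p" "-1 < m"
  shows "jackson_total (p + 1) m * q_number q (p + m + 2) = jackson_total p m * q_number q (p + 1)"
proof -
  let ?W = "jackson_weight p m" and ?V = "jackson_weight (p + 1) m"
  have V: "?V i = q ^ i * ?W i" for i using jackson_weight_add_nat[of p 1 m i] by simp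
  have sW: "summable ?W" and sV: "summable ?V"
    using summable_jackson_weight assms by auto
  have D: "?W i * (1 - q ^ i) = ?W i - ?V i" for i
    unfolding V by (simp add: algebra_simps)
  have s: "summable (\<lambda>i. ?W i * (1 - q ^ i))"
    unfolding D using sW sV by (rule summable_diff)
  have "(\<Sum>i. ?W (Suc i) * (1 - q ^ Suc i)) = (\<Sum>i. ?W i * (1 - q ^ i))"
    using suminf_split_head[OF s] by simp
  also have "\<dots> = jackson_total p m - jackson_total (p + 1) m"
    unfolding jackson_total_def suminf_diff[OF sW sV] D ..
  finally have 1: "(\<Sum>i. ?W (Suc i) * (1 - q ^ Suc i)) = jackson_total p m - jackson_total (p + 1) m" .
  have "(\<Sum>i. ?W (Suc i) * (1 - q ^ Suc i))
      = q powr (p + 1) * (jackson_total p m - q powr (m + 1) * jackson_total (p + 1) m)"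
    unfolding jackson_weight_Suc[OF assms(2)] jackson_total_def
    using sW sV by (simp add: suminf_mult[symmetric] suminf_diff summable_mult summable_diff)
  with 1 have "jackson_total (p + 1) m * (1 - q powr (p + 1) * q powr (m + 1))
      = jackson_total p m * (1 - q powr (p + 1))"
    by (simp add: algebra_simps)
  moreover have "q powr (p + 1) * q powr (m + 1) = q powr (p + m + 2)"
    using q by (simp add: powr_add[symmetric] add_ac)
  ultimately show ?thesis using q by (simp add: q_number_def)
qed

lemma jackson_total_shift_right:
  assumes "-1 < p" "-1 < m"
  shows "jackson_total p (m + 1) * q_number q (p + m + 2) = jackson_total p m * q_number q (m + 1)"
proof -
  have "jackson_weight p (m + 1) = (\<lambda>i. jackson_weight p m i - q powr (m + 1) * jackson_weight (p + 1) m i)"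
  proof
    fix i
    have "q powr (real i + 1 + m) = q powr (m + 1) * q ^ i"
      using q by (simp add: powr_add powr_realpow)
    moreover have "jackson_weight (p + 1) m i = q ^ i * (q powr (real i * (p + 1)) * jackson_factor q m i)"
      using jackson_weight_add_nat[of p 1 m i] by (simp add: jackson_weight_def[of p])
    ultimately show "jackson_weight p (m + 1) i
        = jackson_weight p m i - q powr (m + 1) * jackson_weight (p + 1) m i"
      using jackson_factor_exponent_Suc[OF q assms(2), of i]
      unfolding jackson_weight_def[of p] by (simp only: right_diff_distrib left_diff_distrib mult_ac mult_1_right)
  qed
  then have "jackson_total p (m + 1) = jackson_total p m - q powr (m + 1) * jackson_total (p + 1) m"
    unfolding jackson_total_def using summable_jackson_weight assms
    by (simp add: suminf_mult[symmetric] suminf_diff summable_mult)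
  then have "jackson_total p (m + 1) * q_number q (p + m + 2)
      = jackson_total p m * q_number q (p + m + 2)
        - q powr (m + 1) * (jackson_total (p + 1) m * q_number q (p + m + 2))"
    by (simp only: left_diff_distrib mult.assoc)
  then have "jackson_total p (m + 1) * q_number q (p + m + 2)
      = jackson_total p m * (q_number q (p + m + 2) - q powr (m + 1) * q_number q (p + 1))"
    unfolding jackson_total_shift_left[OF assms] by (simp only: right_diff_distrib mult_ac)
  moreover have "q_number q (p + m + 2) = q_number q (m + 1) + q powr (m + 1) * q_number q (p + 1)"
    using q_number_add[OF q, of "m + 1" "p + 1"] by (simp add: add_ac)
  ultimately show ?thesis by simp
qed

lemma jackson_total_left_prod:
  assumes "-1 < p" "-1 < m"
  shows "jackson_total (p + real r) m * (\<Prod>j<r. q_number q (p + m + 2 + real j))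
    = jackson_total p m * (\<Prod>j<r. q_number q (p + 1 + real j))"
proof (induction r)
  case (Suc r)
  have "jackson_total (p + real (Suc r)) m * q_number q (p + m + 2 + real r)
      = jackson_total (p + real r) m * q_number q (p + 1 + real r)"
    using jackson_total_shift_left[of "p + real r" m] assms by (simp add: add_ac)
  from mult_eq_mult_swap[OF this Suc] show ?case unfolding prod.lessThan_Suc .
qed simp

lemma jackson_total_right_prod:
  assumes "-1 < p" "-1 < m"
  shows "jackson_total p (m + real r) * (\<Prod>j<r. q_number q (p + m + 2 + real j))
    = jackson_total p m * (\<Prod>j<r. q_number q (m + 1 + real j))"
proof (induction r)
  case (Suc r)
  have "jackson_total p (m + real (Suc r)) * q_number q (p + m + 2 + real r)
      = jackson_total p (m + real r) * q_number q (m + 1 + real r)"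
    using jackson_total_shift_right[of p "m + real r"] assms by (simp add: add_ac)
  from mult_eq_mult_swap[OF this Suc] show ?case unfolding prod.lessThan_Suc .
qed simp

section \<open>Tails of the Jackson means\<close>

text \<open>
  The singularity \<open>t\<^bsup>-a\<^esup>\<close> at \<open>t = q\<^bsup>i\<^esup>\<close>, cut off at \<open>y\<close>.
\<close>

definition lower_tail :: "real \<Rightarrow> real \<Rightarrow> nat \<Rightarrow> real" where
  "lower_tail a y i = (if q ^ i < y then q powr (- (real i * a)) else 0)"

text \<open>
  The cut-off is at \<open>q\<^bsup>i\<^esup>\<close>, but the singularity is that of \<open>(1-t)\<^bsup>-b\<^esup>\<close> at \<open>t = q\<^bsup>\<beta>+1\<^esup> q\<^bsup>i\<^esup>\<close>, the point where the
  operator evaluates \<open>f\<close>. The node \<open>q\<^bsup>0\<^esup>\<close> itself is the end point \<open>1\<close>.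
\<close>

definition upper_tail :: "real \<Rightarrow> real \<Rightarrow> real \<Rightarrow> nat \<Rightarrow> real" where
  "upper_tail \<beta> b y i = (if y < q ^ i then (1 - q powr (\<beta> + 1) * q ^ i) powr (- b) else 0)"

lemma lower_tail_nonneg: "0 \<le> lower_tail a y i"
  by (simp add: lower_tail_def)

lemma upper_tail_nonneg: "0 \<le> upper_tail \<beta> b y i"
  by (simp add: upper_tail_def)

lemma jackson_weight_lower_tail_le:
  assumes "-1 < m"
  shows "jackson_weight p m i * lower_tail a y i \<le> jackson_weight (p - a) m i"
  using jackson_weight_shift[of p "- a" m i] jackson_weight_pos[OF assms, of p i]
  by (simp add: lower_tail_def)

lemma summable_lower_tail:
  assumes "-1 < p - a" "-1 < m"
  shows "summable (\<lambda>i. jackson_weight p m i * lower_tail a y i)"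
proof (rule summable_comparison_test')
  show "summable (jackson_weight (p - a) m)" using assms by (rule summable_jackson_weight)
  show "norm (jackson_weight p m i * lower_tail a y i) \<le> jackson_weight (p - a) m i" for i
    using jackson_weight_lower_tail_le[OF assms(2)] lower_tail_nonneg[of a y i]
      jackson_weight_pos[OF assms(2), of p i] by (simp add: abs_mult)
qed

lemma lower_tail_sum_le_crude:
  assumes "-1 < p - a" "-1 < m"
  shows "(\<Sum>i. jackson_weight p m i * lower_tail a y i) \<le> jackson_total (p - a) m"
  unfolding jackson_total_def
  using assms by (intro suminf_le jackson_weight_lower_tail_le summable_lower_tail summable_jackson_weight)

text \<open>
  Markov's inequality with a negative moment. The exponent \<open>a\<close> is rounded up to the natural number \<open>A\<close>,
  so that the two weights differ by an integral shift, for which the ratio of the total masses is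
  an explicit product.
\<close>

lemma lower_tail_sum_le_negative_moment:
  assumes "-1 < p - (real A + real s)" "-1 < m" "0 \<le> a" "a \<le> real A" "0 < y"
  shows "(\<Sum>i. jackson_weight p m i * lower_tail a y i) \<le> y ^ s * jackson_total (p - (real A + real s)) m"
proof -
  have sW: "summable (jackson_weight (p - (real A + real s)) m)"
    using assms by (intro summable_jackson_weight)
  have "(\<Sum>i. jackson_weight p m i * lower_tail a y i)
      \<le> (\<Sum>i. y ^ s * jackson_weight (p - (real A + real s)) m i)"
  proof (rule suminf_le)
    show "summable (\<lambda>i. jackson_weight p m i * lower_tail a y i)"
      using assms by (intro summable_lower_tail) auto
    show "summable (\<lambda>i. y ^ s * jackson_weight (p - (real A + real s)) m i)"
      using sW by (rule summable_mult)
    fix i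
    let ?W = "jackson_weight (p - (real A + real s)) m i"
    have W: "jackson_weight p m i = (q ^ i) ^ s * q powr (real i * real A) * ?W"
      using jackson_weight_add_nat[of "p - (real A + real s) + real A" s m i]
        jackson_weight_shift[of "p - (real A + real s)" "real A" m i] by simp
    show "jackson_weight p m i * lower_tail a y i \<le> y ^ s * ?W"
    proof (cases "q ^ i < y")
      case True
      have "q powr (real i * real A) * q powr (- (real i * a)) = q powr (real i * (real A - a))"
        using q by (simp add: powr_add[symmetric] algebra_simps)
      then have "q powr (real i * real A) * q powr (- (real i * a)) \<le> 1"
        using q_powr_le_1[OF q, of "real i * (real A - a)"] assms by simp
      moreover have "(q ^ i) ^ s \<le> y ^ s" using True q by (intro power_mono) auto
      ultimately have "(q ^ i) ^ s * (q powr (real i * real A) * q powr (- (real i * a))) \<le> y ^ s * 1"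
        using assms by (intro mult_mono) auto
      then have "(q ^ i) ^ s * (q powr (real i * real A) * q powr (- (real i * a))) * ?W \<le> y ^ s * ?W"
        using jackson_weight_pos[OF assms(2)] by (intro mult_right_mono) (auto simp: less_imp_le)
      then show ?thesis using True by (simp add: lower_tail_def W mult_ac)
    next
      case False
      then show ?thesis using assms jackson_weight_pos[OF assms(2)] by (simp add: lower_tail_def less_imp_le)
    qed
  qed
  also have "\<dots> = y ^ s * jackson_total (p - (real A + real s)) m"
    unfolding jackson_total_def using sW by (rule suminf_mult)
  finally show ?thesis .
qed

lemma one_minus_factor_pos:
  assumes "-1 < \<beta>"
  shows "0 < 1 - q powr (\<beta> + 1) * q ^ i"
  using q_powr_less_1[OF q, of "\<beta> + 1 + real i"] assms q by (simp add: powr_add powr_realpow)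

text \<open>
  With \<open>v = q\<^bsup>\<beta>+1\<^esup> q\<^bsup>i\<^esup>\<close> the left-hand side is \<open>(1 - v) + v (1 - q\<^bsup>d\<^esup>)\<close>, and \<open>1 - v\<close> is at least
  \<open>1 - q\<^bsup>\<beta>+1\<^esup>\<close>.
\<close>

lemma one_minus_factor_compare:
  assumes "-1 < \<beta>"
  shows "1 - q powr (real i + 1 + (real d + \<beta>))
     \<le> (1 + q_number q (real d) / q_number q (\<beta> + 1)) * (1 - q powr (\<beta> + 1) * q ^ i)"
proof -
  define v where "v = q powr (\<beta> + 1) * q ^ i"
  define w where "w = q powr (\<beta> + 1)"
  have w: "0 < w" "w < 1" using q q_powr_less_1[OF q, of "\<beta> + 1"] assms by (auto simp: w_def)
  have v: "0 < v" "v \<le> w"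
    using q by (auto simp: v_def w_def mult_right_le_one_le power_le_one)
  have qd: "q ^ d \<le> 1" using q by (simp add: power_le_one)
  have "q powr (real i + 1 + (real d + \<beta>)) = v * q ^ d"
    using q by (simp add: v_def powr_add powr_realpow mult_ac)
  then have "1 - q powr (real i + 1 + (real d + \<beta>)) = (1 - v) + v * (1 - q ^ d)"
    by (simp add: algebra_simps)
  also have "v * (1 - q ^ d) \<le> 1 * (1 - q ^ d) * ((1 - v) / (1 - w))"
  proof -
    have "1 \<le> (1 - v) / (1 - w)" using v w by simp
    then have "(1 - q ^ d) * 1 \<le> (1 - q ^ d) * ((1 - v) / (1 - w))"
      using qd by (intro mult_left_mono) auto
    moreover have "v * (1 - q ^ d) \<le> 1 * (1 - q ^ d)"
      using v w qd by (intro mult_right_mono) auto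
    ultimately show ?thesis by simp
  qed
  also have "(1 - v) + 1 * (1 - q ^ d) * ((1 - v) / (1 - w)) = (1 + (1 - q ^ d) / (1 - w)) * (1 - v)"
    by (simp add: algebra_simps)
  also have "(1 - q ^ d) / (1 - w) = q_number q (real d) / q_number q (\<beta> + 1)"
    using q by (simp add: q_number_def w_def powr_realpow)
  finally show ?thesis by (simp add: v_def)
qed

text \<open>
  The singular factor is absorbed by lowering the second parameter by \<open>b\<close>; the factor
  \<open>q\<^bsup>is\<^esup> / y\<^bsup>s\<^esup>\<close>, which is at least \<open>1\<close> on the tail, raises the first parameter by \<open>s\<close>.
\<close>

lemma jackson_weight_upper_tail_le:
  assumes "-1 < real d + \<beta> - b" "-1 < \<beta>" "0 \<le> b" "0 < y"
  shows "jackson_weight p (real d + \<beta>) i * upper_tail \<beta> b y i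
    \<le> (1 + q_number q (real d) / q_number q (\<beta> + 1)) powr b / y ^ s
       * jackson_weight (p + real s) (real d + \<beta> - b) i"
proof -
  let ?m = "real d + \<beta>" and ?C = "1 + q_number q (real d) / q_number q (\<beta> + 1)"
  let ?u = "1 - q powr (\<beta> + 1) * q ^ i"
  have C: "0 \<le> ?C" using q_number_nonneg[OF q, of "real d"] q_number_nonneg[OF q, of "\<beta> + 1"] assms by simp
  have u: "0 < ?u" using one_minus_factor_pos assms by simp
  let ?W = "jackson_weight p (?m - b) i"
  have Wpos: "0 < ?W" using jackson_weight_pos[OF assms(1)] .
  have "jackson_factor q ?m i \<le> (1 - q powr (real i + 1 + ?m)) powr b * jackson_factor q (?m - b) i"
    using jackson_factor_exponent_add_le[OF q assms(3,1), of i] by (simp add: add.assoc)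
  also have "\<dots> \<le> (?C * ?u) powr b * jackson_factor q (?m - b) i"
    using one_minus_factor_compare[OF assms(2), of i d] jackson_factor_pos[OF q assms(1), of i] assms
      q_powr_le_1[OF q, of "real i + 1 + ?m"]
    by (intro mult_right_mono powr_mono2) auto
  finally have "jackson_weight p ?m i \<le> (?C * ?u) powr b * ?W"
    using q by (simp add: jackson_weight_def mult_left_mono mult.left_commute)
  then have W: "jackson_weight p ?m i \<le> ?C powr b * ?u powr b * ?W"
    using C u by (simp add: powr_mult)
  show ?thesis
  proof (cases "y < q ^ i")
    case True
    have "jackson_weight p ?m i * ?u powr (- b) \<le> ?C powr b * ?u powr b * ?W * ?u powr (- b)"
      using W by (intro mult_right_mono) auto
    also have "\<dots> = ?C powr b * ?W" using u by (simp add: powr_minus)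
    also have "\<dots> * 1 \<le> ?C powr b * ?W * ((q ^ i) ^ s / y ^ s)"
      using True assms(4) Wpos by (intro mult_left_mono) (auto simp: power_mono less_imp_le)
    finally show ?thesis
      using True unfolding jackson_weight_add_nat by (simp add: upper_tail_def mult_ac)
  next
    case False
    have "0 < jackson_weight (p + real s) (?m - b) i" using jackson_weight_pos[OF assms(1)] .
    then show ?thesis using False assms by (simp add: upper_tail_def)
  qed
qed

lemma summable_upper_tail:
  assumes "-1 < p" "-1 < real d + \<beta> - b" "-1 < \<beta>" "0 \<le> b" "0 < y"
  shows "summable (\<lambda>i. jackson_weight p (real d + \<beta>) i * upper_tail \<beta> b y i)"
proof (rule summable_comparison_test')
  show "summable (\<lambda>i. (1 + q_number q (real d) / q_number q (\<beta> + 1)) powr b / y ^ 0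
       * jackson_weight (p + real 0) (real d + \<beta> - b) i)"
    using assms by (intro summable_mult summable_jackson_weight) auto
  fix i
  have "0 < jackson_weight p (real d + \<beta>) i" using assms by (intro jackson_weight_pos) auto
  then show "norm (jackson_weight p (real d + \<beta>) i * upper_tail \<beta> b y i)
    \<le> (1 + q_number q (real d) / q_number q (\<beta> + 1)) powr b / y ^ 0
       * jackson_weight (p + real 0) (real d + \<beta> - b) i"
    using jackson_weight_upper_tail_le[OF assms(2-5), of p i 0] upper_tail_nonneg[of \<beta> b y i]
    by (simp add: abs_mult)
qed

lemma upper_tail_sum_le:
  assumes "-1 < p" "-1 < real d + \<beta> - b" "-1 < \<beta>" "0 \<le> b" "0 < y"
  shows "(\<Sum>i. jackson_weight p (real d + \<beta>) i * upper_tail \<beta> b y i)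
    \<le> (1 + q_number q (real d) / q_number q (\<beta> + 1)) powr b / y ^ s
       * jackson_total (p + real s) (real d + \<beta> - b)"
proof -
  have sW: "summable (jackson_weight (p + real s) (real d + \<beta> - b))"
    using assms by (intro summable_jackson_weight) auto
  show ?thesis unfolding jackson_total_def suminf_mult[OF sW, symmetric]
    using assms by (intro suminf_le jackson_weight_upper_tail_le summable_upper_tail summable_mult sW)
qed

end


context
  fixes q :: real
  assumes q: "0 < q" "q < 1"
begin

section \<open>The q-Bernstein basis\<close>

lemma q_fact_Suc: "q_fact q (Suc n) = q_number q (real (Suc n)) * q_fact q n"
  by (simp add: q_fact_def prod.atLeastAtMost_shift_bounds prod.nat_ivl_Suc')

lemma q_fact_pos: "0 < q_fact q n"
  unfolding q_fact_def using q_number_pos[OF q] by (intro prod_pos) auto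

context
  fixes x :: real
  assumes x: "0 < x" "x < 1"
begin

lemma q_bernstein_basis_nonneg: "0 \<le> q_bernstein_basis n k q x"
proof -
  have "q powr real (n - k) * x \<le> 1 * x"
    using q_powr_le_1[OF q, of "real (n - k)"] x by (intro mult_right_mono) auto
  then have "q powr real (n - k) * x < 1" using x by linarith
  then have "0 < q_shifted_power q x (real (n - k))"
    using q x by (intro q_shifted_power_pos) auto
  then show ?thesis
    using q_fact_pos x by (simp add: q_bernstein_basis_def q_binomial_def less_imp_le)
qed

lemma q_bernstein_basis_Suc_Suc:
  "q_bernstein_basis (Suc n) (Suc k) q x * q_number q (real (Suc k))
    = q_number q (real (Suc n)) * x * q_bernstein_basis n k q x"
  using q_number_pos[OF q, of "real (Suc k)"] q_fact_pos[of k]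
  by (simp add: q_bernstein_basis_def q_binomial_def q_fact_Suc del: of_nat_Suc)

lemma q_bernstein_basis_Suc_0:
  "q_bernstein_basis (Suc n) 0 q x = (1 - q ^ n * x) * q_bernstein_basis n 0 q x"
  using q_fact_pos[of n] q_fact_pos[of "Suc n"] q x
  by (simp add: q_bernstein_basis_def q_binomial_def q_shifted_power_Suc_nat del: of_nat_Suc)

lemma q_bernstein_basis_top:
  "q_bernstein_basis (Suc n) (Suc n) q x = x * q_bernstein_basis n n q x"
  using q_fact_pos[of n] q_fact_pos[of "Suc n"] q x
  by (simp add: q_bernstein_basis_def q_binomial_def)

text \<open>
  The \<open>q\<close>-Pascal rule, in the form in which summing over \<open>k\<close> makes the terms with a power of \<open>q\<close>
  cancel.
\<close>

lemma q_bernstein_basis_Suc: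
  assumes "k < n"
  shows "q_bernstein_basis (Suc n) (Suc k) q x
    = (1 - q ^ (n - Suc k) * x) * q_bernstein_basis n (Suc k) q x
      + q ^ (n - k) * x * q_bernstein_basis n k q x"
proof -
  define e where "e = n - Suc k"
  have n: "n = Suc (k + e)" "n - k = Suc e" "n - Suc k = e" using assms by (auto simp: e_def)
  define a where "a = q_number q (real (Suc e))"
  define b where "b = q_number q (real (Suc k))"
  have ab: "0 < a" "0 < b" using q_number_pos[OF q] by (auto simp: a_def b_def)
  have sum: "q_number q (real (Suc n)) = a + q ^ Suc e * b"
  proof -
    have "real (Suc n) = real (Suc e) + real (Suc k)" by (simp add: n)
    moreover have "q powr real (Suc e) = q ^ Suc e" using q by (simp only: powr_realpow)
    ultimately show ?thesis
      using q_number_add[OF q, of "real (Suc e)" "real (Suc k)"] by (simp only: a_def b_def)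
  qed
  have P: "q_shifted_power q x (real (Suc e)) = (1 - q ^ e * x) * q_shifted_power q x (real e)"
    using q x by (intro q_shifted_power_Suc_nat) auto
  let ?P = "q_shifted_power q x (real e)"
  have 1: "q_bernstein_basis (Suc n) (Suc k) q x
      = (a + q ^ Suc e * b) * q_fact q n / (b * q_fact q k * (a * q_fact q e)) * x ^ Suc k * ((1 - q ^ e * x) * ?P)"
    unfolding q_bernstein_basis_def q_binomial_def diff_Suc_Suc n(2) P q_fact_Suc sum a_def b_def ..
  have 2: "q_bernstein_basis n (Suc k) q x
      = q_fact q n / (b * q_fact q k * q_fact q e) * x ^ Suc k * ?P"
    unfolding q_bernstein_basis_def q_binomial_def n(3) q_fact_Suc b_def ..
  have 3: "q_bernstein_basis n k q x
      = q_fact q n / (q_fact q k * (a * q_fact q e)) * x ^ k * ((1 - q ^ e * x) * ?P)"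
    unfolding q_bernstein_basis_def q_binomial_def n(2) P q_fact_Suc a_def ..
  show ?thesis
    unfolding 1 2 3 n(2,3) using ab q_fact_pos[of k] q_fact_pos[of e] by (rule binomial_split_identity)
qed

lemma sum_q_bernstein_basis: "(\<Sum>k=0..n. q_bernstein_basis n k q x) = 1"
proof (induction n)
  case 0
  then show ?case using q x by (simp add: q_bernstein_basis_def q_binomial_def q_fact_def)
next
  case (Suc n)
  let ?b = "\<lambda>k. q_bernstein_basis n k q x"
  have "(\<Sum>k=0..Suc n. q_bernstein_basis (Suc n) k q x)
      = q_bernstein_basis (Suc n) 0 q x + (\<Sum>k<Suc n. q_bernstein_basis (Suc n) (Suc k) q x)"
    unfolding atMost_atLeast0[symmetric] sum.atMost_Suc_shift by (simp add: lessThan_Suc_atMost)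
  also have "(\<Sum>k<Suc n. q_bernstein_basis (Suc n) (Suc k) q x)
      = (\<Sum>k<n. (1 - q ^ (n - Suc k) * x) * ?b (Suc k) + q ^ (n - k) * x * ?b k) + x * ?b n"
    by (simp add: q_bernstein_basis_Suc q_bernstein_basis_top)
  also have "\<dots> = (\<Sum>k<n. (1 - q ^ (n - Suc k) * x) * ?b (Suc k)) + (\<Sum>k<Suc n. q ^ (n - k) * x * ?b k)"
    by (simp add: sum.distrib)
  also have "q_bernstein_basis (Suc n) 0 q x + \<dots>
      = (\<Sum>k<Suc n. (1 - q ^ (n - k) * x) * ?b k) + (\<Sum>k<Suc n. q ^ (n - k) * x * ?b k)"
    unfolding sum.lessThan_Suc_shift[of "\<lambda>k. (1 - q ^ (n - k) * x) * ?b k"]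
    by (simp add: q_bernstein_basis_Suc_0)
  also have "\<dots> = (\<Sum>k<Suc n. ?b k)"
    by (simp only: sum.distrib[symmetric]) (simp add: algebra_simps)
  finally show ?case using Suc by (simp only: lessThan_Suc_atMost atMost_atLeast0)
qed

text \<open>
  Read from left to right this computes the moments of \<open>[k][k-1]\<dots>\<close>, read from right to left those of
  \<open>1/([k+1][k+2]\<dots>)\<close>. The two tail bounds use one reading each.
\<close>

lemma q_bernstein_basis_shift:
  "q_bernstein_basis (n + s) (k + s) q x * (\<Prod>j<s. q_number q (real (Suc (k + j))))
    = (\<Prod>j<s. q_number q (real (Suc (n + j)))) * x ^ s * q_bernstein_basis n k q x"
proof (induction s)
  case (Suc s)
  have "q_bernstein_basis (n + Suc s) (k + Suc s) q x * q_number q (real (Suc (k + s)))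
      = q_number q (real (Suc (n + s))) * x * q_bernstein_basis (n + s) (k + s) q x"
    using q_bernstein_basis_Suc_Suc[of "n + s" "k + s"] by simp
  then have "q_bernstein_basis (n + Suc s) (k + Suc s) q x * q_number q (real (Suc (k + s)))
      = q_bernstein_basis (n + s) (k + s) q x * (q_number q (real (Suc (n + s))) * x)"
    by (simp only: mult_ac)
  from mult_eq_mult_swap[OF this Suc] show ?case
    by (simp only: prod.lessThan_Suc power_Suc mult_ac)
qed simp

lemma q_bernstein_first_moment:
  "(\<Sum>k=0..n. q_bernstein_basis n k q x * q_number q (real k)) = q_number q (real n) * x"
proof (cases n)
  case 0
  then show ?thesis using q by simp
next
  case (Suc m)
  have "(\<Sum>k=0..n. q_bernstein_basis n k q x * q_number q (real k))
      = (\<Sum>k=0..m. q_bernstein_basis (Suc m) (Suc k) q x * q_number q (real (Suc k)))"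
    unfolding Suc sum.atLeast0_atMost_Suc_shift using q by simp
  also have "\<dots> = q_number q (real n) * x * (\<Sum>k=0..m. q_bernstein_basis m k q x)"
    unfolding q_bernstein_basis_Suc_Suc sum_distrib_left Suc ..
  finally show ?thesis by (simp add: sum_q_bernstein_basis)
qed

lemma q_bernstein_second_moment:
  "(\<Sum>k=0..n. q_bernstein_basis n k q x * q_number q (real k) ^ 2)
    = q_number q (real n) * x * (1 + (q_number q (real n) - 1) * x)"
proof (cases n)
  case 0
  then show ?thesis using q by simp
next
  case (Suc m)
  have S: "q_number q (real (Suc k)) = 1 + q * q_number q (real k)" for k
    using q_number_add[OF q, of 1 "real k"] q by simp
  have "(\<Sum>k=0..n. q_bernstein_basis n k q x * q_number q (real k) ^ 2)
      = (\<Sum>k=0..m. q_bernstein_basis (Suc m) (Suc k) q x * q_number q (real (Suc k)) ^ 2)"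
    unfolding Suc sum.atLeast0_atMost_Suc_shift using q by simp
  also have "\<dots> = (\<Sum>k=0..m. q_number q (real n) * x * q_bernstein_basis m k q x * q_number q (real (Suc k)))"
    unfolding power2_eq_square mult.assoc[symmetric] q_bernstein_basis_Suc_Suc Suc ..
  also have "\<dots> = q_number q (real n) * x * (\<Sum>k=0..m. q_bernstein_basis m k q x * (1 + q * q_number q (real k)))"
    unfolding S sum_distrib_left by (simp only: mult.assoc)
  also have "(\<Sum>k=0..m. q_bernstein_basis m k q x * (1 + q * q_number q (real k)))
      = (\<Sum>k=0..m. q_bernstein_basis m k q x) + q * (\<Sum>k=0..m. q_bernstein_basis m k q x * q_number q (real k))"
    unfolding sum_distrib_left by (simp only: sum.distrib[symmetric]) (simp add: algebra_simps)
  also have "\<dots> = 1 + (q_number q (real n) - 1) * x"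
    unfolding sum_q_bernstein_basis q_bernstein_first_moment Suc S by simp
  finally show ?thesis .
qed

text \<open>
  Markov's inequality for the mean of \<open>1/([k+1]\<dots>[k+s])\<close>, which is at most \<open>1/([n] x)\<^bsup>s\<^esup>\<close>.
\<close>

lemma q_bernstein_lower_tail:
  assumes "0 \<le> v" "0 < n"
  shows "(\<Sum>k | k \<le> n \<and> q_number q (real k) \<le> v. q_bernstein_basis n k q x)
    \<le> ((v + real s) / (q_number q (real n) * x)) ^ s"
proof -
  let ?L = "q_number q (real n)"
  let ?K = "{k. k \<le> n \<and> q_number q (real k) \<le> v}"
  have L: "0 < ?L" using q_number_pos[OF q] assms by simp
  have "(?L * x) ^ s * q_bernstein_basis n k q x
      \<le> (v + real s) ^ s * q_bernstein_basis (n + s) (k + s) q x" if "k \<in> ?K" for k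
  proof -
    have "(?L * x) ^ s * q_bernstein_basis n k q x
        \<le> (\<Prod>j<s. q_number q (real (Suc (n + j)))) * x ^ s * q_bernstein_basis n k q x"
      using prod_mono[of "{..<s}" "\<lambda>j. ?L" "\<lambda>j. q_number q (real (Suc (n + j)))"]
        q_number_mono[OF q, of "real n"] L x q_bernstein_basis_nonneg[of n k]
      unfolding power_mult_distrib by (intro mult_right_mono) auto
    also have "\<dots> = q_bernstein_basis (n + s) (k + s) q x * (\<Prod>j<s. q_number q (real (Suc (k + j))))"
      by (simp only: q_bernstein_basis_shift)
    finally have le: "(?L * x) ^ s * q_bernstein_basis n k q x
        \<le> q_bernstein_basis (n + s) (k + s) q x * (\<Prod>j<s. q_number q (real (Suc (k + j))))" .
    have "(\<Prod>j<s. q_number q (real (Suc (k + j)))) \<le> (\<Prod>j<s. v + real s)"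
    proof (intro prod_mono conjI)
      fix j assume "j \<in> {..<s}"
      then have "q_number q (real (Suc (k + j))) \<le> q_number q (real k) + real (Suc j)"
        using q_number_add_le[OF q, of "real k" "real (Suc j)"] by (simp add: add_ac)
      then show "q_number q (real (Suc (k + j))) \<le> v + real s" using that \<open>j \<in> _\<close> by auto
    qed (use q_number_nonneg[OF q] in auto)
    then have "q_bernstein_basis (n + s) (k + s) q x * (\<Prod>j<s. q_number q (real (Suc (k + j))))
        \<le> q_bernstein_basis (n + s) (k + s) q x * (v + real s) ^ s"
      using q_bernstein_basis_nonneg[of "n + s" "k + s"] by (intro mult_left_mono) auto
    with le show ?thesis by (simp only: mult.commute)
  qed
  then have "(?L * x) ^ s * (\<Sum>k\<in>?K. q_bernstein_basis n k q x)
      \<le> (v + real s) ^ s * (\<Sum>k\<in>?K. q_bernstein_basis (n + s) (k + s) q x)"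
    unfolding sum_distrib_left by (intro sum_mono)
  moreover have "(\<Sum>k\<in>?K. q_bernstein_basis (n + s) (k + s) q x) \<le> 1"
  proof -
    have "(\<Sum>k\<in>?K. q_bernstein_basis (n + s) (k + s) q x)
        = (\<Sum>k\<in>(\<lambda>k. k + s) ` ?K. q_bernstein_basis (n + s) k q x)"
      by (simp add: sum.reindex)
    also have "\<dots> \<le> (\<Sum>k=0..n + s. q_bernstein_basis (n + s) k q x)"
      by (intro sum_mono2 q_bernstein_basis_nonneg) auto
    finally show ?thesis by (simp only: sum_q_bernstein_basis)
  qed
  ultimately show ?thesis using L x assms by (intro le_power_quotient) auto
qed

text \<open>
  Markov's inequality for the mean of \<open>[k][k-1]\<dots>[k-s+1]\<close>, which is at most \<open>([n] x)\<^bsup>s\<^esup>\<close>.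
\<close>

lemma q_bernstein_upper_tail:
  assumes "real s < v"
  shows "(\<Sum>k | k \<le> n \<and> v \<le> q_number q (real k). q_bernstein_basis n k q x)
    \<le> (q_number q (real n) * x / (v - real s)) ^ s"
proof -
  let ?L = "q_number q (real n)"
  let ?K = "{k. k \<le> n \<and> v \<le> q_number q (real k)}"
  have L: "0 \<le> ?L" using q_number_nonneg[OF q] by simp
  (* Truncated subtraction is harmless: [k] \<le> k, so the indices in question are at least s. *)
  have ks: "s \<le> k" if "k \<in> ?K" for k
    using that assms q_number_le_nat[OF q, of k] by simp
  have "(v - real s) ^ s * q_bernstein_basis n k q x
      \<le> (?L * x) ^ s * q_bernstein_basis (n - s) (k - s) q x" if k: "k \<in> ?K" for k
  proof -
    have n: "n - s + s = n" "k - s + s = k" using k ks[OF k] by auto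
    have "(v - real s) ^ s = (\<Prod>j<s. v - real s)" by simp
    also have "\<dots> \<le> (\<Prod>j<s. q_number q (real (Suc (k - s + j))))"
    proof (intro prod_mono conjI)
      fix j
      have "q_number q (real (k - s)) \<le> q_number q (real (Suc (k - s + j)))"
        using q_number_mono[OF q] by simp
      moreover have "real (k - s) + real s = real k" using ks[OF k] by simp
      ultimately show "v - real s \<le> q_number q (real (Suc (k - s + j)))"
        using q_number_diff_ge[OF q, of "real (k - s)" s] k by simp
    qed (use assms in auto)
    finally have "(v - real s) ^ s * q_bernstein_basis n k q x
       \<le> (\<Prod>j<s. q_number q (real (Suc (k - s + j)))) * q_bernstein_basis n k q x"
      using q_bernstein_basis_nonneg by (rule mult_right_mono)
    also have "\<dots> = (\<Prod>j<s. q_number q (real (Suc (n - s + j)))) * x ^ s * q_bernstein_basis (n - s) (k - s) q x"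
      using q_bernstein_basis_shift[of "n - s" s "k - s"] unfolding n by (simp only: mult.commute)
    also have "\<dots> \<le> (\<Prod>j<s. ?L) * x ^ s * q_bernstein_basis (n - s) (k - s) q x"
      using k ks[OF k] x
      by (intro mult_right_mono prod_mono conjI q_bernstein_basis_nonneg q_number_mono[OF q] q_number_nonneg[OF q]) auto
    finally show ?thesis by (simp add: power_mult_distrib)
  qed
  then have "(v - real s) ^ s * (\<Sum>k\<in>?K. q_bernstein_basis n k q x)
      \<le> (?L * x) ^ s * (\<Sum>k\<in>?K. q_bernstein_basis (n - s) (k - s) q x)"
    unfolding sum_distrib_left by (intro sum_mono)
  moreover have "(\<Sum>k\<in>?K. q_bernstein_basis (n - s) (k - s) q x) \<le> 1"
  proof -
    have "inj_on (\<lambda>k. k - s) ?K" using ks by (intro inj_onI) (metis le_add_diff_inverse)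
    then have "(\<Sum>k\<in>?K. q_bernstein_basis (n - s) (k - s) q x)
        = (\<Sum>k\<in>(\<lambda>k. k - s) ` ?K. q_bernstein_basis (n - s) k q x)"
      by (simp add: sum.reindex)
    also have "\<dots> \<le> (\<Sum>k=0..n - s. q_bernstein_basis (n - s) k q x)"
      by (intro sum_mono2 q_bernstein_basis_nonneg) auto
    finally show ?thesis by (simp only: sum_q_bernstein_basis)
  qed
  ultimately show ?thesis using L x assms by (intro le_power_quotient) auto
qed

end
end


section \<open>The operator as a mean of Jackson means\<close>

definition node :: "real \<Rightarrow> real \<Rightarrow> nat \<Rightarrow> real" where
  "node q \<beta> i = q powr (\<beta> + 1) * q ^ i"

definition durrmeyer_mean ::
  "real \<Rightarrow> real \<Rightarrow> nat \<Rightarrow> real \<Rightarrow> real \<Rightarrow> (nat \<Rightarrow> real) \<Rightarrow> real" where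
  "durrmeyer_mean \<alpha> \<beta> n q x h =
     (\<Sum>k=0..n. jackson_mean q (real k + \<alpha>) (real (n - k) + \<beta>) h * q_bernstein_basis n k q x)"

definition durrmeyer_summable :: "real \<Rightarrow> real \<Rightarrow> nat \<Rightarrow> real \<Rightarrow> (nat \<Rightarrow> real) \<Rightarrow> bool" where
  "durrmeyer_summable \<alpha> \<beta> n q h \<longleftrightarrow>
     (\<forall>k\<le>n. summable (\<lambda>i. jackson_weight q (real k + \<alpha>) (real (n - k) + \<beta>) i * h i))"

context
  fixes q :: real
  assumes q: "0 < q" "q < 1"
begin

lemma jackson_integral_eq_weighted_sum:
  "jackson_integral q 1 (\<lambda>t. t powr p * q_shifted_power q (q * t) m * g t)
    = (1 - q) * (\<Sum>i. jackson_weight q p m i * g (q ^ i))"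
proof -
  have "q ^ i * (q ^ i) powr p = q powr (real i * (p + 1))" for i
    using q by (simp add: powr_realpow[symmetric] powr_powr powr_add[symmetric] algebra_simps)
  then have "q ^ i * ((q ^ i) powr p * q_shifted_power q (q * q ^ i) m * g (q ^ i))
      = jackson_weight q p m i * g (q ^ i)" for i
    by (simp add: jackson_weight_def[OF q] jackson_factor_def[OF q] mult.assoc[symmetric])
  then show ?thesis by (simp only: jackson_integral_def mult_1_right mult_1_left)
qed

lemma q_jacobi_coeff_eq_jackson_mean:
  "q_jacobi_coeff \<alpha> \<beta> n k q f
    = jackson_mean q (real k + \<alpha>) (real (n - k) + \<beta>) (\<lambda>i. f (node q \<beta> i))"
  using jackson_integral_eq_weighted_sum[of "real k + \<alpha>" "real (n - k) + \<beta>" "\<lambda>t. f (q powr (\<beta> + 1) * t)"]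
    jackson_integral_eq_weighted_sum[of "real k + \<alpha>" "real (n - k) + \<beta>" "\<lambda>t. 1"] q
  by (simp add: q_jacobi_coeff_def jackson_mean_def[OF q] jackson_total_def[OF q] node_def)

lemma q_durrmeyer_eq_durrmeyer_mean:
  "q_durrmeyer \<alpha> \<beta> n q f x = durrmeyer_mean \<alpha> \<beta> n q x (\<lambda>i. f (node q \<beta> i))"
  by (simp add: q_durrmeyer_def durrmeyer_mean_def q_jacobi_coeff_eq_jackson_mean)

lemma node_bounds:
  assumes "-1 < \<beta>"
  shows "0 < node q \<beta> i" "node q \<beta> i < 1" "node q \<beta> i \<le> q ^ i"
proof -
  show "0 < node q \<beta> i" using q by (simp add: node_def)
  show "node q \<beta> i < 1" using one_minus_factor_pos[OF q assms, of i] by (simp add: node_def)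
  show "node q \<beta> i \<le> q ^ i"
    using q_powr_le_1[OF q, of "\<beta> + 1"] assms q by (simp add: node_def mult_left_le_one_le)
qed

lemma jackson_total_antimono_right:
  assumes "-1 < p" "-1 < m" "m \<le> m'"
  shows "jackson_total q p m' \<le> jackson_total q p m"
  unfolding jackson_total_def[OF q]
proof (intro suminf_le summable_jackson_weight[OF q])
  fix i
  define z where "z = q powr (real i + 1 + m + (m' - m))"
  have "0 \<le> z" "z \<le> 1"
    using q_powr_le_1[OF q, of "real i + 1 + m + (m' - m)"] assms by (auto simp: z_def)
  then have "(1 - z) powr (m' - m) \<le> 1"
    using assms by (intro powr_le1) auto
  then have "(1 - z) powr (m' - m) * jackson_factor q m i \<le> jackson_factor q m i"
    using jackson_factor_pos[OF q assms(2), of i] by simp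
  then have "jackson_factor q m' i \<le> jackson_factor q m i"
    using jackson_factor_exponent_add_le[OF q _ assms(2), of "m' - m" i] assms by (simp add: z_def)
  then show "jackson_weight q p m' i \<le> jackson_weight q p m i"
    using q by (simp add: jackson_weight_def[OF q] mult_left_mono)
qed (use assms in auto)

context
  fixes \<alpha> \<beta> :: real
  assumes ab: "-1 < \<alpha>" "-1 < \<beta>"
begin

lemma summable_bounded:
  assumes "-1 < p" "-1 < m" "\<And>i. \<bar>h i\<bar> \<le> K"
  shows "summable (\<lambda>i. jackson_weight q p m i * h i)"
proof (rule summable_comparison_test')
  show "summable (\<lambda>i. jackson_weight q p m i * K)"
    using summable_jackson_weight[OF q] assms by (intro summable_mult2)
  show "norm (jackson_weight q p m i * h i) \<le> jackson_weight q p m i * K" for i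
    using jackson_weight_pos[OF q assms(2), of p i] assms(3)[of i] by (simp add: abs_mult)
qed

lemma durrmeyer_summable_bounded:
  assumes "\<And>i. \<bar>h i\<bar> \<le> K"
  shows "durrmeyer_summable \<alpha> \<beta> n q h"
  unfolding durrmeyer_summable_def using ab assms by (intro allI impI summable_bounded) auto

lemma durrmeyer_summable_add:
  assumes "durrmeyer_summable \<alpha> \<beta> n q g" "durrmeyer_summable \<alpha> \<beta> n q h"
  shows "durrmeyer_summable \<alpha> \<beta> n q (\<lambda>i. g i + h i)"
  using assms by (auto simp: durrmeyer_summable_def distrib_left intro: summable_add)

lemma durrmeyer_summable_cmult:
  assumes "durrmeyer_summable \<alpha> \<beta> n q h"
  shows "durrmeyer_summable \<alpha> \<beta> n q (\<lambda>i. c * h i)"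
proof -
  have "summable (\<lambda>i. c * (jackson_weight q (real k + \<alpha>) (real (n - k) + \<beta>) i * h i))" if "k \<le> n" for k
    using assms that by (intro summable_mult) (auto simp: durrmeyer_summable_def)
  then show ?thesis by (simp add: durrmeyer_summable_def mult.left_commute)
qed

lemma durrmeyer_summable_le:
  assumes "durrmeyer_summable \<alpha> \<beta> n q h" "\<And>i. \<bar>g i\<bar> \<le> h i"
  shows "durrmeyer_summable \<alpha> \<beta> n q g"
  unfolding durrmeyer_summable_def
proof (intro allI impI)
  fix k assume "k \<le> n"
  show "summable (\<lambda>i. jackson_weight q (real k + \<alpha>) (real (n - k) + \<beta>) i * g i)"
  proof (rule summable_comparison_test')
    show "summable (\<lambda>i. jackson_weight q (real k + \<alpha>) (real (n - k) + \<beta>) i * h i)"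
      using assms \<open>k \<le> n\<close> by (simp add: durrmeyer_summable_def)
    show "norm (jackson_weight q (real k + \<alpha>) (real (n - k) + \<beta>) i * g i)
        \<le> jackson_weight q (real k + \<alpha>) (real (n - k) + \<beta>) i * h i" for i
      using jackson_weight_pos[OF q, of "real (n - k) + \<beta>" "real k + \<alpha>" i] assms(2)[of i] ab
      by (simp add: abs_mult)
  qed
qed

lemma durrmeyer_mean_add:
  assumes "durrmeyer_summable \<alpha> \<beta> n q g" "durrmeyer_summable \<alpha> \<beta> n q h"
  shows "durrmeyer_mean \<alpha> \<beta> n q x (\<lambda>i. g i + h i)
    = durrmeyer_mean \<alpha> \<beta> n q x g + durrmeyer_mean \<alpha> \<beta> n q x h"
  unfolding durrmeyer_mean_def sum.distrib[symmetric]
proof (rule sum.cong)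
  fix k assume "k \<in> {0..n}"
  let ?W = "jackson_weight q (real k + \<alpha>) (real (n - k) + \<beta>)"
  have "(\<Sum>i. ?W i * (g i + h i)) = (\<Sum>i. ?W i * g i) + (\<Sum>i. ?W i * h i)"
    using assms \<open>k \<in> _\<close> unfolding distrib_left durrmeyer_summable_def
    by (intro suminf_add[symmetric]) auto
  then show "jackson_mean q (real k + \<alpha>) (real (n - k) + \<beta>) (\<lambda>i. g i + h i) * q_bernstein_basis n k q x
    = jackson_mean q (real k + \<alpha>) (real (n - k) + \<beta>) g * q_bernstein_basis n k q x
      + jackson_mean q (real k + \<alpha>) (real (n - k) + \<beta>) h * q_bernstein_basis n k q x"
    by (simp only: jackson_mean_def[OF q] add_divide_distrib distrib_right)
qed simp

lemma durrmeyer_mean_cmult: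
  assumes "durrmeyer_summable \<alpha> \<beta> n q h"
  shows "durrmeyer_mean \<alpha> \<beta> n q x (\<lambda>i. c * h i) = c * durrmeyer_mean \<alpha> \<beta> n q x h"
  unfolding durrmeyer_mean_def sum_distrib_left
proof (rule sum.cong)
  fix k assume "k \<in> {0..n}"
  let ?W = "jackson_weight q (real k + \<alpha>) (real (n - k) + \<beta>)"
  have "(\<Sum>i. ?W i * (c * h i)) = c * (\<Sum>i. ?W i * h i)"
    using assms \<open>k \<in> _\<close> unfolding mult.left_commute[of _ c] durrmeyer_summable_def
    by (intro suminf_mult) auto
  then show "jackson_mean q (real k + \<alpha>) (real (n - k) + \<beta>) (\<lambda>i. c * h i) * q_bernstein_basis n k q x
    = c * (jackson_mean q (real k + \<alpha>) (real (n - k) + \<beta>) h * q_bernstein_basis n k q x)"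
    by (simp only: jackson_mean_def[OF q] times_divide_eq_right times_divide_eq_left mult.assoc)
qed simp

lemma durrmeyer_mean_mono:
  assumes "durrmeyer_summable \<alpha> \<beta> n q g" "durrmeyer_summable \<alpha> \<beta> n q h" "\<And>i. g i \<le> h i" "0 < x" "x < 1"
  shows "durrmeyer_mean \<alpha> \<beta> n q x g \<le> durrmeyer_mean \<alpha> \<beta> n q x h"
  unfolding durrmeyer_mean_def
proof (rule sum_mono)
  fix k assume "k \<in> {0..n}"
  moreover have "0 < jackson_total q (real k + \<alpha>) (real (n - k) + \<beta>)"
    using ab by (intro jackson_total_pos[OF q]) auto
  moreover have "0 < jackson_weight q (real k + \<alpha>) (real (n - k) + \<beta>) i" for i
    using ab by (intro jackson_weight_pos[OF q]) auto
  ultimately show "jackson_mean q (real k + \<alpha>) (real (n - k) + \<beta>) g * q_bernstein_basis n k q x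
      \<le> jackson_mean q (real k + \<alpha>) (real (n - k) + \<beta>) h * q_bernstein_basis n k q x"
    using assms unfolding jackson_mean_def[OF q] durrmeyer_summable_def
    by (intro mult_right_mono divide_right_mono suminf_le q_bernstein_basis_nonneg[OF q]) (auto simp: less_imp_le)
qed

lemma durrmeyer_mean_abs_le:
  assumes "durrmeyer_summable \<alpha> \<beta> n q h" "\<And>i. \<bar>g i\<bar> \<le> h i" "0 < x" "x < 1"
  shows "\<bar>durrmeyer_mean \<alpha> \<beta> n q x g\<bar> \<le> durrmeyer_mean \<alpha> \<beta> n q x h"
proof -
  have g: "durrmeyer_summable \<alpha> \<beta> n q g" using assms(1,2) by (rule durrmeyer_summable_le)
  have "durrmeyer_mean \<alpha> \<beta> n q x g \<le> durrmeyer_mean \<alpha> \<beta> n q x h"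
    using assms g by (intro durrmeyer_mean_mono) (auto intro: order_trans[OF abs_ge_self])
  moreover have "durrmeyer_mean \<alpha> \<beta> n q x (\<lambda>i. -1 * g i) \<le> durrmeyer_mean \<alpha> \<beta> n q x h"
    using assms g by (intro durrmeyer_mean_mono durrmeyer_summable_cmult) (auto simp: abs_le_iff)
  ultimately show ?thesis unfolding durrmeyer_mean_cmult[OF g] by (simp add: abs_le_iff)
qed

lemma jackson_mean_node_power:
  assumes "-1 < p" "-1 < m"
  shows "jackson_mean q p m (\<lambda>i. node q \<beta> i ^ s)
    = (q powr (\<beta> + 1)) ^ s * (jackson_total q (p + real s) m / jackson_total q p m)"
proof -
  have "jackson_weight q p m i * node q \<beta> i ^ s = (q powr (\<beta> + 1)) ^ s * jackson_weight q (p + real s) m i" for i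
    unfolding jackson_weight_add_nat[OF q] node_def power_mult_distrib by (simp only: mult_ac)
  then show ?thesis
    using suminf_mult[OF summable_jackson_weight[OF q, of "p + real s" m]] assms
    by (simp add: jackson_mean_def[OF q] jackson_total_def[OF q])
qed

lemma durrmeyer_mean_const:
  assumes "0 < x" "x < 1"
  shows "durrmeyer_mean \<alpha> \<beta> n q x (\<lambda>i. c) = c"
proof -
  have "jackson_mean q (real k + \<alpha>) (real (n - k) + \<beta>) (\<lambda>i. 1) = 1" for k
    using jackson_mean_node_power[of "real k + \<alpha>" "real (n - k) + \<beta>" 0]
      jackson_total_pos[OF q, of "real k + \<alpha>" "real (n - k) + \<beta>"] ab by simp
  then have "durrmeyer_mean \<alpha> \<beta> n q x (\<lambda>i. 1) = 1"
    by (simp add: durrmeyer_mean_def sum_q_bernstein_basis[OF q assms] del: of_nat_diff)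
  then show ?thesis
    using durrmeyer_mean_cmult[OF durrmeyer_summable_bounded[of "\<lambda>i. 1" 1 n], of x c] by simp
qed

lemma durrmeyer_mean_node:
  assumes "0 < x" "x < 1"
  shows "durrmeyer_mean \<alpha> \<beta> n q x (node q \<beta>)
    = q powr (\<beta> + 1) * (q_number q (\<alpha> + 1) + q powr (\<alpha> + 1) * q_number q (real n) * x)
      / q_number q (real n + \<alpha> + \<beta> + 2)"
proof -
  let ?N = "q_number q (real n + \<alpha> + \<beta> + 2)"
  have N: "0 < ?N" using ab by (intro q_number_pos[OF q]) auto
  have mean: "jackson_mean q (real k + \<alpha>) (real (n - k) + \<beta>) (node q \<beta>)
      = q powr (\<beta> + 1) * (q_number q (\<alpha> + 1) + q powr (\<alpha> + 1) * q_number q (real k)) / ?N" if "k \<le> n" for k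
  proof -
    define p m where "p = real k + \<alpha>" and "m = real (n - k) + \<beta>"
    have pm: "-1 < p" "-1 < m" "p + m + 2 = real n + \<alpha> + \<beta> + 2" "p + 1 = (\<alpha> + 1) + real k"
      using ab that by (auto simp: p_def m_def of_nat_diff)
    have "jackson_total q (p + 1) m * ?N = jackson_total q p m * q_number q (p + 1)"
      using jackson_total_shift_left[OF q pm(1,2)] unfolding pm(3) .
    moreover have "0 < jackson_total q p m" using jackson_total_pos[OF q pm(1,2)] .
    ultimately have "jackson_total q (p + 1) m / jackson_total q p m = q_number q (p + 1) / ?N"
      using N by (simp add: frac_eq_eq mult.commute)
    moreover have "q_number q (p + 1) = q_number q (\<alpha> + 1) + q powr (\<alpha> + 1) * q_number q (real k)"
      unfolding pm(4) q_number_add[OF q] ..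
    ultimately show ?thesis
      using jackson_mean_node_power[OF pm(1,2), of 1] by (simp add: p_def m_def)
  qed
  have "durrmeyer_mean \<alpha> \<beta> n q x (node q \<beta>)
    = (\<Sum>k=0..n. q powr (\<beta> + 1) / ?N * (q_number q (\<alpha> + 1) * q_bernstein_basis n k q x
        + q powr (\<alpha> + 1) * (q_bernstein_basis n k q x * q_number q (real k))))"
    unfolding durrmeyer_mean_def
  proof (rule sum.cong[OF refl])
    fix k assume "k \<in> {0..n}"
    then have "k \<le> n" by simp
    show "jackson_mean q (real k + \<alpha>) (real (n - k) + \<beta>) (node q \<beta>) * q_bernstein_basis n k q x
      = q powr (\<beta> + 1) / ?N * (q_number q (\<alpha> + 1) * q_bernstein_basis n k q x
        + q powr (\<alpha> + 1) * (q_bernstein_basis n k q x * q_number q (real k)))"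
      unfolding mean[OF \<open>k \<le> n\<close>] by (simp add: add_divide_distrib algebra_simps)
  qed
  also have "\<dots> = q powr (\<beta> + 1) / ?N * (q_number q (\<alpha> + 1) * (\<Sum>k=0..n. q_bernstein_basis n k q x)
        + q powr (\<alpha> + 1) * (\<Sum>k=0..n. q_bernstein_basis n k q x * q_number q (real k)))"
    by (simp only: sum_distrib_left[symmetric] sum.distrib)
  finally show ?thesis
    by (simp add: sum_q_bernstein_basis[OF q assms] q_bernstein_first_moment[OF q assms] mult.assoc)
qed

lemma durrmeyer_mean_node_square:
  fixes x :: real and n :: nat
  assumes "0 < x" "x < 1"
  defines "L \<equiv> q_number q (real n)"
  shows "durrmeyer_mean \<alpha> \<beta> n q x (\<lambda>i. node q \<beta> i ^ 2)
    = (q powr (\<beta> + 1)) ^ 2 *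
       (q_number q (\<alpha> + 1) * q_number q (\<alpha> + 2)
        + (q_number q (\<alpha> + 1) * q powr (\<alpha> + 2) + q_number q (\<alpha> + 2) * q powr (\<alpha> + 1)) * (L * x)
        + q powr (\<alpha> + 1) * q powr (\<alpha> + 2) * (L * x * (1 + (L - 1) * x)))
      / (q_number q (real n + \<alpha> + \<beta> + 2) * q_number q (real n + \<alpha> + \<beta> + 3))"
proof -
  let ?N = "q_number q (real n + \<alpha> + \<beta> + 2)" and ?N' = "q_number q (real n + \<alpha> + \<beta> + 3)"
  let ?a = "q_number q (\<alpha> + 1)" and ?a' = "q_number q (\<alpha> + 2)"
  let ?r = "q powr (\<alpha> + 1)" and ?r' = "q powr (\<alpha> + 2)"
  have N: "0 < ?N" "0 < ?N'" using ab by (auto intro!: q_number_pos[OF q])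
  have mean: "jackson_mean q (real k + \<alpha>) (real (n - k) + \<beta>) (\<lambda>i. node q \<beta> i ^ 2)
      = (q powr (\<beta> + 1)) ^ 2 * ((?a + ?r * q_number q (real k)) * (?a' + ?r' * q_number q (real k))) / (?N * ?N')"
    if "k \<le> n" for k
  proof -
    define p m where "p = real k + \<alpha>" and "m = real (n - k) + \<beta>"
    have pm: "-1 < p" "-1 < p + 1" "-1 < m" "p + m + 2 = real n + \<alpha> + \<beta> + 2"
      "p + 1 + m + 2 = real n + \<alpha> + \<beta> + 3" "p + 1 = (\<alpha> + 1) + real k" "p + 1 + 1 = (\<alpha> + 2) + real k"
      using ab that by (auto simp: p_def m_def of_nat_diff)
    have 1: "jackson_total q (p + 1) m * ?N = jackson_total q p m * q_number q (p + 1)"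
      using jackson_total_shift_left[OF q pm(1,3)] unfolding pm(4) .
    have 2: "jackson_total q (p + 1 + 1) m * ?N' = jackson_total q (p + 1) m * q_number q (p + 1 + 1)"
      using jackson_total_shift_left[OF q pm(2,3)] unfolding pm(5) .
    have "jackson_total q (p + 1 + 1) m * (?N * ?N') = jackson_total q p m * (q_number q (p + 1) * q_number q (p + 1 + 1))"
      by (rule mult_eq_mult_swap[OF 2 1])
    moreover have "0 < jackson_total q p m" using jackson_total_pos[OF q pm(1,3)] .
    ultimately have "jackson_total q (p + 1 + 1) m / jackson_total q p m
        = q_number q (p + 1) * q_number q (p + 1 + 1) / (?N * ?N')"
      using N by (simp add: frac_eq_eq mult.commute)
    moreover have "q_number q (p + 1) = ?a + ?r * q_number q (real k)"
      "q_number q (p + 1 + 1) = ?a' + ?r' * q_number q (real k)"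
      unfolding pm(7) unfolding pm(6) q_number_add[OF q] by auto
    ultimately show ?thesis
      using jackson_mean_node_power[OF pm(1,3), of 2] by (simp add: p_def m_def add.assoc)
  qed
  have "durrmeyer_mean \<alpha> \<beta> n q x (\<lambda>i. node q \<beta> i ^ 2)
    = (\<Sum>k=0..n. (q powr (\<beta> + 1)) ^ 2 / (?N * ?N') * (?a * ?a' * q_bernstein_basis n k q x
        + (?a * ?r' + ?a' * ?r) * (q_bernstein_basis n k q x * q_number q (real k))
        + ?r * ?r' * (q_bernstein_basis n k q x * q_number q (real k) ^ 2)))"
    unfolding durrmeyer_mean_def
  proof (rule sum.cong[OF refl])
    fix k assume "k \<in> {0..n}"
    then have "k \<le> n" by simp
    show "jackson_mean q (real k + \<alpha>) (real (n - k) + \<beta>) (\<lambda>i. node q \<beta> i ^ 2) * q_bernstein_basis n k q x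
      = (q powr (\<beta> + 1)) ^ 2 / (?N * ?N') * (?a * ?a' * q_bernstein_basis n k q x
        + (?a * ?r' + ?a' * ?r) * (q_bernstein_basis n k q x * q_number q (real k))
        + ?r * ?r' * (q_bernstein_basis n k q x * q_number q (real k) ^ 2))"
      unfolding mean[OF \<open>k \<le> n\<close>] by (simp add: power2_eq_square add_divide_distrib algebra_simps)
  qed
  also have "\<dots> = (q powr (\<beta> + 1)) ^ 2 / (?N * ?N') * (?a * ?a' * (\<Sum>k=0..n. q_bernstein_basis n k q x)
        + (?a * ?r' + ?a' * ?r) * (\<Sum>k=0..n. q_bernstein_basis n k q x * q_number q (real k))
        + ?r * ?r' * (\<Sum>k=0..n. q_bernstein_basis n k q x * q_number q (real k) ^ 2))"
    by (simp only: sum_distrib_left[symmetric] sum.distrib)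
  finally show ?thesis
    unfolding sum_q_bernstein_basis[OF q assms(1,2)] q_bernstein_first_moment[OF q assms(1,2)]
      q_bernstein_second_moment[OF q assms(1,2)] L_def
    by (simp only: mult_1_right times_divide_eq_left)
qed

end
end


context
  fixes q \<alpha> \<beta> :: real
  assumes q: "0 < q" "q < 1" and ab: "-1 < \<alpha>" "-1 < \<beta>"
begin

text \<open>
  Given \<open>k\<close>, the nodes concentrate near \<open>[k] / [n]\<close>. The two tails are therefore estimated differently
  for the indices \<open>k\<close> on the two sides of a threshold: on one side the Jackson mean is small, on the
  other side the sum of the basis is.
\<close>

lemma durrmeyer_mean_split_le:
  assumes low: "\<And>k. k \<le> n \<Longrightarrow> q_number q (real k) \<le> v \<Longrightarrow>
      jackson_mean q (real k + \<alpha>) (real (n - k) + \<beta>) h \<le> U"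
    and high: "\<And>k. k \<le> n \<Longrightarrow> v \<le> q_number q (real k) \<Longrightarrow>
      jackson_mean q (real k + \<alpha>) (real (n - k) + \<beta>) h \<le> V"
    and "0 \<le> U" "0 \<le> V" "0 < x" "x < 1"
  shows "durrmeyer_mean \<alpha> \<beta> n q x h
    \<le> U * (\<Sum>k | k \<le> n \<and> q_number q (real k) \<le> v. q_bernstein_basis n k q x)
      + V * (\<Sum>k | k \<le> n \<and> v \<le> q_number q (real k). q_bernstein_basis n k q x)"
proof -
  let ?b = "\<lambda>k. q_bernstein_basis n k q x"
  have b: "0 \<le> ?b k" for k using q_bernstein_basis_nonneg[OF q] assms by simp
  have "durrmeyer_mean \<alpha> \<beta> n q x h \<le> (\<Sum>k=0..n. (if q_number q (real k) \<le> v then U * ?b k else 0)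
      + (if v \<le> q_number q (real k) then V * ?b k else 0))"
    unfolding durrmeyer_mean_def
  proof (rule sum_mono)
    fix k assume "k \<in> {0..n}"
    then have k: "k \<le> n" by simp
    show "jackson_mean q (real k + \<alpha>) (real (n - k) + \<beta>) h * ?b k
      \<le> (if q_number q (real k) \<le> v then U * ?b k else 0) + (if v \<le> q_number q (real k) then V * ?b k else 0)"
    proof (cases "q_number q (real k) \<le> v")
      case True
      then have "jackson_mean q (real k + \<alpha>) (real (n - k) + \<beta>) h * ?b k \<le> U * ?b k"
        using low[OF k] b by (intro mult_right_mono) auto
      moreover have "0 \<le> V * ?b k" using assms b by simp
      ultimately show ?thesis using True by (simp del: of_nat_diff)
    next
      case False
      then have "jackson_mean q (real k + \<alpha>) (real (n - k) + \<beta>) h * ?b k \<le> V * ?b k"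
        using high[OF k] b by (intro mult_right_mono) auto
      then show ?thesis using False by (simp del: of_nat_diff)
    qed
  qed
  also have "\<dots> = (\<Sum>k\<in>{k\<in>{0..n}. q_number q (real k) \<le> v}. U * ?b k)
      + (\<Sum>k\<in>{k\<in>{0..n}. v \<le> q_number q (real k)}. V * ?b k)"
    unfolding sum.distrib by (simp only: sum.inter_filter[OF finite_atLeastAtMost])
  finally show ?thesis by (simp add: sum_distrib_left)
qed

section \<open>The lower tail of the operator\<close>

text \<open>
  The price of the singular factor for an arbitrary \<open>k\<close>. The first parameter is lowered by \<open>a\<close> and then
  raised by the natural number \<open>A \<ge> a\<close>. The total mass is then at most the original one, and the
  ratio that belongs to the integral shift is an explicit product.
\<close>

lemma lower_tail_mean_le_crude:
  assumes "k \<le> n" "0 \<le> a" "a < \<alpha> + 1" "a \<le> real A"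
  shows "jackson_mean q (real k + \<alpha>) (real (n - k) + \<beta>) (lower_tail q a y)
    \<le> ((q_number q (real n) + (\<alpha> + \<beta> + 3 + real A)) / min 1 (\<alpha> - a + 1)) ^ A"
proof -
  define p m where "p = real k + \<alpha>" and "m = real (n - k) + \<beta>"
  have pm: "-1 < p" "-1 < p - a" "-1 < m" "p + m = real n + \<alpha> + \<beta>" "\<alpha> \<le> p"
    using assms ab by (auto simp: p_def m_def of_nat_diff)
  have T: "0 < jackson_total q p m" "0 < jackson_total q (p - a) m" "0 < jackson_total q (p - a + real A) m"
    using pm by (auto intro!: jackson_total_pos[OF q])
  have "jackson_total q (p - a) m
      \<le> ((q_number q (real n) + (\<alpha> + \<beta> + 3 + real A)) / min 1 (\<alpha> - a + 1)) ^ A * jackson_total q (p - a + real A) m"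
  proof (rule quotient_le_power[OF jackson_total_left_prod[OF q pm(2,3), symmetric]])
    fix j assume "j < A"
    have "min 1 (\<alpha> - a + 1) \<le> q_number q (\<alpha> - a + 1)"
      using assms by (intro q_number_ge_min[OF q]) auto
    also have "\<dots> \<le> q_number q (p - a + 1 + real j)" using pm by (intro q_number_mono[OF q]) auto
    finally show "min 1 (\<alpha> - a + 1) \<le> q_number q (p - a + 1 + real j)" .
    show "0 \<le> q_number q (p - a + m + 2 + real j)" using pm by (intro q_number_nonneg[OF q]) auto
    have "q_number q (p - a + m + 2 + real j) \<le> q_number q (real n + (\<alpha> + \<beta> + 3 + real A))"
      using pm assms \<open>j < A\<close> by (intro q_number_mono[OF q]) auto
    also have "\<dots> \<le> q_number q (real n) + max 1 (\<alpha> + \<beta> + 3 + real A)"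
      using ab by (intro q_number_add_le[OF q]) auto
    finally show "q_number q (p - a + m + 2 + real j) \<le> q_number q (real n) + (\<alpha> + \<beta> + 3 + real A)"
      using ab by simp
  qed (use T assms in auto)
  also have "\<dots> \<le> ((q_number q (real n) + (\<alpha> + \<beta> + 3 + real A)) / min 1 (\<alpha> - a + 1)) ^ A * jackson_total q p m"
    using pm assms ab q_number_nonneg[OF q, of "real n"]
    by (intro mult_left_mono jackson_total_antimono[OF q] zero_le_power divide_nonneg_nonneg) auto
  finally show ?thesis
    using lower_tail_sum_le_crude[OF q pm(2,3), of y] T(1)
    by (simp add: jackson_mean_def[OF q] p_def[symmetric] m_def[symmetric] divide_le_eq del: of_nat_diff)
qed

text \<open>
  For large \<open>[k]\<close> the negative moment of order \<open>A + s\<close> is finite and its factors are at most about \<open>[n] / v\<close>.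
\<close>

lemma lower_tail_mean_le_above:
  assumes "k \<le> n" "0 \<le> a" "a \<le> real A" "0 < y"
    and v: "real (A + s) < v" "v \<le> q_number q (real k)"
  shows "jackson_mean q (real k + \<alpha>) (real (n - k) + \<beta>) (lower_tail q a y)
    \<le> y ^ s * ((q_number q (real n) + (\<alpha> + \<beta> + 3)) / (v - real (A + s))) ^ (A + s)"
proof -
  define p m where "p = real k + \<alpha>" and "m = real (n - k) + \<beta>"
  define r where "r = A + s"
  (* This is what makes p - r > -1, so that the negative moment of order r is finite. *)
  have rk: "r \<le> k" using v q_number_le_nat[OF q, of k] by (simp add: r_def)
  have pm: "-1 < p" "-1 < p - real r" "-1 < m" "p + m = real n + \<alpha> + \<beta>"
    using assms ab rk by (auto simp: p_def m_def of_nat_diff)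
  have T: "0 < jackson_total q p m" "0 < jackson_total q (p - real r) m"
    using pm by (auto intro!: jackson_total_pos[OF q])
  have eq: "jackson_total q (p - real r) m * (\<Prod>j<r. q_number q (p - real r + 1 + real j))
      = jackson_total q p m * (\<Prod>j<r. q_number q (p - real r + m + 2 + real j))"
    using jackson_total_left_prod[OF q pm(2,3), of r] by simp
  have "jackson_total q (p - real r) m
      \<le> ((q_number q (real n) + (\<alpha> + \<beta> + 3)) / (v - real r)) ^ r * jackson_total q p m"
  proof (rule quotient_le_power[OF eq])
    fix j assume "j < r"
    have "v - real r \<le> q_number q (real (k - r))"
      using q_number_diff_ge[OF q, of "real (k - r)" r] v rk by simp
    also have "\<dots> \<le> q_number q (p - real r + 1 + real j)"
      using rk ab by (intro q_number_mono[OF q]) (auto simp: p_def)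
    finally show "v - real r \<le> q_number q (p - real r + 1 + real j)" .
    show "0 \<le> q_number q (p - real r + m + 2 + real j)" using pm by (intro q_number_nonneg[OF q]) auto
    have "q_number q (p - real r + m + 2 + real j) \<le> q_number q (real n + (\<alpha> + \<beta> + 3))"
      using pm assms \<open>j < r\<close> by (intro q_number_mono[OF q]) auto
    also have "\<dots> \<le> q_number q (real n) + max 1 (\<alpha> + \<beta> + 3)"
      using ab by (intro q_number_add_le[OF q]) auto
    finally show "q_number q (p - real r + m + 2 + real j) \<le> q_number q (real n) + (\<alpha> + \<beta> + 3)"
      using ab by simp
  qed (use T v in \<open>auto simp: r_def\<close>)
  then have "y ^ s * jackson_total q (p - real r) m
      \<le> y ^ s * (((q_number q (real n) + (\<alpha> + \<beta> + 3)) / (v - real r)) ^ r * jackson_total q p m)"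
    using assms by (intro mult_left_mono) auto
  moreover have "(\<Sum>i. jackson_weight q p m i * lower_tail q a y i) \<le> y ^ s * jackson_total q (p - real r) m"
    using lower_tail_sum_le_negative_moment[OF q, of p A s m a y] pm assms by (simp add: r_def)
  ultimately show ?thesis
    using T(1) unfolding jackson_mean_def[OF q] p_def[symmetric] m_def[symmetric] r_def[symmetric]
    by (simp add: divide_le_eq mult.assoc)
qed

lemma durrmeyer_summable_lower_tail:
  assumes "a < \<alpha> + 1"
  shows "durrmeyer_summable \<alpha> \<beta> n q (lower_tail q a y)"
  unfolding durrmeyer_summable_def
  using assms ab by (intro allI impI summable_lower_tail[OF q]) auto

text \<open>
  The threshold \<open>v\<close> is to be thought of as a multiple of \<open>[n]\<close> strictly between \<open>[n] y\<close> and \<open>[n] x\<close>, and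
  \<open>s\<close> as a small multiple of \<open>[n]\<close>; then the powers of order \<open>s\<close> have bases smaller than \<open>1\<close>.
\<close>

lemma durrmeyer_mean_lower_tail_le:
  assumes "0 < n" "0 < x" "x < 1" "0 \<le> a" "a < \<alpha> + 1" "a \<le> real A" "0 < y" "real (A + s) < v"
  shows "durrmeyer_mean \<alpha> \<beta> n q x (lower_tail q a y)
    \<le> ((q_number q (real n) + (\<alpha> + \<beta> + 3 + real A)) / min 1 (\<alpha> - a + 1)) ^ A
        * ((v + real s) / (q_number q (real n) * x)) ^ s
      + y ^ s * ((q_number q (real n) + (\<alpha> + \<beta> + 3)) / (v - real (A + s))) ^ (A + s)"
proof -
  let ?U = "((q_number q (real n) + (\<alpha> + \<beta> + 3 + real A)) / min 1 (\<alpha> - a + 1)) ^ A"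
  let ?V = "y ^ s * ((q_number q (real n) + (\<alpha> + \<beta> + 3)) / (v - real (A + s))) ^ (A + s)"
  let ?lo = "\<Sum>k | k \<le> n \<and> q_number q (real k) \<le> v. q_bernstein_basis n k q x"
  let ?hi = "\<Sum>k | k \<le> n \<and> v \<le> q_number q (real k). q_bernstein_basis n k q x"
  have L: "0 \<le> q_number q (real n)" using q_number_nonneg[OF q] by simp
  have U: "0 \<le> ?U" using L assms ab by (intro zero_le_power divide_nonneg_nonneg) auto
  have V: "0 \<le> ?V" using L assms ab by (intro mult_nonneg_nonneg zero_le_power divide_nonneg_nonneg) auto
  have "durrmeyer_mean \<alpha> \<beta> n q x (lower_tail q a y) \<le> ?U * ?lo + ?V * ?hi"
    using assms U V by (intro durrmeyer_mean_split_le lower_tail_mean_le_crude lower_tail_mean_le_above) auto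
  also have "?U * ?lo \<le> ?U * ((v + real s) / (q_number q (real n) * x)) ^ s"
    using assms U by (intro mult_left_mono q_bernstein_lower_tail[OF q]) auto
  also have "?V * ?hi \<le> ?V * 1"
  proof -
    have "?hi \<le> (\<Sum>k=0..n. q_bernstein_basis n k q x)"
      using assms by (intro sum_mono2 q_bernstein_basis_nonneg[OF q]) auto
    then show ?thesis using V sum_q_bernstein_basis[OF q assms(2,3)] by (intro mult_left_mono) auto
  qed
  finally show ?thesis by simp
qed

section \<open>The upper tail of the operator\<close>

text \<open>
  The power of order \<open>b\<close> comes from absorbing the singularity into the second parameter, which is
  lowered by \<open>b\<close>, and the power of order \<open>B\<close> from raising this parameter again by the natural number
  \<open>B \<ge> b\<close>. The last quotient is the moment of order \<open>s\<close> of \<open>q\<^bsup>i\<^esup>\<close>; for \<open>s = 0\<close> it is \<open>1\<close>.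
\<close>

lemma upper_tail_mean_le:
  fixes s :: nat
  assumes "k \<le> n" "0 \<le> b" "b < \<beta> + 1" "b \<le> real B" "0 < y"
  defines "\<kappa> \<equiv> min 1 (\<beta> - b + 1)"
  shows "jackson_mean q (real k + \<alpha>) (real (n - k) + \<beta>) (upper_tail q \<beta> b y)
    \<le> (1 + q_number q (real n) / \<kappa>) powr b
       * ((q_number q (real n) + (\<alpha> + \<beta> + 3 + real s + real B)) / \<kappa>) ^ B / y ^ s
       * (jackson_total q (real k + \<alpha> + real s) (real (n - k) + \<beta>)
          / jackson_total q (real k + \<alpha>) (real (n - k) + \<beta>))"
proof -
  define d where "d = n - k"
  define p m where "p = real k + \<alpha> + real s" and "m = real d + \<beta>"
  have \<kappa>: "0 < \<kappa>" "\<kappa> \<le> \<beta> - b + 1" "\<kappa> \<le> 1" using assms by (auto simp: \<kappa>_def)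
  have pm: "-1 < p" "-1 < m" "-1 < m - b" "p + m = real n + real s + \<alpha> + \<beta>" "\<beta> \<le> m"
    using assms(1-5) ab by (auto simp: p_def m_def d_def of_nat_diff)
  have T: "0 < jackson_total q p m" "0 < jackson_total q p (m - b)" "0 < jackson_total q p (m - b + real B)"
    "0 < jackson_total q (real k + \<alpha>) m"
    using pm ab by (auto intro!: jackson_total_pos[OF q])
  let ?L = "q_number q (real n)"
  let ?C = "1 + q_number q (real d) / q_number q (\<beta> + 1)"
  let ?D = "((?L + (\<alpha> + \<beta> + 3 + real s + real B)) / \<kappa>) ^ B"
  have L: "0 \<le> ?L" using q_number_nonneg[OF q] by simp
  have "jackson_total q p (m - b) \<le> ?D * jackson_total q p (m - b + real B)"
  proof (rule quotient_le_power[OF jackson_total_right_prod[OF q pm(1,3), symmetric]])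
    fix j assume "j < B"
    have "\<kappa> \<le> q_number q (\<beta> - b + 1)"
      unfolding \<kappa>_def using assms(3) by (intro q_number_ge_min[OF q]) auto
    also have "\<dots> \<le> q_number q (m - b + 1 + real j)" using pm by (intro q_number_mono[OF q]) auto
    finally show "\<kappa> \<le> q_number q (m - b + 1 + real j)" .
    show "0 \<le> q_number q (p + (m - b) + 2 + real j)" using pm by (intro q_number_nonneg[OF q]) auto
    have "q_number q (p + (m - b) + 2 + real j) \<le> q_number q (real n + (\<alpha> + \<beta> + 3 + real s + real B))"
      using pm assms(2) \<open>j < B\<close> by (intro q_number_mono[OF q]) auto
    also have "\<dots> \<le> ?L + max 1 (\<alpha> + \<beta> + 3 + real s + real B)"
      using ab by (intro q_number_add_le[OF q]) auto
    finally show "q_number q (p + (m - b) + 2 + real j) \<le> ?L + (\<alpha> + \<beta> + 3 + real s + real B)"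
      using ab by simp
  qed (use T \<kappa> in auto)
  also have "\<dots> \<le> ?D * jackson_total q p m"
    using pm assms(4) ab L \<kappa>
    by (intro mult_left_mono jackson_total_antimono_right[OF q] zero_le_power divide_nonneg_nonneg) auto
  finally have D: "jackson_total q p (m - b) \<le> ?D * jackson_total q p m" .
  have "?C \<le> 1 + ?L / \<kappa>"
  proof -
    have "\<kappa> \<le> q_number q (\<beta> + 1)"
      using q_number_ge_min[OF q, of "\<beta> + 1"] ab \<kappa> assms(2) by auto
    moreover have "q_number q (real d) \<le> ?L" by (intro q_number_mono[OF q]) (simp add: d_def)
    ultimately show ?thesis
      using \<kappa> L q_number_nonneg[OF q, of "real d"] by (intro add_left_mono frac_le) auto
  qed
  moreover have "0 \<le> ?C" using q_number_nonneg[OF q] ab by simp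
  ultimately have C: "?C powr b \<le> (1 + ?L / \<kappa>) powr b"
    using assms(2) by (intro powr_mono2) auto
  have "(\<Sum>i. jackson_weight q (real k + \<alpha>) m i * upper_tail q \<beta> b y i)
      \<le> ?C powr b / y ^ s * jackson_total q p (m - b)"
    unfolding p_def m_def using assms(2-5) ab by (intro upper_tail_sum_le[OF q]) auto
  also have "\<dots> \<le> (1 + ?L / \<kappa>) powr b / y ^ s * (?D * jackson_total q p m)"
    using C D T assms(5) by (intro mult_mono divide_right_mono) auto
  finally have le: "(\<Sum>i. jackson_weight q (real k + \<alpha>) m i * upper_tail q \<beta> b y i)
      \<le> (1 + ?L / \<kappa>) powr b / y ^ s * (?D * jackson_total q p m)" .
  show ?thesis
    using divide_right_mono[OF le, of "jackson_total q (real k + \<alpha>) m"] T(4)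
    unfolding jackson_mean_def[OF q] d_def[symmetric] m_def[symmetric] p_def[symmetric]
    by (simp add: mult.assoc)
qed

lemma jackson_total_shift_le_below:
  assumes "k \<le> n" "0 < n" "q_number q (real k) \<le> v"
  shows "jackson_total q (real k + \<alpha> + real s) (real (n - k) + \<beta>)
          / jackson_total q (real k + \<alpha>) (real (n - k) + \<beta>)
      \<le> ((v + (\<alpha> + 2 + real s)) / q_number q (real n)) ^ s"
proof -
  define p m where "p = real k + \<alpha>" and "m = real (n - k) + \<beta>"
  have pm: "-1 < p" "-1 < m" "p + m = real n + \<alpha> + \<beta>"
    using assms ab by (auto simp: p_def m_def of_nat_diff)
  have T: "0 < jackson_total q p m" "0 < jackson_total q (p + real s) m"
    using pm by (auto intro!: jackson_total_pos[OF q])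
  have "jackson_total q (p + real s) m
      \<le> ((v + (\<alpha> + 2 + real s)) / q_number q (real n)) ^ s * jackson_total q p m"
  proof (rule quotient_le_power[OF jackson_total_left_prod[OF q pm(1,2)]])
    fix j assume "j < s"
    show "q_number q (real n) \<le> q_number q (p + m + 2 + real j)"
      using pm ab by (intro q_number_mono[OF q]) auto
    show "0 \<le> q_number q (p + 1 + real j)" using pm by (intro q_number_nonneg[OF q]) auto
    have "q_number q (p + 1 + real j) \<le> q_number q (real k + (\<alpha> + 2 + real s))"
      using \<open>j < s\<close> by (intro q_number_mono[OF q]) (auto simp: p_def)
    also have "\<dots> \<le> q_number q (real k) + max 1 (\<alpha> + 2 + real s)"
      using ab by (intro q_number_add_le[OF q]) auto
    finally show "q_number q (p + 1 + real j) \<le> v + (\<alpha> + 2 + real s)" using ab assms by simp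
  next
    show "0 < q_number q (real n)" using q_number_pos[OF q] assms by simp
  qed (use T in auto)
  then show ?thesis using T by (simp add: p_def m_def divide_le_eq del: of_nat_diff)
qed

lemma durrmeyer_summable_upper_tail:
  assumes "0 \<le> b" "b < \<beta> + 1" "0 < y"
  shows "durrmeyer_summable \<alpha> \<beta> n q (upper_tail q \<beta> b y)"
  unfolding durrmeyer_summable_def
  using assms ab by (intro allI impI summable_upper_tail[OF q]) auto

lemma durrmeyer_mean_upper_tail_le:
  fixes s B n :: nat
  assumes "0 < n" "0 < x" "x < 1" "0 \<le> b" "b < \<beta> + 1" "b \<le> real B" "0 < y" "real s < v"
  defines "\<kappa> \<equiv> min 1 (\<beta> - b + 1)"
  defines "G \<equiv> (\<lambda>s. (1 + q_number q (real n) / \<kappa>) powr b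
       * ((q_number q (real n) + (\<alpha> + \<beta> + 3 + real s + real B)) / \<kappa>) ^ B)"
  shows "durrmeyer_mean \<alpha> \<beta> n q x (upper_tail q \<beta> b y)
    \<le> G s * ((v + (\<alpha> + 2 + real s)) / (q_number q (real n) * y)) ^ s
      + G 0 * (q_number q (real n) * x / (v - real s)) ^ s"
proof -
  let ?lo = "\<Sum>k | k \<le> n \<and> q_number q (real k) \<le> v. q_bernstein_basis n k q x"
  let ?hi = "\<Sum>k | k \<le> n \<and> v \<le> q_number q (real k). q_bernstein_basis n k q x"
  let ?U = "G s * ((v + (\<alpha> + 2 + real s)) / (q_number q (real n) * y)) ^ s"
  have L: "0 < q_number q (real n)" using q_number_pos[OF q] assms(1) by simp
  have \<kappa>: "0 < \<kappa>" using assms by (simp add: \<kappa>_def)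
  have G: "0 \<le> G s" for s
    using L \<kappa> ab unfolding G_def by (intro mult_nonneg_nonneg zero_le_power divide_nonneg_nonneg) auto
  have U: "0 \<le> ?U"
    using L G assms(7,8) ab by (intro mult_nonneg_nonneg zero_le_power divide_nonneg_nonneg) auto
  have "durrmeyer_mean \<alpha> \<beta> n q x (upper_tail q \<beta> b y) \<le> ?U * ?lo + G 0 * ?hi"
  proof (rule durrmeyer_mean_split_le)
    fix k assume k: "k \<le> n"
    show "jackson_mean q (real k + \<alpha>) (real (n - k) + \<beta>) (upper_tail q \<beta> b y) \<le> G 0"
      using upper_tail_mean_le[OF k assms(4-7), of 0]
        jackson_total_pos[OF q, of "real k + \<alpha>" "real (n - k) + \<beta>"] ab
      by (simp add: G_def \<kappa>_def del: of_nat_diff)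
    assume "q_number q (real k) \<le> v"
    then have "G s / y ^ s * (jackson_total q (real k + \<alpha> + real s) (real (n - k) + \<beta>)
          / jackson_total q (real k + \<alpha>) (real (n - k) + \<beta>))
       \<le> G s / y ^ s * ((v + (\<alpha> + 2 + real s)) / q_number q (real n)) ^ s"
      using k assms(1,7) G by (intro mult_left_mono jackson_total_shift_le_below divide_nonneg_nonneg) auto
    also have "\<dots> = ?U" using assms(7) by (simp add: power_divide power_mult_distrib)
    finally show "jackson_mean q (real k + \<alpha>) (real (n - k) + \<beta>) (upper_tail q \<beta> b y) \<le> ?U"
      using upper_tail_mean_le[OF k assms(4-7), of s] unfolding G_def \<kappa>_def by linarith
  qed (rule U G assms(2) assms(3))+
  also have "?U * ?lo \<le> ?U * 1"
  proof -
    have "?lo \<le> (\<Sum>k=0..n. q_bernstein_basis n k q x)"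
      using assms(2,3) by (intro sum_mono2 q_bernstein_basis_nonneg[OF q]) auto
    then show ?thesis using U sum_q_bernstein_basis[OF q assms(2,3)] by (intro mult_left_mono) auto
  qed
  also have "G 0 * ?hi \<le> G 0 * (q_number q (real n) * x / (v - real s)) ^ s"
    using assms(2,3,8) G by (intro mult_left_mono q_bernstein_upper_tail[OF q]) auto
  finally show ?thesis by simp
qed

end


section \<open>Taylor expansion with growth bounds\<close>

text \<open>
  The exponential gain \<open>\<rho>\<^bsup>s\<^esup>\<close> with \<open>s \<approx> \<epsilon> L\<close> outweighs every power of \<open>L\<close>.
\<close>

lemma powr_times_power_floor_tendsto_0:
  fixes L :: "nat \<Rightarrow> real"
  assumes L: "filterlim L at_top sequentially" and "0 < \<epsilon>" "0 < \<rho>" "\<rho> < 1"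
  shows "(\<lambda>n. L n powr P * \<rho> ^ nat \<lfloor>\<epsilon> * L n\<rfloor>) \<longlonglongrightarrow> 0"
proof -
  define c where "c = - ln \<rho> * \<epsilon>"
  have c: "0 < c" using assms by (simp add: c_def mult_neg_pos)
  have "((\<lambda>y::real. inverse \<rho> * (y powr P * exp (- c * y))) \<longlongrightarrow> 0) at_top"
    using c by real_asymp
  then have lim: "(\<lambda>n. inverse \<rho> * (L n powr P * exp (- c * L n))) \<longlonglongrightarrow> 0"
    using L by (rule filterlim_compose)
  have "\<rho> ^ nat \<lfloor>\<epsilon> * L n\<rfloor> \<le> inverse \<rho> * exp (- c * L n)" if "0 < L n" for n
  proof -
    have "\<epsilon> * L n - 1 \<le> real (nat \<lfloor>\<epsilon> * L n\<rfloor>)" by linarith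
    then have "\<rho> powr real (nat \<lfloor>\<epsilon> * L n\<rfloor>) \<le> \<rho> powr (\<epsilon> * L n - 1)"
      using assms by (intro powr_mono') auto
    also have "\<dots> = inverse \<rho> * exp (- c * L n)"
      using assms by (simp add: powr_diff) (simp add: powr_def c_def field_simps)
    finally show ?thesis using assms by (simp add: powr_realpow)
  qed
  note bound = this
  have upper: "\<forall>\<^sub>F n in sequentially. L n powr P * \<rho> ^ nat \<lfloor>\<epsilon> * L n\<rfloor>
      \<le> inverse \<rho> * (L n powr P * exp (- c * L n))"
    using filterlim_at_top_dense[THEN iffD1, OF L, rule_format, of 0]
  proof eventually_elim
    case (elim n)
    have "L n powr P * \<rho> ^ nat \<lfloor>\<epsilon> * L n\<rfloor> \<le> L n powr P * (inverse \<rho> * exp (- c * L n))"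
      using bound[OF elim] by (intro mult_left_mono) auto
    then show ?case by (simp only: mult.left_commute)
  qed
  have lower: "\<forall>\<^sub>F n in sequentially. 0 \<le> L n powr P * \<rho> ^ nat \<lfloor>\<epsilon> * L n\<rfloor>"
    using assms by (intro always_eventually allI mult_nonneg_nonneg) auto
  show ?thesis by (rule tendsto_sandwich[OF lower upper tendsto_const lim])
qed

text \<open>
  Taylor's formula in the form of Peano, for a function whose second derivative may exist at \<open>x\<close>
  only: the derivative of the remainder is \<open>o(t - x)\<close>, and the mean value inequality on the
  interval between \<open>x\<close> and \<open>t\<close> gives \<open>o((t - x)\<^sup>2)\<close>.
\<close>

lemma taylor_second_order_at_point:
  fixes f :: "real \<Rightarrow> real"
  assumes "has_second_derivative_at f x" "0 < \<epsilon>"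
  obtains \<delta> where "0 < \<delta>"
    "\<And>t. \<bar>t - x\<bar> < \<delta> \<Longrightarrow>
       \<bar>f t - f x - deriv f x * (t - x) - deriv (deriv f) x / 2 * (t - x)\<^sup>2\<bar> \<le> \<epsilon> * (t - x)\<^sup>2"
proof -
  let ?c = "deriv (deriv f) x"
  have "(deriv f has_field_derivative ?c) (at x)"
    using assms DERIV_deriv_iff_real_differentiable by (auto simp: has_second_derivative_at_def)
  then have "(deriv f has_derivative (\<lambda>h. h * ?c)) (at x)"
    by (simp add: has_field_derivative_def mult_commute_abs)
  then obtain d where d: "0 < d"
    "\<And>t. \<bar>t - x\<bar> < d \<Longrightarrow> \<bar>deriv f t - deriv f x - (t - x) * ?c\<bar> \<le> \<epsilon> * \<bar>t - x\<bar>"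
    using assms(2) unfolding has_derivative_at_alt by auto
  have "\<forall>\<^sub>F t in nhds x. f differentiable at t"
    using assms by (simp add: has_second_derivative_at_def)
  then obtain e where e: "0 < e" "\<And>t. \<bar>t - x\<bar> < e \<Longrightarrow> f differentiable at t"
    unfolding eventually_nhds_metric dist_real_def by blast
  show ?thesis
  proof (rule that)
    show "0 < min d e" using d e by simp
    fix t assume t: "\<bar>t - x\<bar> < min d e"
    define r where "r = (\<lambda>t. f t - f x - deriv f x * (t - x) - ?c / 2 * (t - x)\<^sup>2)"
    have "norm (r t - r x) \<le> (\<epsilon> * \<bar>t - x\<bar>) * norm (t - x)"
    proof (rule field_differentiable_bound)
      show "convex (cball x \<bar>t - x\<bar>)" by simp
      fix z assume "z \<in> cball x \<bar>t - x\<bar>"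
      then have z: "\<bar>z - x\<bar> \<le> \<bar>t - x\<bar>" by (simp add: dist_real_def abs_minus_commute)
      then have "(f has_field_derivative deriv f z) (at z)"
        using e(2)[of z] t DERIV_deriv_iff_real_differentiable by auto
      moreover have "((\<lambda>t. f x + deriv f x * (t - x) + ?c / 2 * (t - x)\<^sup>2) has_field_derivative
          deriv f x + (z - x) * ?c) (at z)"
        by (auto intro!: derivative_eq_intros)
      ultimately have "((\<lambda>t. f t - (f x + deriv f x * (t - x) + ?c / 2 * (t - x)\<^sup>2)) has_field_derivative
          deriv f z - (deriv f x + (z - x) * ?c)) (at z)"
        by (rule DERIV_diff)
      then show "(r has_field_derivative (deriv f z - deriv f x - (z - x) * ?c)) (at z within cball x \<bar>t - x\<bar>)"
        unfolding r_def diff_diff_eq by (rule has_field_derivative_at_within)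
      have "\<bar>deriv f z - deriv f x - (z - x) * ?c\<bar> \<le> \<epsilon> * \<bar>z - x\<bar>"
        using d(2)[of z] t z by linarith
      also have "\<dots> \<le> \<epsilon> * \<bar>t - x\<bar>" using z assms by (intro mult_left_mono) auto
      finally show "norm (deriv f z - deriv f x - (z - x) * ?c) \<le> \<epsilon> * \<bar>t - x\<bar>" by simp
    qed (auto simp: dist_real_def abs_minus_commute)
    then have "\<bar>r t\<bar> \<le> \<epsilon> * (\<bar>t - x\<bar> * \<bar>t - x\<bar>)" by (simp add: r_def mult.assoc)
    then show "\<bar>f t - f x - deriv f x * (t - x) - ?c / 2 * (t - x)\<^sup>2\<bar> \<le> \<epsilon> * (t - x)\<^sup>2"
      by (simp add: r_def power2_eq_square abs_mult[symmetric])
  qed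
qed

text \<open>
  Left of \<open>x\<close> the factor \<open>(1-t)\<^bsup>-b\<^esup>\<close> and the Taylor polynomial are bounded, and so are at most a
  multiple of \<open>t\<^bsup>-a\<^esup> \<ge> 1\<close>; symmetrically on the right.
\<close>

lemma taylor_remainder_growth_bound:
  fixes f :: "real \<Rightarrow> real"
  assumes x: "0 < x" "x < 1" and f: "has_second_derivative_at f x" and "0 < \<eta>"
    and "0 \<le> a" "0 \<le> b" "0 \<le> \<kappa>"
    and growth: "\<And>t. 0 < t \<Longrightarrow> t < 1 \<Longrightarrow> \<bar>f t\<bar> \<le> \<kappa> * (t powr - a * (1 - t) powr - b)"
  defines "g \<equiv> \<lambda>t. f t - f x - deriv f x * (t - x) - deriv (deriv f) x / 2 * (t - x)\<^sup>2"
  obtains y z K where "0 < y" "y < x" "x < z" "z < 1" "0 \<le> K"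
    "\<And>t. 0 < t \<Longrightarrow> t < 1 \<Longrightarrow> \<bar>g t\<bar> \<le> \<eta> * (t - x)\<^sup>2
        + K * (if t \<le> y then t powr - a else 0) + K * (if z \<le> t then (1 - t) powr - b else 0)"
proof -
  obtain d where d: "0 < d" "\<And>t. \<bar>t - x\<bar> < d \<Longrightarrow> \<bar>g t\<bar> \<le> \<eta> * (t - x)\<^sup>2"
    using taylor_second_order_at_point[OF f \<open>0 < \<eta>\<close>] unfolding g_def by blast
  define \<delta> where "\<delta> = min d (min (x / 2) ((1 - x) / 2))"
  have \<delta>: "0 < \<delta>" "\<delta> \<le> d" "\<delta> < x" "\<delta> < 1 - x" using d x by (auto simp: \<delta>_def min_def)
  define K0 where "K0 = \<bar>f x\<bar> + \<bar>deriv f x\<bar> + \<bar>deriv (deriv f) x\<bar>"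
  define K where "K = K0 + \<kappa> * ((1 - x) powr - b + x powr - a)"
  have K0: "0 \<le> K0" by (simp add: K0_def)
  have K: "0 \<le> K" using K0 assms by (simp add: K_def)
  have far: "\<bar>g t\<bar> \<le> \<bar>f t\<bar> + K0" if "0 < t" "t < 1" for t
  proof -
    have "\<bar>t - x\<bar> \<le> 1" using that x by linarith
    then have sq: "(t - x)\<^sup>2 \<le> 1" by (simp add: abs_square_le_1)
    have "\<bar>deriv f x * (t - x)\<bar> \<le> \<bar>deriv f x\<bar>"
      using \<open>\<bar>t - x\<bar> \<le> 1\<close> by (simp add: abs_mult mult_left_le)
    moreover have "\<bar>deriv (deriv f) x / 2 * (t - x)\<^sup>2\<bar> \<le> \<bar>deriv (deriv f) x\<bar>"
      using mult_mono[of "\<bar>deriv (deriv f) x\<bar> / 2" "\<bar>deriv (deriv f) x\<bar>" "(t - x)\<^sup>2" 1] sq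
      by (simp add: abs_mult)
    ultimately show ?thesis unfolding g_def K0_def by linarith
  qed
  show ?thesis
  proof (rule that[of "x - \<delta>" "x + \<delta>" K])
    fix t :: real assume t: "0 < t" "t < 1"
    have nonneg: "0 \<le> \<eta> * (t - x)\<^sup>2" using \<open>0 < \<eta>\<close> by simp
    consider "t \<le> x - \<delta>" | "x + \<delta> \<le> t" | "\<bar>t - x\<bar> < d" using \<delta> by linarith
    then show "\<bar>g t\<bar> \<le> \<eta> * (t - x)\<^sup>2
        + K * (if t \<le> x - \<delta> then t powr - a else 0) + K * (if x + \<delta> \<le> t then (1 - t) powr - b else 0)"
    proof cases
      case 1
      have one: "1 \<le> t powr - a" using powr_mono2'[of "- a" t 1] t assms by simp
      have "(1 - t) powr - b \<le> (1 - x) powr - b" using powr_mono2'[of "- b" "1 - x" "1 - t"] 1 \<delta> x assms by simp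
      then have "\<kappa> * (t powr - a * (1 - t) powr - b) \<le> \<kappa> * (t powr - a * (1 - x) powr - b)"
        using assms by (intro mult_left_mono) auto
      moreover have "K0 * 1 \<le> K0 * t powr - a" using K0 one by (intro mult_left_mono) auto
      moreover have "0 \<le> \<kappa> * x powr - a * t powr - a" using assms by simp
      ultimately have "\<bar>f t\<bar> + K0 \<le> K * t powr - a"
        using growth[OF t] by (simp add: K_def algebra_simps)
      then show ?thesis using far[OF t] 1 \<delta> nonneg by simp
    next
      case 2
      have one: "1 \<le> (1 - t) powr - b" using powr_mono2'[of "- b" "1 - t" 1] t assms by simp
      have "t powr - a \<le> x powr - a" using powr_mono2'[of "- a" x t] 2 \<delta> x assms by simp
      then have "\<kappa> * (t powr - a * (1 - t) powr - b) \<le> \<kappa> * (x powr - a * (1 - t) powr - b)"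
        using assms by (intro mult_left_mono mult_right_mono) auto
      moreover have "K0 * 1 \<le> K0 * (1 - t) powr - b" using K0 one by (intro mult_left_mono) auto
      moreover have "0 \<le> \<kappa> * (1 - x) powr - b * (1 - t) powr - b" using assms by simp
      ultimately have "\<bar>f t\<bar> + K0 \<le> K * (1 - t) powr - b"
        using growth[OF t] by (simp add: K_def algebra_simps)
      then show ?thesis using far[OF t] 2 \<delta> nonneg by simp
    next
      case 3
      have "0 \<le> K * (if t \<le> x - \<delta> then t powr - a else 0)" "0 \<le> K * (if x + \<delta> \<le> t then (1 - t) powr - b else 0)"
        using K by simp_all
      then show ?thesis using d(2)[OF 3] by linarith
    qed
  qed (use \<delta> K x in auto)
qed

section \<open>Limits of the moments\<close>

context
  fixes q :: "nat \<Rightarrow> real" and \<alpha> \<beta> :: real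
  assumes q: "\<And>n. 0 < q n" "\<And>n. q n < 1" and q_lim: "q \<longlonglongrightarrow> 1"
    and ab: "-1 < \<alpha>" "-1 < \<beta>"
begin

lemma q_number_tendsto: "(\<lambda>n. q_number (q n) c) \<longlonglongrightarrow> c"
proof -
  have "((\<lambda>y::real. y powr c) has_field_derivative c) (at 1)"
    by (auto intro!: derivative_eq_intros)
  then have "((\<lambda>y::real. (y powr c - 1 powr c) / (y - 1)) \<longlongrightarrow> c) (at 1)"
    by (simp add: has_field_derivative_iff)
  moreover have "filterlim q (at 1) sequentially"
    using q_lim q(2) by (simp add: filterlim_at less_imp_neq)
  ultimately have "(\<lambda>n. (q n powr c - 1 powr c) / (q n - 1)) \<longlonglongrightarrow> c"
    by (rule filterlim_compose)
  moreover have "(q n powr c - 1 powr c) / (q n - 1) = q_number (q n) c" for n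
    using q(2)[of n] by (simp add: q_number_def field_simps)
  ultimately show ?thesis by simp
qed

lemma q_powr_tendsto: "(\<lambda>n. q n powr c) \<longlonglongrightarrow> 1"
  using tendsto_powr[OF q_lim tendsto_const, of c] by simp

abbreviation (input) L :: "nat \<Rightarrow> real" where
  "L n \<equiv> q_number (q n) (real n)"

text \<open>
  For fixed \<open>K\<close> and \<open>n \<ge> K\<close> one has \<open>[n] \<ge> [K]\<close>, and \<open>[K]\<close> tends to \<open>K\<close>.
\<close>

lemma q_number_index_at_top: "filterlim L at_top sequentially"
proof (rule filterlim_at_top_dense[THEN iffD2], rule allI)
  fix Z :: real
  obtain K :: nat where K: "Z < real K" using reals_Archimedean2 by blast
  have "\<forall>\<^sub>F n in sequentially. Z < q_number (q n) (real K)"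
    using q_number_tendsto[of "real K"] K by (rule order_tendstoD)
  then show "\<forall>\<^sub>F n in sequentially. Z < L n"
    using eventually_ge_at_top[of K]
  proof eventually_elim
    case (elim n)
    then show ?case using q_number_mono[OF q[of n], of "real K" "real n"] by simp
  qed
qed

lemma q_number_quotient_tendsto_1: "(\<lambda>n. L n / q_number (q n) (real n + c)) \<longlonglongrightarrow> 1"
proof -
  have "(\<lambda>n. 1 / (q_number (q n) c / L n + q n powr c)) \<longlonglongrightarrow> 1 / (0 + 1)"
    using q_number_index_at_top
    by (intro tendsto_intros q_powr_tendsto tendsto_divide_0[OF q_number_tendsto]
        filterlim_at_top_imp_at_infinity) auto
  moreover have "\<forall>\<^sub>F n in sequentially. 1 / (q_number (q n) c / L n + q n powr c) = L n / q_number (q n) (real n + c)"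
    using filterlim_at_top_dense[THEN iffD1, OF q_number_index_at_top, rule_format, of 0]
  proof eventually_elim
    case (elim n)
    have "q_number (q n) (real n + c) = q_number (q n) c + q n powr c * L n"
      using q_number_add[OF q[of n], of c "real n"] by (simp add: add.commute)
    moreover have "q_number (q n) c / L n + q n powr c = (q_number (q n) c + q n powr c * L n) / L n"
      using elim by (simp add: field_simps)
    ultimately show ?case by simp
  qed
  ultimately show ?thesis by (auto dest: Lim_transform_eventually)
qed

text \<open>
  In \<open>M(t) - x\<close>, written over the common denominator \<open>[n+\<alpha>+\<beta>+2]\<close>, the terms that grow with \<open>[n]\<close>
  cancel exactly.
\<close>

lemma first_moment_tendsto:
  assumes x: "0 < x" "x < 1"
  shows "(\<lambda>n. L n * (durrmeyer_mean \<alpha> \<beta> n (q n) x (node (q n) \<beta>) - x))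
    \<longlonglongrightarrow> (\<alpha> + 1) - (\<alpha> + \<beta> + 2) * x"
proof -
  define a where "a = \<alpha> + \<beta> + 2"
  have "L n * (durrmeyer_mean \<alpha> \<beta> n (q n) x (node (q n) \<beta>) - x)
      = L n / q_number (q n) (real n + a)
        * (q n powr (\<beta> + 1) * q_number (q n) (\<alpha> + 1) - q_number (q n) a * x)" for n
  proof -
    define N where "N = q_number (q n) (real n + a)"
    have Npos: "0 < N" unfolding N_def using ab by (intro q_number_pos[OF q]) (auto simp: a_def)
    have N: "N = q_number (q n) a + q n powr a * L n"
      using q_number_add[OF q[of n], of a "real n"] by (simp add: N_def add.commute)
    have r: "q n powr (\<beta> + 1) * q n powr (\<alpha> + 1) = q n powr a"
      by (simp add: powr_add[symmetric] a_def add_ac)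
    have M: "durrmeyer_mean \<alpha> \<beta> n (q n) x (node (q n) \<beta>)
        = q n powr (\<beta> + 1) * (q_number (q n) (\<alpha> + 1) + q n powr (\<alpha> + 1) * L n * x) / N"
      using durrmeyer_mean_node[OF q[of n] ab x, of n] by (simp add: N_def a_def add.assoc)
    have "durrmeyer_mean \<alpha> \<beta> n (q n) x (node (q n) \<beta>) - x
        = (q n powr (\<beta> + 1) * (q_number (q n) (\<alpha> + 1) + q n powr (\<alpha> + 1) * L n * x) - x * N) / N"
      using Npos unfolding M by (simp add: diff_divide_distrib)
    also have "q n powr (\<beta> + 1) * (q_number (q n) (\<alpha> + 1) + q n powr (\<alpha> + 1) * L n * x) - x * N
        = q n powr (\<beta> + 1) * q_number (q n) (\<alpha> + 1) - q_number (q n) a * x"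
      unfolding N r[symmetric] by (simp add: algebra_simps)
    finally show ?thesis unfolding N_def by simp
  qed
  moreover have "(\<lambda>n. L n / q_number (q n) (real n + a)
        * (q n powr (\<beta> + 1) * q_number (q n) (\<alpha> + 1) - q_number (q n) a * x))
      \<longlonglongrightarrow> 1 * (1 * (\<alpha> + 1) - a * x)"
    by (intro tendsto_intros q_number_quotient_tendsto_1 q_powr_tendsto q_number_tendsto)
  ultimately show ?thesis by (simp add: a_def)
qed

text \<open>
  As for the first moment: over the common denominator \<open>[n+\<alpha>+\<beta>+2] [n+\<alpha>+\<beta>+3]\<close> the terms quadratic
  in \<open>[n]\<close> cancel, and \<open>R\<close> is what is left of the numerator, divided by \<open>[n]\<close>.
\<close>

lemma second_moment_tendsto:
  assumes x: "0 < x" "x < 1"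
  shows "(\<lambda>n. L n * (durrmeyer_mean \<alpha> \<beta> n (q n) x (\<lambda>i. node (q n) \<beta> i ^ 2) - x\<^sup>2))
    \<longlonglongrightarrow> (2 * \<alpha> + 3) * x + x * (1 - x) - x\<^sup>2 * (2 * (\<alpha> + \<beta> + 2) + 1)"
proof -
  define a where "a = \<alpha> + \<beta> + 2"
  define R where "R n = (q n powr (\<beta> + 1))\<^sup>2 * (q_number (q n) (\<alpha> + 1) * q_number (q n) (\<alpha> + 2) / L n
      + (q_number (q n) (\<alpha> + 1) * q n powr (\<alpha> + 2) + q_number (q n) (\<alpha> + 2) * q n powr (\<alpha> + 1)) * x)
      + q n powr a * q n powr (a + 1) * (x * (1 - x))
      - x\<^sup>2 * (q_number (q n) a * q_number (q n) (a + 1) / L n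
      + (q_number (q n) a * q n powr (a + 1) + q_number (q n) (a + 1) * q n powr a))" for n
  have eq: "L n * (durrmeyer_mean \<alpha> \<beta> n (q n) x (\<lambda>i. node (q n) \<beta> i ^ 2) - x\<^sup>2)
      = L n / q_number (q n) (real n + a) * (L n / q_number (q n) (real n + (a + 1))) * R n"
    if "0 < L n" for n
  proof -
    define N N' where "N = q_number (q n) (real n + a)" and "N' = q_number (q n) (real n + (a + 1))"
    have Npos: "0 < N" "0 < N'"
      unfolding N_def N'_def using ab by (auto intro!: q_number_pos[OF q] simp: a_def)
    define l A A' Q Q' where "l = L n" and "A = q_number (q n) a" and "A' = q_number (q n) (a + 1)"
      and "Q = q n powr a" and "Q' = q n powr (a + 1)"
    define B r r' c c' where "B = q n powr (\<beta> + 1)" and "r = q n powr (\<alpha> + 1)" and "r' = q n powr (\<alpha> + 2)"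
      and "c = q_number (q n) (\<alpha> + 1)" and "c' = q_number (q n) (\<alpha> + 2)"
    have l: "0 < l" using that by (simp add: l_def)
    have N: "N = A + Q * l" "N' = A' + Q' * l"
      using q_number_add[OF q[of n], of a "real n"] q_number_add[OF q[of n], of "a + 1" "real n"]
      by (simp_all add: N_def N'_def A_def A'_def Q_def Q'_def l_def add_ac)
    have QQ: "B\<^sup>2 * (r * r') = Q * Q'"
      by (simp add: B_def r_def r'_def Q_def Q'_def a_def power2_eq_square powr_add[symmetric] algebra_simps)
    have M: "durrmeyer_mean \<alpha> \<beta> n (q n) x (\<lambda>i. node (q n) \<beta> i ^ 2)
        = B\<^sup>2 * (c * c' + (c * r' + c' * r) * (l * x) + r * r' * (l * x * (1 + (l - 1) * x))) / (N * N')"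
      using durrmeyer_mean_node_square[OF q[of n] ab x, of n]
      by (simp add: N_def N'_def a_def add.assoc B_def r_def r'_def c_def c'_def l_def)
    have "durrmeyer_mean \<alpha> \<beta> n (q n) x (\<lambda>i. node (q n) \<beta> i ^ 2) - x\<^sup>2
        = (B\<^sup>2 * (c * c' + (c * r' + c' * r) * (l * x) + r * r' * (l * x * (1 + (l - 1) * x))) - x\<^sup>2 * (N * N')) / (N * N')"
      using Npos unfolding M by (simp add: diff_divide_distrib)
    also have "B\<^sup>2 * (c * c' + (c * r' + c' * r) * (l * x) + r * r' * (l * x * (1 + (l - 1) * x))) - x\<^sup>2 * (N * N')
        = B\<^sup>2 * (c * c' + (c * r' + c' * r) * (l * x)) + (B\<^sup>2 * (r * r')) * (l * x * (1 + (l - 1) * x)) - x\<^sup>2 * (N * N')"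
      by (simp add: algebra_simps)
    also have "\<dots> = B\<^sup>2 * (c * c' + (c * r' + c' * r) * (l * x)) + (Q * Q') * (l * (x * (1 - x)))
        - x\<^sup>2 * (A * A' + (A * Q' + A' * Q) * l)"
      unfolding QQ N by (simp add: algebra_simps power2_eq_square)
    also have "\<dots> = l * (B\<^sup>2 * (c * c' / l + (c * r' + c' * r) * x) + Q * Q' * (x * (1 - x))
        - x\<^sup>2 * (A * A' / l + (A * Q' + A' * Q)))"
      using l by (simp add: field_simps)
    also have "\<dots> = l * R n"
      by (simp add: R_def B_def c_def c'_def r_def r'_def A_def A'_def Q_def Q'_def l_def)
    finally show ?thesis by (simp add: N_def N'_def l_def)
  qed
  have inv: "(\<lambda>n. q_number (q n) c * q_number (q n) d / L n) \<longlonglongrightarrow> 0" for c d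
    using q_number_index_at_top
    by (intro tendsto_divide_0[OF tendsto_mult[OF q_number_tendsto q_number_tendsto]]
        filterlim_at_top_imp_at_infinity)
  have "(\<lambda>n. L n / q_number (q n) (real n + a) * (L n / q_number (q n) (real n + (a + 1))) * R n)
      \<longlonglongrightarrow> 1 * 1 * (1\<^sup>2 * (0 + ((\<alpha> + 1) * 1 + (\<alpha> + 2) * 1) * x) + 1 * 1 * (x * (1 - x))
      - x\<^sup>2 * (0 + (a * 1 + (a + 1) * 1)))"
    unfolding R_def by (intro tendsto_intros q_number_quotient_tendsto_1 q_powr_tendsto q_number_tendsto inv)
  moreover have "\<forall>\<^sub>F n in sequentially.
      L n / q_number (q n) (real n + a) * (L n / q_number (q n) (real n + (a + 1))) * R n
      = L n * (durrmeyer_mean \<alpha> \<beta> n (q n) x (\<lambda>i. node (q n) \<beta> i ^ 2) - x\<^sup>2)"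
    using filterlim_at_top_dense[THEN iffD1, OF q_number_index_at_top, rule_format, of 0]
    by eventually_elim (simp add: eq)
  ultimately have "(\<lambda>n. L n * (durrmeyer_mean \<alpha> \<beta> n (q n) x (\<lambda>i. node (q n) \<beta> i ^ 2) - x\<^sup>2))
      \<longlonglongrightarrow> 1 * 1 * (1\<^sup>2 * (0 + ((\<alpha> + 1) * 1 + (\<alpha> + 2) * 1) * x) + 1 * 1 * (x * (1 - x))
      - x\<^sup>2 * (0 + (a * 1 + (a + 1) * 1)))"
    by (rule Lim_transform_eventually)
  moreover have "1 * 1 * (1\<^sup>2 * (0 + ((\<alpha> + 1) * 1 + (\<alpha> + 2) * 1) * x) + 1 * 1 * (x * (1 - x))
      - x\<^sup>2 * (0 + (a * 1 + (a + 1) * 1)))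
     = (2 * \<alpha> + 3) * x + x * (1 - x) - x\<^sup>2 * (2 * (\<alpha> + \<beta> + 2) + 1)"
    by (simp add: a_def algebra_simps)
  ultimately show ?thesis by (simp only:)
qed

lemma node_bounded: "\<bar>node (q n) \<beta> i\<bar> \<le> 1"
  using node_bounds[OF q[of n] ab(2), of i] by simp

lemma linear_moment:
  assumes x: "0 < x" "x < 1"
  shows "durrmeyer_mean \<alpha> \<beta> n (q n) x (\<lambda>i. node (q n) \<beta> i - x)
    = durrmeyer_mean \<alpha> \<beta> n (q n) x (node (q n) \<beta>) - x"
  using durrmeyer_mean_add[OF q[of n] ab durrmeyer_summable_bounded[OF q[of n] ab node_bounded]
      durrmeyer_summable_bounded[OF q[of n] ab, of "\<lambda>i. - x" "\<bar>x\<bar>"], of n x]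
    durrmeyer_mean_const[OF q[of n] ab x, of n "- x"] by simp

lemma quadratic_moment:
  assumes x: "0 < x" "x < 1"
  shows "durrmeyer_mean \<alpha> \<beta> n (q n) x (\<lambda>i. (node (q n) \<beta> i - x)\<^sup>2)
    = (durrmeyer_mean \<alpha> \<beta> n (q n) x (\<lambda>i. node (q n) \<beta> i ^ 2) - x\<^sup>2)
      - 2 * x * (durrmeyer_mean \<alpha> \<beta> n (q n) x (node (q n) \<beta>) - x)"
proof -
  let ?M = "durrmeyer_mean \<alpha> \<beta> n (q n) x" and ?t = "node (q n) \<beta>"
  have S: "durrmeyer_summable \<alpha> \<beta> n (q n) (\<lambda>i. ?t i ^ 2)"
    by (rule durrmeyer_summable_bounded[OF q[of n] ab, of _ 1])
      (simp add: power_le_one less_imp_le node_bounds[OF q[of n] ab(2)])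
  have S': "durrmeyer_summable \<alpha> \<beta> n (q n) (\<lambda>i. - 2 * x * ?t i)"
    by (rule durrmeyer_summable_cmult[OF q[of n] ab durrmeyer_summable_bounded[OF q[of n] ab node_bounded]])
  have S'': "durrmeyer_summable \<alpha> \<beta> n (q n) (\<lambda>i. x\<^sup>2)"
    by (rule durrmeyer_summable_bounded[OF q[of n] ab, of _ "\<bar>x\<^sup>2\<bar>"]) simp
  have "(\<lambda>i. (?t i - x)\<^sup>2) = (\<lambda>i. ?t i ^ 2 + (- 2 * x * ?t i + x\<^sup>2))"
    by (simp add: fun_eq_iff power2_diff)
  then have "?M (\<lambda>i. (?t i - x)\<^sup>2) = ?M (\<lambda>i. ?t i ^ 2) + (?M (\<lambda>i. - 2 * x * ?t i) + ?M (\<lambda>i. x\<^sup>2))"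
    using durrmeyer_mean_add[OF q[of n] ab S durrmeyer_summable_add[OF q[of n] ab S' S''], of x]
      durrmeyer_mean_add[OF q[of n] ab S' S'', of x] by simp
  also have "?M (\<lambda>i. - 2 * x * ?t i) = - 2 * x * ?M ?t"
    by (rule durrmeyer_mean_cmult[OF q[of n] ab durrmeyer_summable_bounded[OF q[of n] ab node_bounded]])
  also have "?M (\<lambda>i. x\<^sup>2) = x\<^sup>2" by (rule durrmeyer_mean_const[OF q[of n] ab x])
  finally show ?thesis by (simp add: power2_eq_square algebra_simps)
qed

lemma central_second_moment_tendsto:
  assumes x: "0 < x" "x < 1"
  shows "(\<lambda>n. L n * durrmeyer_mean \<alpha> \<beta> n (q n) x (\<lambda>i. (node (q n) \<beta> i - x)\<^sup>2)) \<longlonglongrightarrow> 2 * x * (1 - x)"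
proof -
  have "(\<lambda>n. L n * (durrmeyer_mean \<alpha> \<beta> n (q n) x (\<lambda>i. node (q n) \<beta> i ^ 2) - x\<^sup>2)
      - 2 * x * (L n * (durrmeyer_mean \<alpha> \<beta> n (q n) x (node (q n) \<beta>) - x)))
     \<longlonglongrightarrow> ((2 * \<alpha> + 3) * x + x * (1 - x) - x\<^sup>2 * (2 * (\<alpha> + \<beta> + 2) + 1))
      - 2 * x * ((\<alpha> + 1) - (\<alpha> + \<beta> + 2) * x)"
    using x by (intro tendsto_intros first_moment_tendsto second_moment_tendsto)
  moreover have "((2 * \<alpha> + 3) * x + x * (1 - x) - x\<^sup>2 * (2 * (\<alpha> + \<beta> + 2) + 1))
      - 2 * x * ((\<alpha> + 1) - (\<alpha> + \<beta> + 2) * x) = 2 * x * (1 - x)"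
    by (simp add: algebra_simps power2_eq_square)
  moreover have "l * (X - 2 * x * Y) = l * X - 2 * x * (l * Y)" for l X Y :: real
    by (simp add: algebra_simps)
  ultimately show ?thesis unfolding quadratic_moment[OF x] by (simp only:)
qed

section \<open>The tails in the limit\<close>

lemma eventually_q_number_index_gt: "\<forall>\<^sub>F n in sequentially. Z < L n"
  using q_number_index_at_top by (simp add: filterlim_at_top_dense)

text \<open>
  The bound \<open>durrmeyer_mean_lower_tail_le\<close> with threshold \<open>z [n]\<close>, where \<open>y < z < x\<close>, and with the moment
  order \<open>s = \<lfloor>\<epsilon> [n]\<rfloor>\<close>. The bases of the two powers of order \<open>s\<close> are then close to \<open>z / x\<close> and \<open>y / z\<close>.
\<close>

lemma lower_tail_tendsto_0:
  assumes x: "0 < x" "x < 1" and y: "0 < y" "y < x" and a: "0 \<le> a" "a < \<alpha> + 1"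
  shows "(\<lambda>n. L n * durrmeyer_mean \<alpha> \<beta> n (q n) x (lower_tail (q n) a y)) \<longlonglongrightarrow> 0"
proof -
  (* z is the midpoint of y and x, and \<epsilon> is so small against its distances to them that the
     perturbations of size \<epsilon> below leave both bases smaller than 1. *)
  define \<epsilon> where "\<epsilon> = (x - y) / 16"
  define z where "z = y + 8 * \<epsilon>"
  define A where "A = nat \<lceil>a\<rceil>"
  define \<kappa> where "\<kappa> = min 1 (\<alpha> - a + 1)"
  define R where "R = (1 + \<epsilon>) / (z - 2 * \<epsilon>)"
  define \<rho>1 where "\<rho>1 = (z + \<epsilon>) / x"
  define \<rho>2 where "\<rho>2 = y * R"
  define s where "s n = nat \<lfloor>\<epsilon> * L n\<rfloor>" for n
  have \<epsilon>: "0 < \<epsilon>" "x = y + 16 * \<epsilon>" using y by (simp_all add: \<epsilon>_def field_simps)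
  have A: "a \<le> real A" using real_nat_ceiling_ge by (simp add: A_def)
  have \<kappa>: "0 < \<kappa>" using a by (simp add: \<kappa>_def)
  have z: "0 < z - 2 * \<epsilon>" using y \<epsilon> by (simp add: z_def)
  have "y * \<epsilon> \<le> 1 * \<epsilon>" using x y \<epsilon> by (intro mult_right_mono) auto
  then have "y * (1 + \<epsilon>) < z - 2 * \<epsilon>" using \<epsilon> by (simp add: z_def algebra_simps)
  then have \<rho>2: "0 < \<rho>2" "\<rho>2 < 1" using z y \<epsilon> by (simp_all add: \<rho>2_def R_def)
  have \<rho>1: "0 < \<rho>1" "\<rho>1 < 1" using y \<epsilon> x by (simp_all add: \<rho>1_def z_def)
  have R: "0 < R" using z \<epsilon> by (simp add: R_def)
  let ?bound = "\<lambda>n. (2 / \<kappa>) ^ A * (L n powr (real A + 1) * \<rho>1 ^ s n) + R ^ A * (L n powr 1 * \<rho>2 ^ s n)"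
  have "?bound \<longlonglongrightarrow> (2 / \<kappa>) ^ A * 0 + R ^ A * 0"
    unfolding s_def using \<epsilon>(1) \<rho>1 \<rho>2
    by (intro tendsto_intros powr_times_power_floor_tendsto_0 q_number_index_at_top)
  then have lim: "?bound \<longlonglongrightarrow> 0" by simp
  have upper: "\<forall>\<^sub>F n in sequentially. L n * durrmeyer_mean \<alpha> \<beta> n (q n) x (lower_tail (q n) a y) \<le> ?bound n"
    using eventually_q_number_index_gt[of 1] eventually_q_number_index_gt[of "\<alpha> + \<beta> + 3 + real A"]
      eventually_q_number_index_gt[of "(\<alpha> + \<beta> + 3) / \<epsilon>"] eventually_q_number_index_gt[of "real A / \<epsilon>"]
      eventually_gt_at_top[of 0]
  proof eventually_elim
    case (elim n)
    define l where "l = L n"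
    have l: "1 < l" "\<alpha> + \<beta> + 3 + real A < l" "\<alpha> + \<beta> + 3 \<le> \<epsilon> * l" "real A \<le> \<epsilon> * l"
      using elim \<epsilon> by (simp_all add: l_def field_simps)
    have s: "real (s n) \<le> \<epsilon> * l" using l \<epsilon> by (simp add: s_def l_def)
    have As: "z * l - 2 * \<epsilon> * l \<le> z * l - real (A + s n)" using l s by simp
    have pos: "0 < z * l - 2 * \<epsilon> * l" using z l by (simp add: left_diff_distrib[symmetric])
    have "durrmeyer_mean \<alpha> \<beta> n (q n) x (lower_tail (q n) a y)
      \<le> ((l + (\<alpha> + \<beta> + 3 + real A)) / \<kappa>) ^ A * ((z * l + real (s n)) / (l * x)) ^ s n
        + y ^ s n * ((l + (\<alpha> + \<beta> + 3)) / (z * l - real (A + s n))) ^ (A + s n)"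
      unfolding l_def \<kappa>_def using elim(5) x y a A As pos
      by (intro durrmeyer_mean_lower_tail_le[OF q[of n] ab]) (auto simp: l_def)
    also have "\<dots> \<le> (2 * l / \<kappa>) ^ A * \<rho>1 ^ s n + y ^ s n * R ^ (A + s n)"
    proof (intro add_mono mult_mono power_mono)
      show "(l + (\<alpha> + \<beta> + 3 + real A)) / \<kappa> \<le> 2 * l / \<kappa>"
        using l \<kappa> by (intro divide_right_mono) auto
      have le: "(z * l + real (s n)) / (l * x) \<le> (z * l + \<epsilon> * l) / (l * x)"
        using s l x by (intro divide_right_mono) auto
      have eq: "(z * l + \<epsilon> * l) / (l * x) = \<rho>1"
        using l by (simp add: \<rho>1_def distrib_right[symmetric])
      show "(z * l + real (s n)) / (l * x) \<le> \<rho>1" by (rule le[unfolded eq])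
      have le: "(l + (\<alpha> + \<beta> + 3)) / (z * l - real (A + s n)) \<le> (l + \<epsilon> * l) / (z * l - 2 * \<epsilon> * l)"
      proof (rule frac_le[OF _ _ pos As])
        show "0 \<le> l + \<epsilon> * l" using l \<epsilon> by simp
        show "l + (\<alpha> + \<beta> + 3) \<le> l + \<epsilon> * l" using l by linarith
      qed
      have "(l + \<epsilon> * l) / (z * l - 2 * \<epsilon> * l) = ((1 + \<epsilon>) * l) / ((z - 2 * \<epsilon>) * l)"
        by (simp only: distrib_right left_diff_distrib mult_1_left)
      then have eq: "(l + \<epsilon> * l) / (z * l - 2 * \<epsilon> * l) = R" using l by (simp add: R_def)
      show "(l + (\<alpha> + \<beta> + 3)) / (z * l - real (A + s n)) \<le> R" by (rule le[unfolded eq])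
      show "0 \<le> (l + (\<alpha> + \<beta> + 3 + real A)) / \<kappa>"
        using l ab \<kappa> by (intro divide_nonneg_nonneg) auto
      have "0 \<le> z * l" using z \<epsilon> l by (intro mult_nonneg_nonneg) auto
      then show "0 \<le> (z * l + real (s n)) / (l * x)"
        using l x by (intro divide_nonneg_nonneg mult_nonneg_nonneg) auto
      then show "0 \<le> ((z * l + real (s n)) / (l * x)) ^ s n" by (rule zero_le_power)
      show "0 \<le> (l + (\<alpha> + \<beta> + 3)) / (z * l - real (A + s n))"
        using l ab As pos by (intro divide_nonneg_nonneg) linarith+
      then show "0 \<le> ((l + (\<alpha> + \<beta> + 3)) / (z * l - real (A + s n))) ^ (A + s n)" by (rule zero_le_power)
      show "0 \<le> (2 * l / \<kappa>) ^ A" using l \<kappa> by (intro zero_le_power divide_nonneg_nonneg) auto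
      show "0 \<le> y ^ s n" using y by simp
    qed (use y in auto)
    finally have "l * durrmeyer_mean \<alpha> \<beta> n (q n) x (lower_tail (q n) a y)
      \<le> l * ((2 * l / \<kappa>) ^ A * \<rho>1 ^ s n + y ^ s n * R ^ (A + s n))"
      using l by (intro mult_left_mono) auto
    also have "\<dots> = (2 / \<kappa>) ^ A * (l powr (real A + 1) * \<rho>1 ^ s n) + R ^ A * (l powr 1 * \<rho>2 ^ s n)"
    proof -
      have "l powr (real A + 1) = l * l ^ A" "l powr 1 = l"
        using l by (simp_all add: powr_add powr_realpow)
      moreover have "(2 * l / \<kappa>) ^ A = (2 / \<kappa>) ^ A * l ^ A"
        by (simp add: power_mult_distrib power_divide)
      moreover have "\<rho>2 ^ s n = y ^ s n * R ^ s n" by (simp add: \<rho>2_def power_mult_distrib)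
      ultimately show ?thesis by (simp only: distrib_left power_add mult_ac)
    qed
    finally show ?case unfolding l_def .
  qed
  have lower: "\<forall>\<^sub>F n in sequentially. 0 \<le> L n * durrmeyer_mean \<alpha> \<beta> n (q n) x (lower_tail (q n) a y)"
  proof (intro always_eventually allI mult_nonneg_nonneg)
    fix n
    show "0 \<le> L n" using q_number_nonneg[OF q[of n]] by simp
    have "\<bar>durrmeyer_mean \<alpha> \<beta> n (q n) x (\<lambda>i. 0)\<bar> \<le> durrmeyer_mean \<alpha> \<beta> n (q n) x (lower_tail (q n) a y)"
      using a x lower_tail_nonneg[OF q[of n]]
      by (intro durrmeyer_mean_abs_le[OF q[of n] ab] durrmeyer_summable_lower_tail[OF q[of n] ab]) auto
    then show "0 \<le> durrmeyer_mean \<alpha> \<beta> n (q n) x (lower_tail (q n) a y)" by linarith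
  qed
  show ?thesis by (rule tendsto_sandwich[OF lower upper tendsto_const lim])
qed

text \<open>
  The same choice as for the lower tail, with \<open>x < z < y\<close>; the bases are close to \<open>z / y\<close> and \<open>x / z\<close>.
\<close>

lemma upper_tail_tendsto_0:
  assumes x: "0 < x" "x < 1" and y: "x < y" "y < 1" and b: "0 \<le> b" "b < \<beta> + 1"
  shows "(\<lambda>n. L n * durrmeyer_mean \<alpha> \<beta> n (q n) x (upper_tail (q n) \<beta> b y)) \<longlonglongrightarrow> 0"
proof -
  (* z is the midpoint of x and y; \<epsilon> is small as for the lower tail. *)
  define \<epsilon> where "\<epsilon> = (y - x) / 16"
  define z where "z = x + 8 * \<epsilon>"
  define B where "B = nat \<lceil>b\<rceil>"
  define \<kappa> where "\<kappa> = min 1 (\<beta> - b + 1)"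
  define \<rho>1 where "\<rho>1 = (z + 2 * \<epsilon>) / y"
  define \<rho>2 where "\<rho>2 = x / (z - \<epsilon>)"
  define s where "s n = nat \<lfloor>\<epsilon> * L n\<rfloor>" for n
  have \<epsilon>: "0 < \<epsilon>" "\<epsilon> \<le> 1" "y = x + 16 * \<epsilon>" using x y by (simp_all add: \<epsilon>_def field_simps)
  have B: "b \<le> real B" using real_nat_ceiling_ge by (simp add: B_def)
  have \<kappa>: "0 < \<kappa>" "\<kappa> \<le> 1" using b by (simp_all add: \<kappa>_def)
  have \<rho>1: "0 < \<rho>1" "\<rho>1 < 1" using \<epsilon> x y by (simp_all add: \<rho>1_def z_def)
  have \<rho>2: "0 < \<rho>2" "\<rho>2 < 1" using \<epsilon> x y by (simp_all add: \<rho>2_def z_def)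
  define C where "C = (2 / \<kappa>) powr b * (3 / \<kappa>) ^ B"
  let ?bound = "\<lambda>n. C * (L n powr (b + real B + 1) * \<rho>1 ^ s n) + C * (L n powr (b + real B + 1) * \<rho>2 ^ s n)"
  have "?bound \<longlonglongrightarrow> C * 0 + C * 0"
    unfolding s_def using \<epsilon>(1) \<rho>1 \<rho>2
    by (intro tendsto_intros powr_times_power_floor_tendsto_0 q_number_index_at_top)
  then have lim: "?bound \<longlonglongrightarrow> 0" by simp
  have upper: "\<forall>\<^sub>F n in sequentially. L n * durrmeyer_mean \<alpha> \<beta> n (q n) x (upper_tail (q n) \<beta> b y) \<le> ?bound n"
    using eventually_q_number_index_gt[of 1] eventually_q_number_index_gt[of "\<alpha> + \<beta> + 3 + real B"]
      eventually_q_number_index_gt[of "(\<alpha> + 2) / \<epsilon>"] eventually_gt_at_top[of 0]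
  proof eventually_elim
    case (elim n)
    define l where "l = L n"
    have l: "1 < l" "\<alpha> + \<beta> + 3 + real B < l" "\<alpha> + 2 \<le> \<epsilon> * l"
      using elim \<epsilon> by (simp_all add: l_def field_simps)
    have s: "real (s n) \<le> \<epsilon> * l" using l \<epsilon> by (simp add: s_def l_def)
    have "\<epsilon> * l \<le> 1 * l" using \<epsilon> l by (intro mult_right_mono) auto
    then have sl: "real (s n) \<le> l" using s by simp
    have zs: "(z - \<epsilon>) * l \<le> z * l - real (s n)" using s by (simp add: left_diff_distrib)
    have pos: "0 < (z - \<epsilon>) * l" using x \<epsilon> l by (simp add: z_def)
    define G where "G s = (1 + l / \<kappa>) powr b * ((l + (\<alpha> + \<beta> + 3 + real s + real B)) / \<kappa>) ^ B" for s :: nat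
    have G0: "0 \<le> G s'" for s'
      using l \<kappa> ab unfolding G_def by (intro mult_nonneg_nonneg zero_le_power divide_nonneg_nonneg) auto
    have G: "G s' \<le> C * l powr (b + real B)" if "real s' \<le> l" for s'
    proof -
      have "\<kappa> \<le> l" using l \<kappa> by simp
      then have "1 + l / \<kappa> \<le> (2 / \<kappa>) * l" using \<kappa> by (simp add: field_simps)
      then have "(1 + l / \<kappa>) powr b \<le> ((2 / \<kappa>) * l) powr b"
        using l \<kappa> b by (intro powr_mono2) auto
      moreover have "((l + (\<alpha> + \<beta> + 3 + real s' + real B)) / \<kappa>) ^ B \<le> ((3 * l) / \<kappa>) ^ B"
      proof (intro power_mono divide_right_mono divide_nonneg_nonneg)
        show "l + (\<alpha> + \<beta> + 3 + real s' + real B) \<le> 3 * l" using that l by linarith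
        show "0 \<le> l + (\<alpha> + \<beta> + 3 + real s' + real B)" using l(1) ab by linarith
        show "0 \<le> \<kappa>" "0 \<le> \<kappa>" using \<kappa> by simp_all
      qed
      moreover have "0 \<le> ((l + (\<alpha> + \<beta> + 3 + real s' + real B)) / \<kappa>) ^ B"
      proof (intro zero_le_power divide_nonneg_nonneg)
        show "0 \<le> l + (\<alpha> + \<beta> + 3 + real s' + real B)" using l(1) ab by linarith
        show "0 \<le> \<kappa>" using \<kappa> by simp
      qed
      ultimately have "G s' \<le> ((2 / \<kappa>) * l) powr b * ((3 * l) / \<kappa>) ^ B"
        unfolding G_def by (rule mult_mono[OF _ _ powr_ge_zero])
      also have "\<dots> = C * l powr (b + real B)"
      proof -
        have "((2 / \<kappa>) * l) powr b = (2 / \<kappa>) powr b * l powr b" by (rule powr_mult)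
        moreover have "((3 * l) / \<kappa>) ^ B = (3 / \<kappa>) ^ B * l powr real B"
          using l by (simp add: power_divide power_mult_distrib powr_realpow)
        ultimately show ?thesis by (simp only: C_def powr_add mult_ac)
      qed
      finally show ?thesis .
    qed
    have "durrmeyer_mean \<alpha> \<beta> n (q n) x (upper_tail (q n) \<beta> b y)
      \<le> G (s n) * ((z * l + (\<alpha> + 2 + real (s n))) / (l * y)) ^ s n
        + G 0 * (l * x / (z * l - real (s n))) ^ s n"
      unfolding l_def G_def \<kappa>_def using elim(4) x y b B zs pos
      by (intro durrmeyer_mean_upper_tail_le[OF q[of n] ab]) (auto simp: l_def)
    also have "\<dots> \<le> C * l powr (b + real B) * \<rho>1 ^ s n + C * l powr (b + real B) * \<rho>2 ^ s n"
    proof (intro add_mono mult_mono power_mono G)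
      have le1: "(z * l + (\<alpha> + 2 + real (s n))) / (l * y) \<le> ((z + 2 * \<epsilon>) * l) / (l * y)"
        using s l x y by (intro divide_right_mono) (auto simp: distrib_right)
      have eq1: "((z + 2 * \<epsilon>) * l) / (l * y) = \<rho>1" using l by (simp add: \<rho>1_def)
      show "(z * l + (\<alpha> + 2 + real (s n))) / (l * y) \<le> \<rho>1" by (rule le1[unfolded eq1])
      have le2: "l * x / (z * l - real (s n)) \<le> l * x / ((z - \<epsilon>) * l)"
        by (rule frac_le[OF _ order_refl pos zs]) (use l x in auto)
      have eq2: "l * x / ((z - \<epsilon>) * l) = \<rho>2" using l by (simp add: \<rho>2_def)
      show "l * x / (z * l - real (s n)) \<le> \<rho>2" by (rule le2[unfolded eq2])
      have "0 \<le> z * l" using l x \<epsilon> by (simp add: z_def)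
      then show "0 \<le> (z * l + (\<alpha> + 2 + real (s n))) / (l * y)"
        using l x y ab by (intro divide_nonneg_nonneg) (linarith, simp)
      show "0 \<le> l * x / (z * l - real (s n))"
        using l x zs pos by (intro divide_nonneg_nonneg mult_nonneg_nonneg) auto
      then show "0 \<le> (l * x / (z * l - real (s n))) ^ s n" by simp
      show "0 \<le> ((z * l + (\<alpha> + 2 + real (s n))) / (l * y)) ^ s n"
        using \<open>0 \<le> (z * l + (\<alpha> + 2 + real (s n))) / (l * y)\<close> by simp
      show "0 \<le> C * l powr (b + real B)" "0 \<le> C * l powr (b + real B)"
        using \<kappa> by (simp_all add: C_def)
    qed (use sl l in auto)
    finally have "l * durrmeyer_mean \<alpha> \<beta> n (q n) x (upper_tail (q n) \<beta> b y)
      \<le> l * (C * l powr (b + real B) * \<rho>1 ^ s n + C * l powr (b + real B) * \<rho>2 ^ s n)"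
      using l by (intro mult_left_mono) auto
    also have "\<dots> = C * (l powr (b + real B + 1) * \<rho>1 ^ s n) + C * (l powr (b + real B + 1) * \<rho>2 ^ s n)"
    proof -
      have "l powr (b + real B + 1) = l * l powr (b + real B)" using l by (simp add: powr_add)
      then show ?thesis by (simp only: distrib_left mult_ac)
    qed
    finally show ?case unfolding l_def .
  qed
  have lower: "\<forall>\<^sub>F n in sequentially. 0 \<le> L n * durrmeyer_mean \<alpha> \<beta> n (q n) x (upper_tail (q n) \<beta> b y)"
  proof (intro always_eventually allI mult_nonneg_nonneg)
    fix n
    show "0 \<le> L n" using q_number_nonneg[OF q[of n]] by simp
    have "\<bar>durrmeyer_mean \<alpha> \<beta> n (q n) x (\<lambda>i. 0)\<bar> \<le> durrmeyer_mean \<alpha> \<beta> n (q n) x (upper_tail (q n) \<beta> b y)"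
      using b x y upper_tail_nonneg[OF q[of n]]
      by (intro durrmeyer_mean_abs_le[OF q[of n] ab] durrmeyer_summable_upper_tail[OF q[of n] ab]) auto
    then show "0 \<le> durrmeyer_mean \<alpha> \<beta> n (q n) x (upper_tail (q n) \<beta> b y)" by linarith
  qed
  show ?thesis by (rule tendsto_sandwich[OF lower upper tendsto_const lim])
qed

text \<open>
  The nodes are \<open>q\<^bsup>i\<^esup>\<close> times a number \<open>q\<^bsup>\<beta>+1\<^esup>\<close> that tends to \<open>1\<close>, whereas the tails are cut off in terms of
  \<open>q\<^bsup>i\<^esup>\<close>. Moving the thresholds from \<open>y\<close> and \<open>z\<close> a little towards \<open>x\<close>, to \<open>y'\<close> and \<open>z'\<close>, makes up for the
  difference, and the factor \<open>2\<close> for that between \<open>t\<^bsup>-a\<^esup>\<close> and \<open>q\<^bsup>-ia\<^esup>\<close>.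
\<close>

lemma eventually_tails_dominate:
  assumes y: "0 < y" "y < y'" and z: "z' < z" and K: "0 \<le> K" and a: "0 \<le> a"
    and g: "\<And>t. 0 < t \<Longrightarrow> t < 1 \<Longrightarrow> \<bar>g t\<bar> \<le> \<eta> * (t - x)\<^sup>2
        + K * (if t \<le> y then t powr - a else 0) + K * (if z \<le> t then (1 - t) powr - b else 0)"
  shows "\<forall>\<^sub>F n in sequentially. \<forall>i. \<bar>g (node (q n) \<beta> i)\<bar> \<le> \<eta> * (node (q n) \<beta> i - x)\<^sup>2
      + (2 * K * lower_tail (q n) a y' i + K * upper_tail (q n) \<beta> b z' i)"
proof -
  have "y / y' < 1" using y by simp
  then have "\<forall>\<^sub>F n in sequentially. y / y' < q n powr (\<beta> + 1)"
    using q_powr_tendsto[of "\<beta> + 1"] by (rule order_tendstoD(1)[rotated])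
  moreover have "\<forall>\<^sub>F n in sequentially. q n powr - ((\<beta> + 1) * a) < 2"
    using q_powr_tendsto[of "- ((\<beta> + 1) * a)"] by (rule order_tendstoD(2)) simp
  ultimately show ?thesis
  proof eventually_elim
    case (elim n)
    show ?case
    proof
      fix i
      let ?t = "node (q n) \<beta> i"
      have t: "0 < ?t" "?t < 1" "?t \<le> q n ^ i" using node_bounds[OF q[of n] ab(2)] by auto
      have "(if ?t \<le> y then ?t powr - a else 0) \<le> 2 * lower_tail (q n) a y' i"
      proof (cases "?t \<le> y")
        case True
        have "q n powr (\<beta> + 1) * q n ^ i < q n powr (\<beta> + 1) * y'"
          using elim(1) y True by (simp add: node_def field_simps)
        then have "q n ^ i < y'" using q[of n] by simp
        moreover have "?t powr - a = q n powr - ((\<beta> + 1) * a) * q n powr - (real i * a)"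
          using q[of n] by (simp add: node_def powr_mult powr_powr powr_realpow[symmetric])
        moreover have "\<dots> \<le> 2 * q n powr - (real i * a)" using elim(2) by (intro mult_right_mono) auto
        ultimately show ?thesis using True by (simp add: lower_tail_def[OF q[of n]])
      next
        case False
        then show ?thesis using lower_tail_nonneg[OF q[of n], of a y' i] by simp
      qed
      then have "K * (if ?t \<le> y then ?t powr - a else 0) \<le> K * (2 * lower_tail (q n) a y' i)"
        using K by (rule mult_left_mono)
      moreover have "(if z \<le> ?t then (1 - ?t) powr - b else 0) \<le> upper_tail (q n) \<beta> b z' i"
        using t z by (simp add: upper_tail_def[OF q[of n]] node_def)
      then have "K * (if z \<le> ?t then (1 - ?t) powr - b else 0) \<le> K * upper_tail (q n) \<beta> b z' i"
        using K by (rule mult_left_mono)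
      ultimately show "\<bar>g ?t\<bar> \<le> \<eta> * (?t - x)\<^sup>2
          + (2 * K * lower_tail (q n) a y' i + K * upper_tail (q n) \<beta> b z' i)"
        using g[OF t(1,2)] by linarith
    qed
  qed
qed

section \<open>The remainder and the limit theorem\<close>

lemma summable_quadratic: "durrmeyer_summable \<alpha> \<beta> n (q n) (\<lambda>i. (node (q n) \<beta> i - x)\<^sup>2)"
proof (rule durrmeyer_summable_bounded[OF q[of n] ab])
  fix i
  have "\<bar>node (q n) \<beta> i - x\<bar> \<le> 1 + \<bar>x\<bar>" using node_bounded[of n i] by linarith
  then have "\<bar>node (q n) \<beta> i - x\<bar>\<^sup>2 \<le> (1 + \<bar>x\<bar>)\<^sup>2" by (intro power_mono) auto
  then show "\<bar>(node (q n) \<beta> i - x)\<^sup>2\<bar> \<le> (1 + \<bar>x\<bar>)\<^sup>2" by simp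
qed

lemma summable_linear: "durrmeyer_summable \<alpha> \<beta> n (q n) (\<lambda>i. node (q n) \<beta> i - x)"
proof (rule durrmeyer_summable_bounded[OF q[of n] ab])
  show "\<bar>node (q n) \<beta> i - x\<bar> \<le> 1 + \<bar>x\<bar>" for i using node_bounded[of n i] by linarith
qed

context
  fixes x a b :: real
  assumes x: "0 < x" "x < 1" and a: "0 \<le> a" "a < \<alpha> + 1" and b: "0 \<le> b" "b < \<beta> + 1"
begin

text \<open>
  By the tail estimates only the part \<open>\<eta> (t - x)\<^sup>2\<close> of the bound survives in the limit, and it
  contributes \<open>2 \<eta> x (1 - x)\<close>, with \<open>\<eta>\<close> arbitrarily small.
\<close>

lemma remainder_mean_tendsto_0:
  assumes dom: "\<And>\<eta>. 0 < \<eta> \<Longrightarrow> \<exists>y z K. 0 < y \<and> y < x \<and> x < z \<and> z < 1 \<and> 0 \<le> K \<and>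
      (\<forall>t. 0 < t \<longrightarrow> t < 1 \<longrightarrow> \<bar>g t\<bar> \<le> \<eta> * (t - x)\<^sup>2
        + K * (if t \<le> y then t powr - a else 0) + K * (if z \<le> t then (1 - t) powr - b else 0))"
  shows "\<forall>\<^sub>F n in sequentially. durrmeyer_summable \<alpha> \<beta> n (q n) (\<lambda>i. g (node (q n) \<beta> i))"
    and "(\<lambda>n. L n * durrmeyer_mean \<alpha> \<beta> n (q n) x (\<lambda>i. g (node (q n) \<beta> i))) \<longlonglongrightarrow> 0"
proof -
  have main: "(\<forall>\<^sub>F n in sequentially. durrmeyer_summable \<alpha> \<beta> n (q n) (\<lambda>i. g (node (q n) \<beta> i))) \<and>
    (\<forall>\<^sub>F n in sequentially. \<bar>L n * durrmeyer_mean \<alpha> \<beta> n (q n) x (\<lambda>i. g (node (q n) \<beta> i))\<bar> < e)"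
    if "0 < e" for e
  proof -
    (* The limit of the quadratic part is then e / 2. *)
    define \<eta> where "\<eta> = e / (2 * (2 * x * (1 - x)))"
    have pos: "0 < 2 * x * (1 - x)" using x by simp
    have "e / (2 * w) * w = e / 2" if "0 < w" for w :: real using that by simp
    from this[OF pos] have half: "\<eta> * (2 * x * (1 - x)) = e / 2" unfolding \<eta>_def .
    have \<eta>: "0 < \<eta>" "\<eta> * (2 * x * (1 - x)) < e"
      unfolding half using \<open>0 < e\<close> pos by (simp_all add: \<eta>_def)
    obtain y z K where yz: "0 < y" "y < x" "x < z" "z < 1" "0 \<le> K"
      and g: "\<And>t. 0 < t \<Longrightarrow> t < 1 \<Longrightarrow> \<bar>g t\<bar> \<le> \<eta> * (t - x)\<^sup>2
        + K * (if t \<le> y then t powr - a else 0) + K * (if z \<le> t then (1 - t) powr - b else 0)"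
      using dom[OF \<eta>(1)] by blast
    obtain y' where y': "y < y'" "y' < x" using dense[OF yz(2)] by blast
    obtain z' where z': "x < z'" "z' < z" using dense[OF yz(3)] by blast
    let ?M = "\<lambda>n. durrmeyer_mean \<alpha> \<beta> n (q n) x"
    let ?u = "\<lambda>n i. (node (q n) \<beta> i - x)\<^sup>2"
    let ?lo = "\<lambda>n. lower_tail (q n) a y'" and ?up = "\<lambda>n. upper_tail (q n) \<beta> b z'"
    let ?h = "\<lambda>n i. \<eta> * ?u n i + (2 * K * ?lo n i + K * ?up n i)"
    have Slo: "durrmeyer_summable \<alpha> \<beta> n (q n) (?lo n)" for n
      using a by (intro durrmeyer_summable_lower_tail[OF q[of n] ab])
    have Sup: "durrmeyer_summable \<alpha> \<beta> n (q n) (?up n)" for n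
      using b x z' by (intro durrmeyer_summable_upper_tail[OF q[of n] ab]) auto
    note S = durrmeyer_summable_cmult[OF q ab summable_quadratic, of _ \<eta> x]
      durrmeyer_summable_cmult[OF q ab Slo, of _ "2 * K"] durrmeyer_summable_cmult[OF q ab Sup, of _ K]
    have Sh: "durrmeyer_summable \<alpha> \<beta> n (q n) (?h n)" for n
      by (intro durrmeyer_summable_add[OF q[of n] ab] S)
    have Mh: "?M n (?h n) = \<eta> * ?M n (?u n) + (2 * K * ?M n (?lo n) + K * ?M n (?up n))" for n
      by (simp only: durrmeyer_mean_add[OF q[of n] ab S(1) durrmeyer_summable_add[OF q[of n] ab S(2,3)]]
          durrmeyer_mean_add[OF q[of n] ab S(2,3)] durrmeyer_mean_cmult[OF q[of n] ab summable_quadratic]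
          durrmeyer_mean_cmult[OF q[of n] ab Slo] durrmeyer_mean_cmult[OF q[of n] ab Sup])
    have ev: "\<forall>\<^sub>F n in sequentially. \<forall>i. \<bar>g (node (q n) \<beta> i)\<bar> \<le> ?h n i"
      using yz y' z' a by (intro eventually_tails_dominate[where y = y and z = z] g) auto
    have "(\<lambda>n. \<eta> * (L n * ?M n (?u n)) + (2 * K * (L n * ?M n (?lo n)) + K * (L n * ?M n (?up n))))
        \<longlonglongrightarrow> \<eta> * (2 * x * (1 - x)) + (2 * K * 0 + K * 0)"
      using x yz y' z' a b
      by (intro tendsto_intros central_second_moment_tendsto lower_tail_tendsto_0 upper_tail_tendsto_0) auto
    then have "(\<lambda>n. L n * ?M n (?h n)) \<longlonglongrightarrow> \<eta> * (2 * x * (1 - x))"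
      unfolding Mh by (simp add: algebra_simps)
    then have small: "\<forall>\<^sub>F n in sequentially. L n * ?M n (?h n) < e"
      using \<eta>(2) by (rule order_tendstoD)
    have "\<forall>\<^sub>F n in sequentially. durrmeyer_summable \<alpha> \<beta> n (q n) (\<lambda>i. g (node (q n) \<beta> i))"
      using ev
    proof eventually_elim
      case (elim n)
      then show ?case by (intro durrmeyer_summable_le[OF q[of n] ab Sh]) auto
    qed
    moreover have "\<forall>\<^sub>F n in sequentially. \<bar>L n * ?M n (\<lambda>i. g (node (q n) \<beta> i))\<bar> < e"
      using ev small
    proof eventually_elim
      case (elim n)
      have "\<bar>?M n (\<lambda>i. g (node (q n) \<beta> i))\<bar> \<le> ?M n (?h n)"
        using elim(1) by (intro durrmeyer_mean_abs_le[OF q[of n] ab Sh _ x]) auto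
      then have "L n * \<bar>?M n (\<lambda>i. g (node (q n) \<beta> i))\<bar> \<le> L n * ?M n (?h n)"
        using q_number_nonneg[OF q[of n], of "real n"] by (intro mult_left_mono) auto
      then show ?case
        using elim(2) q_number_nonneg[OF q[of n], of "real n"] by (simp add: abs_mult)
    qed
    ultimately show ?thesis by blast
  qed
  show "\<forall>\<^sub>F n in sequentially. durrmeyer_summable \<alpha> \<beta> n (q n) (\<lambda>i. g (node (q n) \<beta> i))"
    using main[of 1] by simp
  show "(\<lambda>n. L n * durrmeyer_mean \<alpha> \<beta> n (q n) x (\<lambda>i. g (node (q n) \<beta> i))) \<longlonglongrightarrow> 0"
    using main by (intro tendstoI) (simp add: dist_real_def)
qed

text \<open>
  The common core of the two alternatives of the theorem: it needs \<open>q\<^sub>n \<longlonglongrightarrow> 1\<close> and algebraic growth of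
  \<open>f\<close> at the end points.
\<close>

lemma q_durrmeyer_voronovskaya:
  fixes f :: "real \<Rightarrow> real"
  assumes f: "has_second_derivative_at f x" and "0 \<le> \<kappa>"
    and growth: "\<And>t. 0 < t \<Longrightarrow> t < 1 \<Longrightarrow> \<bar>f t\<bar> \<le> \<kappa> * (t powr - a * (1 - t) powr - b)"
  shows "(\<lambda>n. L n * (q_durrmeyer \<alpha> \<beta> n (q n) f x - f x))
    \<longlonglongrightarrow> deriv f x * ((\<alpha> + 1) - (\<alpha> + \<beta> + 2) * x) + deriv (deriv f) x * (x * (1 - x))"
proof -
  define d c where "d = deriv f x" and "c = deriv (deriv f) x / 2"
  define g where "g t = f t - f x - d * (t - x) - c * (t - x)\<^sup>2" for t
  let ?M = "\<lambda>n. durrmeyer_mean \<alpha> \<beta> n (q n) x" and ?t = "\<lambda>n. node (q n) \<beta>"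
  have dom: "\<exists>y z K. 0 < y \<and> y < x \<and> x < z \<and> z < 1 \<and> 0 \<le> K \<and>
      (\<forall>t. 0 < t \<longrightarrow> t < 1 \<longrightarrow> \<bar>g t\<bar> \<le> \<eta> * (t - x)\<^sup>2
        + K * (if t \<le> y then t powr - a else 0) + K * (if z \<le> t then (1 - t) powr - b else 0))"
    if "0 < \<eta>" for \<eta>
    unfolding g_def d_def c_def
    by (rule taylor_remainder_growth_bound[OF x f that a(1) b(1) \<open>0 \<le> \<kappa>\<close> growth])
      (assumption | intro exI conjI allI impI)+
  have remainder: "\<forall>\<^sub>F n in sequentially. durrmeyer_summable \<alpha> \<beta> n (q n) (\<lambda>i. g (?t n i))"
    "(\<lambda>n. L n * ?M n (\<lambda>i. g (?t n i))) \<longlonglongrightarrow> 0"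
    using dom by (intro remainder_mean_tendsto_0; blast)+
  have "(\<lambda>n. d * (L n * (?M n (?t n) - x)) + (c * (L n * ?M n (\<lambda>i. (?t n i - x)\<^sup>2)) + L n * ?M n (\<lambda>i. g (?t n i))))
      \<longlonglongrightarrow> d * ((\<alpha> + 1) - (\<alpha> + \<beta> + 2) * x) + (c * (2 * x * (1 - x)) + 0)"
    using x by (intro tendsto_intros first_moment_tendsto central_second_moment_tendsto remainder(2))
  moreover have "\<forall>\<^sub>F n in sequentially.
      d * (L n * (?M n (?t n) - x)) + (c * (L n * ?M n (\<lambda>i. (?t n i - x)\<^sup>2)) + L n * ?M n (\<lambda>i. g (?t n i)))
      = L n * (q_durrmeyer \<alpha> \<beta> n (q n) f x - f x)"
    using remainder(1)
  proof eventually_elim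
    case (elim n)
    note S1 = durrmeyer_summable_cmult[OF q[of n] ab summable_linear, of d x]
    note S2 = durrmeyer_summable_cmult[OF q[of n] ab summable_quadratic, of c x]
    note S0 = durrmeyer_summable_bounded[OF q[of n] ab, of "\<lambda>i. f x" "\<bar>f x\<bar>" n, OF order_refl]
    have "(\<lambda>i. f (?t n i)) = (\<lambda>i. f x + (d * (?t n i - x) + (c * (?t n i - x)\<^sup>2 + g (?t n i))))"
      by (simp add: g_def)
    then have "q_durrmeyer \<alpha> \<beta> n (q n) f x
        = ?M n (\<lambda>i. f x + (d * (?t n i - x) + (c * (?t n i - x)\<^sup>2 + g (?t n i))))"
      by (simp only: q_durrmeyer_eq_durrmeyer_mean[OF q[of n]])
    also have "\<dots> = ?M n (\<lambda>i. f x) + (?M n (\<lambda>i. d * (?t n i - x)) + (?M n (\<lambda>i. c * (?t n i - x)\<^sup>2) + ?M n (\<lambda>i. g (?t n i))))"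
      unfolding durrmeyer_mean_add[OF q[of n] ab S0 durrmeyer_summable_add[OF q[of n] ab S1 durrmeyer_summable_add[OF q[of n] ab S2 elim]]]
        durrmeyer_mean_add[OF q[of n] ab S1 durrmeyer_summable_add[OF q[of n] ab S2 elim]]
        durrmeyer_mean_add[OF q[of n] ab S2 elim] ..
    also have "\<dots> = f x + (d * (?M n (?t n) - x) + (c * ?M n (\<lambda>i. (?t n i - x)\<^sup>2) + ?M n (\<lambda>i. g (?t n i))))"
      by (simp only: durrmeyer_mean_const[OF q[of n] ab x] linear_moment[OF x]
          durrmeyer_mean_cmult[OF q[of n] ab summable_linear] durrmeyer_mean_cmult[OF q[of n] ab summable_quadratic])
    finally have eq: "q_durrmeyer \<alpha> \<beta> n (q n) f x
        = f x + (d * (?M n (?t n) - x) + (c * ?M n (\<lambda>i. (?t n i - x)\<^sup>2) + ?M n (\<lambda>i. g (?t n i))))" .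
    show ?case unfolding eq by (simp add: algebra_simps)
  qed
  ultimately have "(\<lambda>n. L n * (q_durrmeyer \<alpha> \<beta> n (q n) f x - f x))
      \<longlonglongrightarrow> d * ((\<alpha> + 1) - (\<alpha> + \<beta> + 2) * x) + (c * (2 * x * (1 - x)) + 0)"
    by (rule Lim_transform_eventually)
  then show ?thesis by (simp add: d_def c_def)
qed

end

end

lemma property_S_imp_tendsto_1:
  assumes "property_S q" "\<And>n. q n < 1"
  shows "q \<longlonglongrightarrow> 1"
proof -
  obtain N c where bound: "\<And>n. N < n \<Longrightarrow> 1 - q n < c / real n"
    using assms by (auto simp: property_S_def)
  have "\<forall>\<^sub>F n in sequentially. 1 - c / real n \<le> q n"
    using eventually_gt_at_top[of N] by eventually_elim (use bound in \<open>simp add: algebra_simps less_imp_le\<close>)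
  moreover have "(\<lambda>n. 1 - c / real n) \<longlonglongrightarrow> 1 - 0"
    by (intro tendsto_intros lim_const_over_n)
  ultimately show ?thesis
    using assms(2) by (intro tendsto_sandwich[of "\<lambda>n. 1 - c / real n" q _ "\<lambda>n. 1"]) (auto simp: less_imp_le)
qed

lemma jacobi_operator_eq:
  fixes f :: "real \<Rightarrow> real"
  assumes "0 < x" "x < 1" "has_second_derivative_at f x"
  shows "deriv (\<lambda>t. t powr (\<alpha> + 1) * (1 - t) powr (\<beta> + 1) * deriv f t) x / (x powr \<alpha> * (1 - x) powr \<beta>)
    = deriv f x * ((\<alpha> + 1) - (\<alpha> + \<beta> + 2) * x) + deriv (deriv f) x * (x * (1 - x))"
proof -
  have "(deriv f has_field_derivative deriv (deriv f) x) (at x)"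
    using assms DERIV_deriv_iff_real_differentiable by (auto simp: has_second_derivative_at_def)
  then have "((\<lambda>t. t powr (\<alpha> + 1) * (1 - t) powr (\<beta> + 1) * deriv f t) has_field_derivative
      ((\<alpha> + 1) * x powr \<alpha> * (1 - x) powr (\<beta> + 1) - x powr (\<alpha> + 1) * ((\<beta> + 1) * (1 - x) powr \<beta>)) * deriv f x
      + x powr (\<alpha> + 1) * (1 - x) powr (\<beta> + 1) * deriv (deriv f) x) (at x)"
    using assms by (auto intro!: derivative_eq_intros simp: algebra_simps)
  then have "deriv (\<lambda>t. t powr (\<alpha> + 1) * (1 - t) powr (\<beta> + 1) * deriv f t) x =
      ((\<alpha> + 1) * x powr \<alpha> * (1 - x) powr (\<beta> + 1) - x powr (\<alpha> + 1) * ((\<beta> + 1) * (1 - x) powr \<beta>)) * deriv f x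
      + x powr (\<alpha> + 1) * (1 - x) powr (\<beta> + 1) * deriv (deriv f) x"
    by (rule DERIV_imp_deriv)
  also have "\<dots> = (x powr \<alpha> * (1 - x) powr \<beta>)
      * (deriv f x * ((\<alpha> + 1) - (\<alpha> + \<beta> + 2) * x) + deriv (deriv f) x * (x * (1 - x)))"
    using assms by (simp add: powr_add algebra_simps)
  finally show ?thesis using assms by simp
qed

theorem theorem4:
  fixes \<alpha> \<beta> x :: real and q :: "nat \<Rightarrow> real" and f :: "real \<Rightarrow> real"
  assumes "\<alpha> > -1" and "\<beta> > -1"
    and "x \<in> {0<..<1}"
    and "\<And>n. q n \<in> {0<..<1}"
    and "has_second_derivative_at f x"
    and "(bounded (f ` {0..1}) \<and> q \<longlonglongrightarrow> 1) \<or>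
         ((\<exists>\<alpha>' \<beta>' \<kappa>'. \<alpha>' \<ge> 0 \<and> \<beta>' \<ge> 0 \<and> \<kappa>' > 0 \<and>
             (\<forall>t\<in>{0<..<1}. \<bar>t powr \<alpha>' * (1 - t) powr \<beta>' * f t\<bar> \<le> \<kappa>') \<and>
             \<alpha>' < \<alpha> + 1 \<and> \<beta>' < \<beta> + 1) \<and> property_S q)"
  shows "(\<lambda>n. q_number (q n) (real n) * (q_durrmeyer \<alpha> \<beta> n (q n) f x - f x))
    \<longlonglongrightarrow> deriv (\<lambda>t. t powr (\<alpha> + 1) * (1 - t) powr (\<beta> + 1) * deriv f t) x
          / (x powr \<alpha> * (1 - x) powr \<beta>)"
proof -
  have x: "0 < x" "x < 1" and q: "\<And>n. 0 < q n" "\<And>n. q n < 1" using assms(3,4) by auto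
  have lim: "q \<longlonglongrightarrow> 1" using assms(6) property_S_imp_tendsto_1[of q] q(2) by blast
  have "\<exists>a b \<kappa>. 0 \<le> a \<and> a < \<alpha> + 1 \<and> 0 \<le> b \<and> b < \<beta> + 1 \<and> 0 \<le> \<kappa> \<and>
      (\<forall>t. 0 < t \<longrightarrow> t < 1 \<longrightarrow> \<bar>f t\<bar> \<le> \<kappa> * (t powr - a * (1 - t) powr - b))"
    using assms(6)
  proof (elim disjE conjE exE)
    assume "bounded (f ` {0..1})"
    then obtain \<kappa> where \<kappa>: "\<And>t. t \<in> {0..1} \<Longrightarrow> \<bar>f t\<bar> \<le> \<kappa>"
      unfolding bounded_iff real_norm_def by blast
    have "0 \<le> \<kappa>" using \<kappa>[of 0] by simp
    then show ?thesis using \<kappa> assms(1,2) by (intro exI[of _ 0] exI[of _ \<kappa>]) auto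
  next
    fix a b \<kappa>
    assume ab: "0 \<le> a" "0 \<le> b" "a < \<alpha> + 1" "b < \<beta> + 1" and "0 < \<kappa>"
      and bound: "\<forall>t\<in>{0<..<1}. \<bar>t powr a * (1 - t) powr b * f t\<bar> \<le> \<kappa>"
    have "\<bar>f t\<bar> \<le> \<kappa> * (t powr - a * (1 - t) powr - b)" if "0 < t" "t < 1" for t
      using bound[rule_format, of t] that by (simp add: abs_mult powr_minus field_simps)
    then show ?thesis using ab \<open>0 < \<kappa>\<close> by (intro exI[of _ a] exI[of _ b] exI[of _ \<kappa>]) auto
  qed
  then obtain a b \<kappa> where "0 \<le> a" "a < \<alpha> + 1" "0 \<le> b" "b < \<beta> + 1" "0 \<le> \<kappa>"
    and "\<And>t. 0 < t \<Longrightarrow> t < 1 \<Longrightarrow> \<bar>f t\<bar> \<le> \<kappa> * (t powr - a * (1 - t) powr - b)" by blast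
  then show ?thesis
    unfolding jacobi_operator_eq[OF x assms(5)]
    by (intro q_durrmeyer_voronovskaya[OF q lim assms(1,2) x _ _ _ _ assms(5)])
qed

end
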